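(* The following holds conditioned on the event that all the weights are smaller than $n^{\alpha}$, with $\alpha=1/8$. For each $n$, let $G$ be an instance of the degree-corrected stochastic block model on $n$ vertices (see context). Let $s\in\{1,\dots,q\}$. Let $u$ be a uniformly picked vertex in $V(G)$. Let $A=A(G)$, $B=B(G)$, $C=C(G)\subset V(G)$ be a (random) partition of $V(G)$, with $u\in A$, such that $B$ separates $A$ and $C$ in $G$. Assume that $|A\cup B|\le n^{1/9}$ for asymptotically almost every realization of $G$. Then there exist a sequence of events $(\Omega_n)_n$ and a sequence of non-negative real numbers $(\epsilon(n))_n$ such that $\mathbb P(\Omega_n)=1-o_n(1)$ and $\epsilon(n)=o_n(1)$, and further, for each $n$, $$\left|\mathbb P\left(\sigma_u=s\,\middle|\,\sigma_{B\cup C},G,\phi\right)-\mathbb P\left(\sigma_u=s\,\middle|\,\sigma_B,G_{A\cup B},\phi_{A\cup B}\right)\right|\le\epsilon(n)\qquad\text{on }\Omega_n.$$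
   Context: Degree-corrected stochastic block model (DC-SBM). Fix an integer $q\ge 2$, constants $a,b>0$, a constant $\phi_{\min}\in(0,\infty)$ and a probability law $\nu$ with support in a set $W\subset[\phi_{\min},\infty)$, all independent of $n$. It is assumed that there is an exponent $\beta>8$ such that $\nu([k,\infty))\le k^{-\beta}$ for all large enough $k$. The graph $G=G(n)$ has vertex set $V(G)=\{1,\dots,n\}$. Each vertex $w$ has a spin $\sigma_w$ drawn independently and uniformly from $\{1,\dots,q\}$ and a weight $\phi_w$; the weights are i.i.d. with law $\nu$ and independent of the spins. Conditionally on spins and weights, each pair of distinct vertices $w,w'$ is joined by an edge, independently of other pairs, with probability $\frac{\phi_w\phi_{w'}}{n}a$ if $\sigma_w=\sigma_{w'}$ and $\frac{\phi_w\phi_{w'}}{n}b$ otherwise (read as $1$ if exceeding $1$). Notation. $\phi=(\phi_1,\dots,\phi_n)$; for $U\subset V(G)$, $\sigma_U=\{\sigma_w\}_{w\in U}$, $\phi_U=\{\phi_w\}_{w\in U}$, and $G_U$ is the restriction of $G$ to $U$. "$B$ separates $A$ and $C$" means that every path in $G$ from $A$ to $C$ passes through $B$; in particular there are no edges between $A$ and $C$. The sets $A,B,C$ are determined by the graph $G$ together with the marked vertex $u$, whose identity is treated as known in the conditional probabilities. "For asymptotically almost every realization" means with probability tending to $1$ as $n\to\infty$. *)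

theory Defs
  imports "HOL-Probability.Probability"
begin

text \<open>A graph is its vertex set together with its set of unordered edges.\<close>

type_synonym graph = "nat set \<times> nat set set"

definition simple_graphs :: "nat \<Rightarrow> graph set" where
  "simple_graphs n = {(V, E). V = {1..n} \<and> E \<subseteq> {{w, w'} | w w'. w \<in> V \<and> w' \<in> V \<and> w \<noteq> w'}}"

definition induced :: "graph \<Rightarrow> nat set \<Rightarrow> graph" where
  "induced G U = (U, {e \<in> snd G. e \<subseteq> U})"

definition is_path :: "graph \<Rightarrow> nat list \<Rightarrow> bool" where
  "is_path G p \<longleftrightarrow>
     p \<noteq> [] \<and> distinct p \<and> set p \<subseteq> fst G \<and> successively (\<lambda>x y. {x, y} \<in> snd G) p"

definition separates :: "graph \<Rightarrow> nat set \<Rightarrow> nat set \<Rightarrow> nat set \<Rightarrow> bool" where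
  "separates G B A C \<longleftrightarrow>
     (\<forall>p. is_path G p \<and> hd p \<in> A \<and> last p \<in> C \<longrightarrow> set p \<inter> B \<noteq> {})"

definition vertex_pairs :: "nat \<Rightarrow> (nat \<times> nat) set" where
  "vertex_pairs n = {(w, w'). w \<in> {1..n} \<and> w' \<in> {1..n} \<and> w < w'}"

definition edge_prob ::
  "nat \<Rightarrow> real \<Rightarrow> real \<Rightarrow> (nat \<Rightarrow> nat) \<Rightarrow> (nat \<Rightarrow> real) \<Rightarrow> nat \<Rightarrow> nat \<Rightarrow> real" where
  "edge_prob n a b \<sigma> \<phi> w w' =
     min 1 (\<phi> w * \<phi> w' / real n * (if \<sigma> w = \<sigma> w' then a else b))"

text \<open>The conditional law of the graph given the spins and the weights.\<close>

definition graph_law ::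
  "nat \<Rightarrow> real \<Rightarrow> real \<Rightarrow> (nat \<Rightarrow> nat) \<Rightarrow> (nat \<Rightarrow> real) \<Rightarrow> graph pmf" where
  "graph_law n a b \<sigma> \<phi> =
     map_pmf (\<lambda>X. ({1..n}, {{w, w'} | w w'. (w, w') \<in> vertex_pairs n \<and> X (w, w')}))
       (Pi_pmf (vertex_pairs n) False (\<lambda>(w, w'). bernoulli_pmf (edge_prob n a b \<sigma> \<phi> w w')))"

text \<open>A sample consists of the spins, the weights, the graph and the marked vertex.\<close>

type_synonym sample = "(nat \<Rightarrow> nat) \<times> (nat \<Rightarrow> real) \<times> graph \<times> nat"

definition sample_space :: "nat \<Rightarrow> sample measure" where
  "sample_space n =
     PiM {1..n} (\<lambda>_. count_space UNIV) \<Otimes>\<^sub>M PiM {1..n} (\<lambda>_. borel) \<Otimes>\<^sub>M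
     count_space UNIV \<Otimes>\<^sub>M count_space UNIV"

definition dcsbm :: "nat \<Rightarrow> real \<Rightarrow> real \<Rightarrow> real measure \<Rightarrow> nat \<Rightarrow> sample measure" where
  "dcsbm q a b \<nu> n = do {
     \<sigma> \<leftarrow> PiM {1..n} (\<lambda>_. measure_pmf (pmf_of_set {1..q}));
     \<phi> \<leftarrow> PiM {1..n} (\<lambda>_. \<nu>);
     G \<leftarrow> measure_pmf (graph_law n a b \<sigma> \<phi>);
     u \<leftarrow> measure_pmf (pmf_of_set {1..n});
     return (sample_space n) (\<sigma>, \<phi>, G, u)
   }"

text \<open>
  The model conditioned on all weights being smaller than \<open>n\<^sup>\<alpha>\<close>. For any \<open>n\<close>
  for which this event has probability zero, the result is the zero measure.
\<close>

definition dcsbm_trunc ::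
  "nat \<Rightarrow> real \<Rightarrow> real \<Rightarrow> real measure \<Rightarrow> real \<Rightarrow> nat \<Rightarrow> sample measure" where
  "dcsbm_trunc q a b \<nu> \<alpha> n =
     uniform_measure (dcsbm q a b \<nu> n)
       {(\<sigma>, \<phi>, G, u) \<in> space (sample_space n). \<forall>w\<in>{1..n}. \<phi> w < real n powr \<alpha>}"

text \<open>
  The sigma-algebra generated by the marked vertex \<open>u\<close>, the spins \<open>\<sigma>\<^sub>S\<close>, the graph \<open>G\<^sub>U\<close> and the
  weights \<open>\<phi>\<^sub>U\<close>, where \<open>S\<close> and \<open>U\<close> are vertex sets depending on the graph and on \<open>u\<close>. Each
  restricted family reveals its own index set: \<open>\<sigma>\<^sub>S\<close> is the partial map with domain \<open>S\<close>, and
  \<open>G\<^sub>U\<close> has vertex set \<open>U\<close>, so the zeros that pad \<open>\<phi>\<^sub>U\<close> outside \<open>U\<close> carry no information.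
\<close>

definition observed ::
  "nat \<Rightarrow> (graph \<Rightarrow> nat \<Rightarrow> nat set) \<Rightarrow> (graph \<Rightarrow> nat \<Rightarrow> nat set) \<Rightarrow> sample measure" where
  "observed n S U =
     vimage_algebra (space (sample_space n))
       (\<lambda>(\<sigma>, \<phi>, G, u).
          (u, (Some \<circ> \<sigma>) |` S G u, induced G (U G u),
           \<lambda>w\<in>{1..n}. if w \<in> U G u then \<phi> w else 0))
       (count_space UNIV \<Otimes>\<^sub>M count_space UNIV \<Otimes>\<^sub>M count_space UNIV \<Otimes>\<^sub>M PiM {1..n} (\<lambda>_. borel))"

definition cprob :: "'a measure \<Rightarrow> 'a measure \<Rightarrow> 'a set \<Rightarrow> 'a \<Rightarrow> real" where
  "cprob M F X = real_cond_exp M F (indicator X)"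

definition marked_spin :: "nat \<Rightarrow> nat \<Rightarrow> sample set" where
  "marked_spin n s = {(\<sigma>, \<phi>, G, u) \<in> space (sample_space n). \<sigma> u = s}"

end

theory Submission
  imports Defs "HOL-Real_Asymp.Real_Asymp"
begin

text \<open>
  Write \<open>h\<close> for the local posterior of \<open>\<sigma>\<^sub>u\<close>: sum the likelihood of the pairs inside \<open>A \<union> B\<close> over all
  spins in \<open>A\<close>, keeping the spins in \<open>B\<close>, and normalise. Both conditional probabilities are close to
  \<open>h\<close> in mean, so their difference tends to zero in probability.

  Given the spins outside \<open>A\<close>, the graph and the weights, the exact posterior of \<open>\<sigma>\<^sub>u\<close> is the same
  ratio with an additional factor, the probability that there is no edge between \<open>A\<close> and \<open>C\<close>
  (\<open>pair_lik_split\<close>). To first order this probability is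
  \<open>exp (- (\<Sum>w\<in>A. \<phi> w * f\<^sub>w) / n)\<close>, where the field \<open>f\<^sub>w\<close> sums \<open>\<phi> w'\<close> times \<open>a\<close> or \<open>b\<close> over the
  vertices \<open>w'\<close> in \<open>C\<close>. As \<open>A \<union> B\<close> is small, \<open>C\<close> may be replaced by the set of all vertices, and then the
  field concentrates around a value that is the same for all spins of \<open>w\<close>, by Hoeffding's inequality
  (\<open>deviation_prob\<close>). Hence the additional factor is almost constant in the spins in \<open>A\<close> and cancels
  in the ratio (\<open>prod_one_minus_bounds\<close>, \<open>weighted_mean_perturb\<close>).

  The sets \<open>A\<close>, \<open>B\<close> and \<open>C\<close> depend on the whole graph, so the law of the spins given only the
  graph inside \<open>A \<union> B\<close> has no simple formula. It is not needed. Let \<open>Z\<close> be the sign of the difference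
  between one of the two conditional probabilities and \<open>h\<close>. It is measurable with respect to the
  conditioning sigma-algebra, which does not reveal the spins in \<open>A\<close>, so \<open>Z\<close> does not depend on
  them. When tested against \<open>Z\<close>, the conditional probability may be replaced by the indicator of the
  event, and this by the exact posterior, by resampling the spins in \<open>A\<close> (\<open>sum_resample\<close>). So the
  mean distance to \<open>h\<close> is at most that between the exact and the local posterior
  (\<open>posterior_L1_error\<close>), which is small on the typical event. Markov's inequality concludes.
\<close>

section \<open>The law of the graph and measurability of discrete data\<close>

lemma finite_simple_graphs: "finite (simple_graphs n)"
proof (rule finite_subset)
  show "simple_graphs n \<subseteq> {{1..n}} \<times> Pow (Pow {1..n})"
    by (auto simp: simple_graphs_def)
qed simp

lemma finite_vertex_pairs: "finite (vertex_pairs n)"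
  by (rule finite_subset[of _ "{1..n} \<times> {1..n}"]) (auto simp: vertex_pairs_def)

text \<open>
  The conditional probability of what \<open>G\<close> shows at a single pair of vertices: an edge or a
  non-edge. It is written as a mass of a Bernoulli law, so that it is nonnegative also for the
  null set of negative weights.
\<close>

definition edge_factor ::
  "nat \<Rightarrow> real \<Rightarrow> real \<Rightarrow> graph \<Rightarrow> (nat \<Rightarrow> nat) \<Rightarrow> (nat \<Rightarrow> real) \<Rightarrow> nat \<times> nat \<Rightarrow> real" where
  "edge_factor n a b G \<sigma> \<phi> = (\<lambda>(w, w').
     pmf (bernoulli_pmf (edge_prob n a b \<sigma> \<phi> w w')) ({w, w'} \<in> snd G))"

text \<open>The likelihood of \<open>G\<close> restricted to a set \<open>P\<close> of pairs of vertices.\<close>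

definition pair_lik ::
  "nat \<Rightarrow> real \<Rightarrow> real \<Rightarrow> graph \<Rightarrow> (nat \<times> nat) set \<Rightarrow> (nat \<Rightarrow> nat) \<Rightarrow> (nat \<Rightarrow> real) \<Rightarrow> real" where
  "pair_lik n a b G P \<sigma> \<phi> = (\<Prod>e\<in>P. edge_factor n a b G \<sigma> \<phi> e)"

lemma pair_lik_nonneg: "pair_lik n a b G P \<sigma> \<phi> \<ge> 0"
  unfolding pair_lik_def edge_factor_def by (intro prod_nonneg) auto

lemma pmf_graph_law:
  assumes "G \<in> simple_graphs n"
  shows "pmf (graph_law n a b \<sigma> \<phi>) G = pair_lik n a b G (vertex_pairs n) \<sigma> \<phi>"
proof -
  let ?P = "Pi_pmf (vertex_pairs n) False (\<lambda>(w, w'). bernoulli_pmf (edge_prob n a b \<sigma> \<phi> w w'))"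
  let ?f = "\<lambda>X. ({1..n}, {{w, w'} | w w'. (w, w') \<in> vertex_pairs n \<and> X (w, w')})"
  let ?X = "\<lambda>(w, w'). (w, w') \<in> vertex_pairs n \<and> {w, w'} \<in> snd G"
  have E: "{{w, w'} | w w'. (w, w') \<in> vertex_pairs n \<and> ?X (w, w')} = snd G"
  proof
    show "snd G \<subseteq> {{w, w'} | w w'. (w, w') \<in> vertex_pairs n \<and> ?X (w, w')}"
    proof
      fix e assume e: "e \<in> snd G"
      with assms obtain w w' where w: "e = {w, w'}" "w \<in> {1..n}" "w' \<in> {1..n}" "w \<noteq> w'"
        unfolding simple_graphs_def by (cases G) auto
      show "e \<in> {{w, w'} | w w'. (w, w') \<in> vertex_pairs n \<and> ?X (w, w')}"
      proof (cases "w < w'")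
        case True
        then show ?thesis using w e by (auto simp: vertex_pairs_def)
      next
        case False
        with w have "e = {w', w}" "(w', w) \<in> vertex_pairs n" by (auto simp: vertex_pairs_def)
        then show ?thesis using e by auto
      qed
    qed
  qed auto
  have fX: "?f ?X = G"
    using E assms unfolding simple_graphs_def by (cases G) auto
  have inj: "X = (\<lambda>(w, w'). (w, w') \<in> vertex_pairs n \<and> {w, w'} \<in> snd G)" if "?f X = G" "\<forall>x. x \<notin> vertex_pairs n \<longrightarrow> X x = False" for X
  proof
    fix x :: "nat \<times> nat"
    obtain w w' where x: "x = (w, w')" by (cases x)
    show "X x = ?X x"
    proof (cases "x \<in> vertex_pairs n")
      case True
      then have l: "w < w'" using x by (auto simp: vertex_pairs_def)
      have "{w, w'} \<in> snd G \<longleftrightarrow>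
          (\<exists>v v'. {w, w'} = {v, v'} \<and> (v, v') \<in> vertex_pairs n \<and> X (v, v'))"
        unfolding that(1)[symmetric] snd_conv mem_Collect_eq ..
      also have "\<dots> \<longleftrightarrow> X (w, w')"
      proof
        assume "\<exists>v v'. {w, w'} = {v, v'} \<and> (v, v') \<in> vertex_pairs n \<and> X (v, v')"
        then show "X (w, w')" using l by (auto simp: doubleton_eq_iff vertex_pairs_def)
      next
        assume "X (w, w')"
        then show "\<exists>v v'. {w, w'} = {v, v'} \<and> (v, v') \<in> vertex_pairs n \<and> X (v, v')"
          using True x by (intro exI[of _ w] exI[of _ w']) simp
      qed
      finally show ?thesis using True x by simp
    next
      case False
      then show ?thesis using that(2) x by auto
    qed
  qed
  define X0 where "X0 = ?X"
  define f where "f = ?f"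
  have fX0: "f X0 = G" unfolding f_def X0_def by (rule fX)
  have injX0: "X = X0" if "f X = G" "\<forall>x. x \<notin> vertex_pairs n \<longrightarrow> X x = False" for X
    unfolding X0_def using that(1) unfolding f_def by (rule inj[OF _ that(2)])
  have "pmf (graph_law n a b \<sigma> \<phi>) G = measure (measure_pmf ?P) (f -` {G})"
    unfolding graph_law_def pmf_map f_def ..
  also have "\<dots> = measure (measure_pmf ?P) {X0}"
  proof (rule measure_pmf.finite_measure_eq_AE)
    have "X \<in> f -` {G} \<longleftrightarrow> X \<in> {X0}" if "X \<in> set_pmf ?P" for X
    proof -
      have "X \<in> {f. \<forall>x. x \<notin> vertex_pairs n \<longrightarrow> f x = False}"
        by (rule subsetD[OF set_Pi_pmf_subset[OF finite_vertex_pairs] that])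
      then show ?thesis
        using fX0 injX0[of X] by blast
    qed
    then show "AE X in measure_pmf ?P. (X \<in> f -` {G}) = (X \<in> {X0})"
      unfolding AE_measure_pmf_iff by blast
  qed auto
  also have "\<dots> = pmf ?P X0" by (simp add: measure_pmf_single)
  also have "\<dots> = (\<Prod>e\<in>vertex_pairs n. pmf (case e of (w, w') \<Rightarrow>
      bernoulli_pmf (edge_prob n a b \<sigma> \<phi> w w')) (X0 e))"
    by (rule pmf_Pi'[OF finite_vertex_pairs]) (simp add: split_beta X0_def)
  also have "\<dots> = pair_lik n a b G (vertex_pairs n) \<sigma> \<phi>"
    unfolding pair_lik_def edge_factor_def
    by (rule prod.cong[OF refl]) (simp add: split_beta X0_def)
  finally show ?thesis .
qed

lemma set_pmf_graph_law: "set_pmf (graph_law n a b \<sigma> \<phi>) \<subseteq> simple_graphs n"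
proof
  fix G assume "G \<in> set_pmf (graph_law n a b \<sigma> \<phi>)"
  then obtain X :: "nat \<times> nat \<Rightarrow> bool"
    where G: "G = ({1..n}, {{w, w'} | w w'. (w, w') \<in> vertex_pairs n \<and> X (w, w')})"
    by (auto simp: graph_law_def)
  have "{w, w'} \<in> {{w, w'} | w w'. w \<in> {1..n} \<and> w' \<in> {1..n} \<and> w \<noteq> w'}" if "(w, w') \<in> vertex_pairs n" for w w'
    using that unfolding vertex_pairs_def by blast
  then show "G \<in> simple_graphs n"
    unfolding G simple_graphs_def by blast
qed

lemma pmf_bernoulli_clamp: "pmf (bernoulli_pmf p) x = (if x then min 1 (max 0 p) else 1 - min 1 (max 0 p))"
  by (simp add: bernoulli_pmf.rep_eq)

lemma measurable_edge_factor:
  assumes "e \<in> vertex_pairs n"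
  shows "(\<lambda>(\<sigma>, \<phi>). edge_factor n a b G \<sigma> \<phi> e) \<in> borel_measurable
     (PiM {1..n} (\<lambda>_. count_space UNIV) \<Otimes>\<^sub>M PiM {1..n} (\<lambda>_. borel))"
proof -
  obtain w w' where e: "e = (w, w')" "w \<in> {1..n}" "w' \<in> {1..n}"
    using assms by (auto simp: vertex_pairs_def)
  let ?M = "PiM {1..n} (\<lambda>_. count_space (UNIV :: nat set)) \<Otimes>\<^sub>M PiM {1..n} (\<lambda>_. borel :: real measure)"
  have s: "(\<lambda>x. fst x v) \<in> ?M \<rightarrow>\<^sub>M count_space UNIV" if "v \<in> {1..n}" for v
    by (rule measurable_compose[OF measurable_fst measurable_component_singleton[OF that]])
  have p: "(\<lambda>x. snd x v) \<in> borel_measurable ?M" if "v \<in> {1..n}" for v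
    by (rule measurable_compose[OF measurable_snd measurable_component_singleton[OF that]])
  note [measurable] = s[OF e(2)] s[OF e(3)] p[OF e(2)] p[OF e(3)]
  have [measurable]: "Measurable.pred ?M (\<lambda>x. fst x w = fst x w')"
    by (rule measurable_compose_countable[OF _ s[OF e(2)], of "\<lambda>i x. i = fst x w'"],
        rule measurable_compose[OF s[OF e(3)]]) simp
  have [measurable]: "(\<lambda>x. edge_prob n a b (fst x) (snd x) w w') \<in> borel_measurable ?M"
    unfolding edge_prob_def by measurable
  show ?thesis
    unfolding e(1) edge_factor_def pmf_bernoulli_clamp split_beta' fst_conv snd_conv
    by (cases "{w, w'} \<in> snd G"; simp only: if_True if_False; measurable)
qed

lemma measurable_pair_lik:
  assumes "P \<subseteq> vertex_pairs n"
  shows "(\<lambda>(\<sigma>, \<phi>). pair_lik n a b G P \<sigma> \<phi>) \<in> borel_measurable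
     (PiM {1..n} (\<lambda>_. count_space UNIV) \<Otimes>\<^sub>M PiM {1..n} (\<lambda>_. borel))"
  unfolding pair_lik_def split_beta'
  by (intro borel_measurable_prod measurable_edge_factor[unfolded split_beta'] subsetD[OF assms])

lemma countable_PiE_nat: "countable (PiE {1..n::nat} (\<lambda>_. UNIV :: nat set))"
  by (rule countable_PiE) auto

lemma measurable_graph_kernel:
  "(\<lambda>(\<sigma>, \<phi>). measure_pmf (graph_law n a b \<sigma> \<phi>)) \<in> measurable
     (PiM {1..n} (\<lambda>_. count_space UNIV) \<Otimes>\<^sub>M PiM {1..n} (\<lambda>_. borel))
     (subprob_algebra (count_space UNIV))"
proof (rule measurable_subprob_algebra)
  fix A :: "graph set"
  have "emeasure (measure_pmf (graph_law n a b \<sigma> \<phi>)) A =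
      ennreal (\<Sum>G\<in>A \<inter> simple_graphs n. pair_lik n a b G (vertex_pairs n) \<sigma> \<phi>)" for \<sigma> \<phi>
  proof -
    have "measure (measure_pmf (graph_law n a b \<sigma> \<phi>)) A =
      measure (measure_pmf (graph_law n a b \<sigma> \<phi>)) (A \<inter> simple_graphs n)"
      by (rule measure_pmf.finite_measure_eq_AE)
         (use set_pmf_graph_law[of n a b \<sigma> \<phi>] in \<open>auto simp: AE_measure_pmf_iff\<close>)
    also have "\<dots> = (\<Sum>G\<in>A \<inter> simple_graphs n. pair_lik n a b G (vertex_pairs n) \<sigma> \<phi>)"
      by (subst measure_measure_pmf_finite) (auto simp: finite_simple_graphs pmf_graph_law)
    finally show ?thesis by (simp add: measure_pmf.emeasure_eq_measure)
  qed
  then show "(\<lambda>x. emeasure (case x of (\<sigma>, \<phi>) \<Rightarrow> measure_pmf (graph_law n a b \<sigma> \<phi>)) A) \<in>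
     borel_measurable (PiM {1..n} (\<lambda>_. count_space UNIV) \<Otimes>\<^sub>M PiM {1..n} (\<lambda>_. borel))"
    using measurable_pair_lik[OF order_refl] by (simp add: split_beta' )
qed (auto simp: measure_pmf.subprob_space_axioms)

lemma sets_PiM_nat: "sets (PiM {1..n::nat} (\<lambda>_. count_space (UNIV :: nat set))) = Pow (PiE {1..n} (\<lambda>_. UNIV))"
proof -
  have "count_space (PiE {1..n::nat} (\<lambda>_. UNIV :: nat set)) = PiM {1..n} (\<lambda>_. count_space UNIV)"
    by (subst count_space_PiM_finite) auto
  then show ?thesis by (metis sets_count_space)
qed

text \<open>
  Spin configurations and marked vertices range over countable sets, so every function of the
  discrete part of a sample is measurable, although the type of graphs is uncountable.
\<close>

lemma measurable_discrete_data:
  "(\<lambda>(\<sigma>, \<phi>, G, u). D \<sigma> G u) \<in> measurable (sample_space n) (count_space UNIV)"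
proof -
  have f: "fst \<in> sample_space n \<rightarrow>\<^sub>M count_space (PiE {1..n} (\<lambda>_. UNIV :: nat set))"
  proof -
    have "fst \<in> sample_space n \<rightarrow>\<^sub>M PiM {1..n} (\<lambda>_. count_space (UNIV :: nat set))"
      unfolding sample_space_def by (rule measurable_fst)
    also have "measurable (sample_space n) (PiM {1..n} (\<lambda>_. count_space (UNIV :: nat set))) =
        measurable (sample_space n) (count_space (PiE {1..n} (\<lambda>_. UNIV :: nat set)))"
      by (rule measurable_cong_sets) (simp_all only: sets_PiM_nat sets_count_space)
    finally show ?thesis .
  qed
  have u: "(\<lambda>\<omega>. snd (snd (snd \<omega>))) \<in> sample_space n \<rightarrow>\<^sub>M count_space UNIV"
    and G: "(\<lambda>\<omega>. fst (snd (snd \<omega>))) \<in> sample_space n \<rightarrow>\<^sub>M count_space UNIV"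
    unfolding sample_space_def by measurable
  have 1: "(\<lambda>\<omega>. D \<sigma> (fst (snd (snd \<omega>))) u) \<in> sample_space n \<rightarrow>\<^sub>M count_space UNIV" for \<sigma> u
    by (rule measurable_compose[OF G]) simp
  have 2: "(\<lambda>\<omega>. D \<sigma> (fst (snd (snd \<omega>))) (snd (snd (snd \<omega>)))) \<in> sample_space n \<rightarrow>\<^sub>M count_space UNIV" for \<sigma>
    by (rule measurable_compose_countable[OF 1 u])
  show ?thesis
    unfolding split_beta'
    by (rule measurable_compose_countable'[OF 2 f countable_PiE_nat])
qed

section \<open>Integrals over the joint law as finite sums over the discrete data\<close>

abbreviation spin_space :: "nat \<Rightarrow> (nat \<Rightarrow> nat) measure" where
  "spin_space n \<equiv> PiM {1..n} (\<lambda>_. count_space UNIV)"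

abbreviation weight_space :: "nat \<Rightarrow> (nat \<Rightarrow> real) measure" where
  "weight_space n \<equiv> PiM {1..n} (\<lambda>_. borel)"

lemma measurable_sample_kernel:
  "(\<lambda>((\<sigma>, \<phi>), G). measure_pmf p \<bind> (\<lambda>u. return (sample_space n) (\<sigma>, \<phi>, G, u))) \<in>
     ((spin_space n \<Otimes>\<^sub>M weight_space n) \<Otimes>\<^sub>M count_space UNIV) \<rightarrow>\<^sub>M subprob_algebra (sample_space n)"
  unfolding split_beta'
proof (rule measurable_bind')
  show "(\<lambda>x. measure_pmf p) \<in> ((spin_space n \<Otimes>\<^sub>M weight_space n) \<Otimes>\<^sub>M count_space UNIV) \<rightarrow>\<^sub>M subprob_algebra (count_space UNIV)"
    by (rule measurable_const) (rule measure_pmf_in_subprob_space)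
  show "(\<lambda>(x, u). return (sample_space n) (fst (fst x), snd (fst x), snd x, u)) \<in>
      ((spin_space n \<Otimes>\<^sub>M weight_space n) \<Otimes>\<^sub>M count_space UNIV) \<Otimes>\<^sub>M count_space UNIV
      \<rightarrow>\<^sub>M subprob_algebra (sample_space n)"
    unfolding split_beta'
  proof (rule measurable_compose[OF _ return_measurable])
    show "(\<lambda>x. (fst (fst (fst x)), snd (fst (fst x)), snd (fst x), snd x)) \<in>
      ((spin_space n \<Otimes>\<^sub>M weight_space n) \<Otimes>\<^sub>M count_space UNIV) \<Otimes>\<^sub>M count_space UNIV \<rightarrow>\<^sub>M sample_space n"
      unfolding sample_space_def
      by (intro measurable_Pair measurable_snd measurable_compose[OF measurable_fst] measurable_fst'' measurable_snd'' measurable_ident_sets refl)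
  qed
qed

lemma measurable_weights_kernel:
  "(\<lambda>(\<sigma>, \<phi>). measure_pmf (graph_law n a b \<sigma> \<phi>) \<bind>
     (\<lambda>G. measure_pmf p \<bind> (\<lambda>u. return (sample_space n) (\<sigma>, \<phi>, G, u)))) \<in>
     (spin_space n \<Otimes>\<^sub>M weight_space n) \<rightarrow>\<^sub>M subprob_algebra (sample_space n)"
proof -
  have "(\<lambda>x. measure_pmf (graph_law n a b (fst x) (snd x)) \<bind>
     (\<lambda>G. measure_pmf p \<bind> (\<lambda>u. return (sample_space n) (fst x, snd x, G, u)))) \<in>
     (spin_space n \<Otimes>\<^sub>M weight_space n) \<rightarrow>\<^sub>M subprob_algebra (sample_space n)"
    by (rule measurable_bind'[OF measurable_graph_kernel[unfolded split_beta']],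
        unfold split_beta', rule measurable_sample_kernel[unfolded split_beta'])
  then show ?thesis unfolding split_beta' .
qed

lemma sets_PiM_const: "sets N = sets M \<Longrightarrow> sets (PiM I (\<lambda>_. N)) = sets (PiM I (\<lambda>_. M))"
  by (rule sets_PiM_cong) auto

lemma measurable_spins_kernel:
  assumes "prob_space \<nu>" "sets \<nu> = sets borel"
  shows "(\<lambda>\<sigma>. PiM {1..n} (\<lambda>_. \<nu>) \<bind> (\<lambda>\<phi>. measure_pmf (graph_law n a b \<sigma> \<phi>) \<bind>
     (\<lambda>G. measure_pmf p \<bind> (\<lambda>u. return (sample_space n) (\<sigma>, \<phi>, G, u))))) \<in>
     spin_space n \<rightarrow>\<^sub>M subprob_algebra (sample_space n)"
proof (rule measurable_bind')
  have "prob_space (PiM {1..n} (\<lambda>_. \<nu>))" by (rule prob_space_PiM) (rule assms(1))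
  then show "(\<lambda>\<sigma>. PiM {1..n} (\<lambda>_. \<nu>)) \<in> spin_space n \<rightarrow>\<^sub>M subprob_algebra (weight_space n)"
    by (intro measurable_const)
       (auto simp: space_subprob_algebra prob_space_imp_subprob_space sets_PiM_const[OF assms(2)])
qed (rule measurable_weights_kernel)

lemma space_sample_space: "space (sample_space n) = PiE {1..n} (\<lambda>_. UNIV) \<times> PiE {1..n} (\<lambda>_. UNIV) \<times> UNIV \<times> UNIV"
  by (simp add: sample_space_def space_pair_measure space_PiM)

lemma
  assumes "prob_space \<nu>" "sets \<nu> = sets borel"
  shows sets_dcsbm: "sets (dcsbm q a b \<nu> n) = sets (sample_space n)"
    and nn_integral_dcsbm_iterated: "f \<in> borel_measurable (sample_space n) \<Longrightarrow>
      (\<integral>\<^sup>+\<omega>. f \<omega> \<partial>dcsbm q a b \<nu> n) =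
      (\<integral>\<^sup>+\<sigma>. \<integral>\<^sup>+\<phi>. \<integral>\<^sup>+G. \<integral>\<^sup>+u. f (\<sigma>, \<phi>, G, u)
         \<partial>measure_pmf (pmf_of_set {1..n}) \<partial>measure_pmf (graph_law n a b \<sigma> \<phi>)
         \<partial>PiM {1..n} (\<lambda>_. \<nu>) \<partial>PiM {1..n} (\<lambda>_. measure_pmf (pmf_of_set {1..q})))"
proof -
  let ?p = "pmf_of_set {1..n}" and ?M = "PiM {1..n} (\<lambda>_. measure_pmf (pmf_of_set {1..q}))"
    and ?N = "PiM {1..n} (\<lambda>_. \<nu>)" and ?S = "sample_space n"
  have sM: "sets ?M = sets (spin_space n)" by (rule sets_PiM_const) simp
  have sN: "sets ?N = sets (weight_space n)" by (rule sets_PiM_const) (rule assms)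
  note spM = sets_eq_imp_space_eq[OF sM] and spN = sets_eq_imp_space_eq[OF sN]
  have k1: "(\<lambda>\<sigma>. ?N \<bind> (\<lambda>\<phi>. measure_pmf (graph_law n a b \<sigma> \<phi>) \<bind>
     (\<lambda>G. measure_pmf ?p \<bind> (\<lambda>u. return ?S (\<sigma>, \<phi>, G, u))))) \<in> ?M \<rightarrow>\<^sub>M subprob_algebra ?S"
    unfolding measurable_cong_sets[OF sM refl] by (rule measurable_spins_kernel[OF assms])
  have k2: "(\<lambda>\<phi>. measure_pmf (graph_law n a b \<sigma> \<phi>) \<bind>
     (\<lambda>G. measure_pmf ?p \<bind> (\<lambda>u. return ?S (\<sigma>, \<phi>, G, u)))) \<in> ?N \<rightarrow>\<^sub>M subprob_algebra ?S"
    if "\<sigma> \<in> space ?M" for \<sigma>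
    unfolding measurable_cong_sets[OF sN refl]
    using measurable_Pair2[OF measurable_weights_kernel[of n a b ?p], of \<sigma>] that spM by simp
  have k3: "(\<lambda>G. measure_pmf ?p \<bind> (\<lambda>u. return ?S (\<sigma>, \<phi>, G, u))) \<in>
      measure_pmf (graph_law n a b \<sigma> \<phi>) \<rightarrow>\<^sub>M subprob_algebra ?S"
    if "\<sigma> \<in> space ?M" "\<phi> \<in> space ?N" for \<sigma> \<phi>
    using measurable_Pair2[OF measurable_sample_kernel[of ?p n], of "(\<sigma>, \<phi>)"] that spM spN
    by (simp add: space_pair_measure)
  have mem: "(\<sigma>, \<phi>, G, u) \<in> space ?S" if "\<sigma> \<in> space ?M" "\<phi> \<in> space ?N" for \<sigma> \<phi> G u
    using that unfolding spM spN by (simp add: space_sample_space space_PiM)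
  have k4: "(\<lambda>u. return ?S (\<sigma>, \<phi>, G, u)) \<in> measure_pmf ?p \<rightarrow>\<^sub>M subprob_algebra ?S"
    if "\<sigma> \<in> space ?M" "\<phi> \<in> space ?N" for \<sigma> \<phi> G
  proof -
    have "(\<lambda>u. return ?S (\<sigma>, \<phi>, G, u)) \<in> count_space UNIV \<rightarrow>\<^sub>M subprob_algebra ?S"
      by (rule measurable_compose[OF _ return_measurable]) (use mem[OF that] in auto)
    then show ?thesis by simp
  qed
  have ne: "space ?M \<noteq> {}" unfolding spM by (simp add: space_PiM PiE_eq_empty_iff)
  show "sets (dcsbm q a b \<nu> n) = sets ?S"
    unfolding dcsbm_def by (rule sets_bind[OF sets_kernel[OF k1] ne])
  assume f: "f \<in> borel_measurable ?S"
  show "(\<integral>\<^sup>+\<omega>. f \<omega> \<partial>dcsbm q a b \<nu> n) =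
      (\<integral>\<^sup>+\<sigma>. \<integral>\<^sup>+\<phi>. \<integral>\<^sup>+G. \<integral>\<^sup>+u. f (\<sigma>, \<phi>, G, u) \<partial>?p \<partial>graph_law n a b \<sigma> \<phi> \<partial>?N \<partial>?M)"
    unfolding dcsbm_def
    by (subst nn_integral_bind[OF f k1], intro nn_integral_cong,
        subst nn_integral_bind[OF f k2], assumption, intro nn_integral_cong,
        subst nn_integral_bind[OF f k3], assumption+, intro nn_integral_cong,
        subst nn_integral_bind[OF f k4], assumption+, intro nn_integral_cong,
        subst nn_integral_return[OF mem f]) auto
qed

text \<open>The spin configurations of positive probability.\<close>

definition spins :: "nat \<Rightarrow> nat \<Rightarrow> (nat \<Rightarrow> nat) set" where
  "spins q n = PiE {1..n} (\<lambda>_. {1..q})"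

lemma finite_spins: "finite (spins q n)"
  unfolding spins_def by (rule finite_PiE) auto

lemma nn_integral_spins:
  assumes q: "q \<ge> 1"
  shows "(\<integral>\<^sup>+\<sigma>. f \<sigma> \<partial>PiM {1..n} (\<lambda>_. measure_pmf (pmf_of_set {1..q}))) =
     (\<Sum>\<sigma>\<in>spins q n. f \<sigma>) * ennreal (1 / real q ^ n)"
proof -
  let ?M = "PiM {1..n} (\<lambda>_. measure_pmf (pmf_of_set {1..q}))"
  interpret product_prob_space "\<lambda>_::nat. measure_pmf (pmf_of_set {1..q})" "{1..n}" ..
  have sets: "sets ?M = Pow (PiE {1..n} (\<lambda>_. UNIV))"
    using sets_PiM_nat[of n] sets_PiM_const[of "measure_pmf (pmf_of_set {1..q})" "count_space UNIV" "{1..n}"] by simp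
  have em: "emeasure ?M {\<sigma>} = ennreal (1 / real q ^ n)" if "\<sigma> \<in> spins q n" for \<sigma>
  proof -
    have s: "\<And>i. i \<in> {1..n} \<Longrightarrow> \<sigma> i \<in> {1..q}" and "PiE {1..n} (\<lambda>i. {\<sigma> i}) = {\<sigma>}"
      using that PiE_singleton[of \<sigma> "{1..n}"] unfolding spins_def PiE_iff by blast+
    then have "emeasure ?M {\<sigma>} = (\<Prod>i\<in>{1..n}. emeasure (measure_pmf (pmf_of_set {1..q})) {\<sigma> i})"
      by (subst emeasure_PiM[symmetric]) auto
    also have "\<dots> = (\<Prod>i\<in>{1..n}. ennreal (1 / real q))"
      using s q by (intro prod.cong refl) (simp add: emeasure_pmf_single)
    also have "\<dots> = ennreal (1 / real q ^ n)"
      by (simp add: ennreal_power power_divide)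
    finally show ?thesis .
  qed
  have sing: "{\<tau>} \<in> sets ?M" if "\<tau> \<in> spins q n" for \<tau>
    using that unfolding sets spins_def PiE_def by simp
  have ae: "AE \<sigma> in ?M. \<sigma> \<in> spins q n"
  proof -
    have "AE \<sigma> in ?M. \<forall>i\<in>{1..n}. \<sigma> i \<in> {1..q}"
    proof (rule AE_finite_allI)
      fix i assume "i \<in> {1..n}"
      then show "AE \<sigma> in ?M. \<sigma> i \<in> {1..q}"
        using q by (intro AE_PiM_component) (auto simp: AE_measure_pmf_iff measure_pmf.prob_space_axioms)
    qed simp
    then show ?thesis
      using AE_space[of ?M] by eventually_elim (auto simp: spins_def space_PiM PiE_def)
  qed
  have "(\<integral>\<^sup>+\<sigma>. f \<sigma> \<partial>?M) = (\<integral>\<^sup>+\<sigma>. (\<Sum>\<tau>\<in>spins q n. f \<tau> * indicator {\<tau>} \<sigma>) \<partial>?M)"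
  proof (rule nn_integral_cong_AE, use ae in eventually_elim)
    fix \<sigma> assume "\<sigma> \<in> spins q n"
    then have "(\<Sum>\<tau>\<in>spins q n. f \<tau> * indicator {\<tau>} \<sigma>) = f \<sigma> * indicator {\<sigma>} \<sigma>"
      by (subst sum.remove[OF finite_spins]) (auto simp: indicator_def intro!: sum.neutral)
    then show "f \<sigma> = (\<Sum>\<tau>\<in>spins q n. f \<tau> * indicator {\<tau>} \<sigma>)" by simp
  qed
  also have "\<dots> = (\<Sum>\<tau>\<in>spins q n. \<integral>\<^sup>+\<sigma>. f \<tau> * indicator {\<tau>} \<sigma> \<partial>?M)"
    by (rule nn_integral_sum) (intro borel_measurable_times_ennreal borel_measurable_indicator sing borel_measurable_const)
  also have "\<dots> = (\<Sum>\<tau>\<in>spins q n. f \<tau> * ennreal (1 / real q ^ n))"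
    by (rule sum.cong[OF refl], subst nn_integral_cmult_indicator) (simp_all only: em sing)
  also have "\<dots> = (\<Sum>\<sigma>\<in>spins q n. f \<sigma>) * ennreal (1 / real q ^ n)"
    by (rule sum_distrib_right[symmetric])
  finally show ?thesis .
qed

text \<open>
  The joint probability of the spins, the graph and the marked vertex, given the weights; it does
  not depend on the marked vertex, which is uniform.
\<close>

definition cell_prob :: "nat \<Rightarrow> nat \<Rightarrow> real \<Rightarrow> real \<Rightarrow> (nat \<Rightarrow> real) \<Rightarrow> (nat \<Rightarrow> nat) \<Rightarrow> graph \<Rightarrow> real" where
  "cell_prob q n a b \<phi> \<sigma> G = pair_lik n a b G (vertex_pairs n) \<sigma> \<phi> / (real q ^ n * real n)"

lemma cell_prob_nonneg: "cell_prob q n a b \<phi> \<sigma> G \<ge> 0"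
  unfolding cell_prob_def by (simp add: pair_lik_nonneg)

lemma sum_graphs_lik: "(\<Sum>G\<in>simple_graphs n. pair_lik n a b G (vertex_pairs n) \<sigma> \<phi>) = 1"
proof -
  have "(\<Sum>G\<in>simple_graphs n. pmf (graph_law n a b \<sigma> \<phi>) G) = 1"
    by (rule sum_pmf_eq_1[OF finite_simple_graphs set_pmf_graph_law])
  then show ?thesis by (simp add: pmf_graph_law)
qed

lemma sum_cell_prob_graph:
  assumes "n \<ge> 1" "q \<ge> 1"
  shows "(\<Sum>G\<in>simple_graphs n. \<Sum>u\<in>{1..n}. cell_prob q n a b \<phi> \<sigma> G) = 1 / real q ^ n"
  using assms by (simp add: cell_prob_def sum_divide_distrib[symmetric] sum_distrib_left[symmetric] sum_graphs_lik)

lemma card_spins: "card (spins q n) = q ^ n"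
  unfolding spins_def by (simp add: card_PiE)

lemma sum_cell_prob:
  assumes "n \<ge> 1" "q \<ge> 1"
  shows "(\<Sum>\<sigma>\<in>spins q n. \<Sum>G\<in>simple_graphs n. \<Sum>u\<in>{1..n}. cell_prob q n a b \<phi> \<sigma> G) = 1"
  unfolding sum_cell_prob_graph[OF assms] using assms by (simp add: card_spins)

lemma borel_measurable_section:
  fixes f :: "sample \<Rightarrow> 'b :: topological_space"
  assumes "f \<in> borel_measurable (sample_space n)" "\<sigma> \<in> PiE {1..n} (\<lambda>_. UNIV)"
  shows "(\<lambda>\<phi>. f (\<sigma>, \<phi>, G, u)) \<in> borel_measurable (weight_space n)"
proof (rule measurable_compose[OF _ assms(1)])
  show "(\<lambda>\<phi>. (\<sigma>, \<phi>, G, u)) \<in> weight_space n \<rightarrow>\<^sub>M sample_space n"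
    unfolding sample_space_def using assms(2)
    by (intro measurable_Pair measurable_const measurable_ident_sets refl) (auto simp: space_PiM)
qed

lemma spins_PiE: "\<sigma> \<in> spins q n \<Longrightarrow> \<sigma> \<in> PiE {1..n} (\<lambda>_. UNIV)"
  by (auto simp: spins_def PiE_def)

lemma measurable_pair_lik_section:
  assumes "P \<subseteq> vertex_pairs n" "\<sigma> \<in> PiE {1..n} (\<lambda>_. UNIV)"
  shows "(\<lambda>\<phi>. pair_lik n a b G P \<sigma> \<phi>) \<in> borel_measurable (weight_space n)"
  using measurable_Pair2[OF measurable_pair_lik[OF assms(1)], of \<sigma> a b G] assms(2)
  by (simp add: space_PiM)

lemma measurable_cell_prob:
  assumes "\<sigma> \<in> PiE {1..n} (\<lambda>_. UNIV)"
  shows "(\<lambda>\<phi>. cell_prob q n a b \<phi> \<sigma> G) \<in> borel_measurable (weight_space n)"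
  unfolding cell_prob_def by (intro borel_measurable_divide measurable_pair_lik_section assms) auto

lemma nn_integral_dcsbm:
  assumes "prob_space \<nu>" "sets \<nu> = sets borel" "n \<ge> 1" "q \<ge> 1"
    and f: "f \<in> borel_measurable (sample_space n)"
  shows "(\<integral>\<^sup>+\<omega>. f \<omega> \<partial>dcsbm q a b \<nu> n) =
    (\<integral>\<^sup>+\<phi>. (\<Sum>\<sigma>\<in>spins q n. \<Sum>G\<in>simple_graphs n. \<Sum>u\<in>{1..n}.
       ennreal (cell_prob q n a b \<phi> \<sigma> G) * f (\<sigma>, \<phi>, G, u)) \<partial>PiM {1..n} (\<lambda>_. \<nu>))"
proof -
  let ?N = "PiM {1..n} (\<lambda>_. \<nu>)"
  have sN: "sets ?N = sets (weight_space n)" by (rule sets_PiM_const) (rule assms)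
  have 1: "(\<integral>\<^sup>+G. \<integral>\<^sup>+u. f (\<sigma>, \<phi>, G, u) \<partial>measure_pmf (pmf_of_set {1..n})
       \<partial>measure_pmf (graph_law n a b \<sigma> \<phi>)) * ennreal (1 / real q ^ n) =
      (\<Sum>G\<in>simple_graphs n. \<Sum>u\<in>{1..n}. ennreal (cell_prob q n a b \<phi> \<sigma> G) * f (\<sigma>, \<phi>, G, u))"
    (is "?l * _ = ?r") for \<sigma> \<phi>
  proof -
    have "?l = (\<Sum>G\<in>simple_graphs n. (\<integral>\<^sup>+u. f (\<sigma>, \<phi>, G, u) \<partial>measure_pmf (pmf_of_set {1..n})) *
        ennreal (pmf (graph_law n a b \<sigma> \<phi>) G))"
      by (rule nn_integral_measure_pmf_support[OF finite_simple_graphs])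
         (simp, blast dest: subsetD[OF set_pmf_graph_law])
    also have "\<dots> = (\<Sum>G\<in>simple_graphs n. (\<Sum>u\<in>{1..n}. f (\<sigma>, \<phi>, G, u) * ennreal (1 / real n)) *
        ennreal (pair_lik n a b G (vertex_pairs n) \<sigma> \<phi>))"
    proof (rule sum.cong[OF refl])
      fix G assume "G \<in> simple_graphs n"
      moreover have "(\<integral>\<^sup>+u. f (\<sigma>, \<phi>, G, u) \<partial>measure_pmf (pmf_of_set {1..n})) =
         (\<Sum>u\<in>{1..n}. f (\<sigma>, \<phi>, G, u) * ennreal (pmf (pmf_of_set {1..n}) u))"
        using assms by (intro nn_integral_measure_pmf_support) (auto simp: set_pmf_of_set)
      moreover have "\<dots> = (\<Sum>u\<in>{1..n}. f (\<sigma>, \<phi>, G, u) * ennreal (1 / real n))"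
        using assms by (intro sum.cong refl) simp
      ultimately show "(\<integral>\<^sup>+u. f (\<sigma>, \<phi>, G, u) \<partial>measure_pmf (pmf_of_set {1..n})) *
        ennreal (pmf (graph_law n a b \<sigma> \<phi>) G) = (\<Sum>u\<in>{1..n}. f (\<sigma>, \<phi>, G, u) * ennreal (1 / real n)) *
        ennreal (pair_lik n a b G (vertex_pairs n) \<sigma> \<phi>)" by (simp only: pmf_graph_law)
    qed
    finally have l: "?l = \<dots>" .
    have c: "ennreal (cell_prob q n a b \<phi> \<sigma> G) =
        ennreal (1 / real n) * ennreal (pair_lik n a b G (vertex_pairs n) \<sigma> \<phi>) * ennreal (1 / real q ^ n)" for G
      by (simp add: cell_prob_def ennreal_mult[symmetric] pair_lik_nonneg mult.commute)
    show ?thesis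
      unfolding l c sum_distrib_right by (intro sum.cong refl) (simp only: ac_simps)
  qed
  have m: "(\<lambda>\<phi>. \<Sum>G\<in>simple_graphs n. \<Sum>u\<in>{1..n}. ennreal (cell_prob q n a b \<phi> \<sigma> G) * f (\<sigma>, \<phi>, G, u))
      \<in> borel_measurable ?N" (is "?g \<in> _") if "\<sigma> \<in> spins q n" for \<sigma>
    unfolding measurable_cong_sets[OF sN refl]
    by (intro borel_measurable_sum borel_measurable_times_ennreal borel_measurable_section f
        spins_PiE[OF that] measurable_compose[OF measurable_cell_prob measurable_ennreal])
  have m': "(\<lambda>\<phi>. \<integral>\<^sup>+G. \<integral>\<^sup>+u. f (\<sigma>, \<phi>, G, u) \<partial>measure_pmf (pmf_of_set {1..n})
       \<partial>measure_pmf (graph_law n a b \<sigma> \<phi>)) \<in> borel_measurable ?N" (is "?h \<in> _") if "\<sigma> \<in> spins q n" for \<sigma>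
  proof -
    have "(\<lambda>\<phi>. (?h \<phi> * ennreal (1 / real q ^ n)) * ennreal (real q ^ n)) \<in> borel_measurable ?N"
      unfolding 1 by (intro borel_measurable_times_ennreal m[OF that] borel_measurable_const)
    moreover have "(?h \<phi> * ennreal (1 / real q ^ n)) * ennreal (real q ^ n) = ?h \<phi>" for \<phi>
      using assms by (simp add: mult.assoc ennreal_mult[symmetric])
    ultimately show ?thesis by simp
  qed
  show ?thesis
    unfolding nn_integral_dcsbm_iterated[OF assms(1,2) f] nn_integral_spins[OF assms(4)]
      sum_distrib_right
    by (subst nn_integral_sum, erule m, intro sum.cong refl)
       (simp only: 1[symmetric] nn_integral_multc m')
qed

lemma prob_space_dcsbm:
  assumes "prob_space \<nu>" "sets \<nu> = sets borel" "n \<ge> 1" "q \<ge> 1"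
  shows "prob_space (dcsbm q a b \<nu> n)"
proof
  let ?N = "PiM {1..n} (\<lambda>_. \<nu>)"
  interpret N: prob_space ?N by (rule prob_space_PiM) (rule assms)
  have "emeasure (dcsbm q a b \<nu> n) (space (dcsbm q a b \<nu> n)) = (\<integral>\<^sup>+\<omega>. 1 \<partial>dcsbm q a b \<nu> n)" by simp
  also have "\<dots> = (\<integral>\<^sup>+\<phi>. (\<Sum>\<sigma>\<in>spins q n. \<Sum>G\<in>simple_graphs n. \<Sum>u\<in>{1..n}.
       ennreal (cell_prob q n a b \<phi> \<sigma> G) * 1) \<partial>?N)"
    by (rule nn_integral_dcsbm[OF assms]) simp
  also have "\<dots> = (\<integral>\<^sup>+\<phi>. ennreal 1 \<partial>?N)"
    by (intro nn_integral_cong)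
       (simp only: mult_1_right sum_ennreal cell_prob_nonneg sum_nonneg sum_cell_prob[OF assms(3,4)])
  also have "\<dots> = 1" by (simp only: N.emeasure_space_1 nn_integral_const ennreal_1 mult_1_left)
  finally show "emeasure (dcsbm q a b \<nu> n) (space (dcsbm q a b \<nu> n)) = 1" .
qed

text \<open>The conditional expectation of \<open>f\<close> given the weights, as a finite sum.\<close>

definition cell_sum :: "nat \<Rightarrow> nat \<Rightarrow> real \<Rightarrow> real \<Rightarrow> (sample \<Rightarrow> real) \<Rightarrow> (nat \<Rightarrow> real) \<Rightarrow> real" where
  "cell_sum q n a b f \<phi> = (\<Sum>\<sigma>\<in>spins q n. \<Sum>G\<in>simple_graphs n. \<Sum>u\<in>{1..n}.
       cell_prob q n a b \<phi> \<sigma> G * f (\<sigma>, \<phi>, G, u))"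

lemma measurable_cell_sum:
  assumes "f \<in> borel_measurable (sample_space n)"
  shows "cell_sum q n a b f \<in> borel_measurable (weight_space n)"
  unfolding cell_sum_def
  by (intro borel_measurable_sum borel_measurable_times borel_measurable_section assms
        spins_PiE measurable_cell_prob)

lemma cell_sum_mono:
  assumes "\<And>\<sigma> G u. \<sigma> \<in> spins q n \<Longrightarrow> G \<in> simple_graphs n \<Longrightarrow> u \<in> {1..n} \<Longrightarrow>
     f (\<sigma>, \<phi>, G, u) \<le> g (\<sigma>, \<phi>, G, u)"
  shows "cell_sum q n a b f \<phi> \<le> cell_sum q n a b g \<phi>"
  unfolding cell_sum_def by (intro sum_mono mult_left_mono assms cell_prob_nonneg)

lemma cell_sum_const:
  assumes "n \<ge> 1" "q \<ge> 1"
  shows "cell_sum q n a b (\<lambda>_. c) \<phi> = c"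
proof -
  have "cell_sum q n a b (\<lambda>_. c) \<phi> = (\<Sum>\<sigma>\<in>spins q n. \<Sum>G\<in>simple_graphs n. \<Sum>u\<in>{1..n}.
       cell_prob q n a b \<phi> \<sigma> G) * c"
    unfolding cell_sum_def sum_distrib_right ..
  then show ?thesis by (simp only: sum_cell_prob[OF assms] mult_1_left)
qed

lemma cell_sum_add: "cell_sum q n a b (\<lambda>\<omega>. f \<omega> + g \<omega>) \<phi> = cell_sum q n a b f \<phi> + cell_sum q n a b g \<phi>"
  unfolding cell_sum_def by (simp add: distrib_left sum.distrib)

lemma
  assumes "prob_space \<nu>" "sets \<nu> = sets borel" "n \<ge> 1" "q \<ge> 1"
    and f: "f \<in> borel_measurable (sample_space n)"
    and bound: "\<And>\<omega>. \<omega> \<in> space (sample_space n) \<Longrightarrow> \<bar>f \<omega>\<bar> \<le> B"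
  shows integrable_cell_sum: "integrable (PiM {1..n} (\<lambda>_. \<nu>)) (cell_sum q n a b f)"
    and integral_dcsbm: "(\<integral>\<omega>. f \<omega> \<partial>dcsbm q a b \<nu> n) = (\<integral>\<phi>. cell_sum q n a b f \<phi> \<partial>PiM {1..n} (\<lambda>_. \<nu>))"
proof -
  let ?N = "PiM {1..n} (\<lambda>_. \<nu>)" and ?D = "dcsbm q a b \<nu> n"
  interpret N: prob_space ?N by (rule prob_space_PiM) (rule assms)
  interpret D: prob_space ?D by (rule prob_space_dcsbm[OF assms(1-4)])
  have sN: "sets ?N = sets (weight_space n)" by (rule sets_PiM_const) (rule assms)
  have sD: "sets ?D = sets (sample_space n)" by (rule sets_dcsbm[OF assms(1,2)])
  have fD: "f \<in> borel_measurable ?D" using f unfolding measurable_cong_sets[OF sD refl] .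
  have spD: "space ?D = space (sample_space n)" by (rule sets_eq_imp_space_eq[OF sD])
  have mem: "(\<sigma>, \<phi>, G, u) \<in> space (sample_space n)" if "\<sigma> \<in> spins q n" "\<phi> \<in> space ?N" for \<sigma> \<phi> G u
    using that spins_PiE[of \<sigma>] sets_eq_imp_space_eq[OF sN] by (simp add: space_sample_space space_PiM)
  have bound': "0 \<le> f \<omega> + B" if "\<omega> \<in> space (sample_space n)" for \<omega>
    using bound[OF that] by linarith
  have mS: "cell_sum q n a b f \<in> borel_measurable ?N"
    unfolding measurable_cong_sets[OF sN refl] by (rule measurable_cell_sum[OF f])
  have bS: "\<bar>cell_sum q n a b f \<phi>\<bar> \<le> B" if "\<phi> \<in> space ?N" for \<phi>
  proof -
    have "cell_sum q n a b f \<phi> \<le> cell_sum q n a b (\<lambda>_. B) \<phi>"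
      "cell_sum q n a b (\<lambda>_. - B) \<phi> \<le> cell_sum q n a b f \<phi>"
      using bound[OF mem[OF _ that]] by (auto intro!: cell_sum_mono simp: abs_le_iff minus_le_iff)
    then show ?thesis by (simp add: cell_sum_const[OF assms(3,4)] abs_le_iff)
  qed
  show iS: "integrable ?N (cell_sum q n a b f)"
    by (rule N.integrable_const_bound[of _ B]) (use bS mS in auto)
  have iD: "integrable ?D f"
    by (rule D.integrable_const_bound[of _ B]) (use bound fD spD in auto)
  \<comment> \<open>shifting by the bound \<open>B\<close> reduces the claim to nonnegative integrands\<close>
  have "(\<integral>\<omega>. f \<omega> + B \<partial>?D) = enn2real (\<integral>\<^sup>+\<omega>. ennreal (f \<omega> + B) \<partial>?D)"
    using bound' by (intro integral_eq_nn_integral borel_measurable_add fD AE_I2) (simp_all only: spD borel_measurable_const)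
  also have "(\<integral>\<^sup>+\<omega>. ennreal (f \<omega> + B) \<partial>?D) = (\<integral>\<^sup>+\<phi>. ennreal (cell_sum q n a b (\<lambda>\<omega>. f \<omega> + B) \<phi>) \<partial>?N)"
    unfolding cell_sum_def
  proof (subst nn_integral_dcsbm[OF assms(1-4)], safe intro!: nn_integral_cong)
    fix \<phi> assume p: "\<phi> \<in> space ?N"
    have nn: "0 \<le> f (\<sigma>, \<phi>, G, u) + B" if "\<sigma> \<in> spins q n" for \<sigma> G u
      by (rule bound'[OF mem[OF that p]])
    show "(\<Sum>\<sigma>\<in>spins q n. \<Sum>G\<in>simple_graphs n. \<Sum>u\<in>{1..n}.
       ennreal (cell_prob q n a b \<phi> \<sigma> G) * ennreal (f (\<sigma>, \<phi>, G, u) + B)) =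
       ennreal (\<Sum>\<sigma>\<in>spins q n. \<Sum>G\<in>simple_graphs n. \<Sum>u\<in>{1..n}.
        cell_prob q n a b \<phi> \<sigma> G * (f (\<sigma>, \<phi>, G, u) + B))"
      by (simp add: sum_ennreal[symmetric] sum_nonneg nn cell_prob_nonneg ennreal_mult)
  qed (use f in measurable)
  also have "enn2real \<dots> = (\<integral>\<phi>. cell_sum q n a b (\<lambda>\<omega>. f \<omega> + B) \<phi> \<partial>?N)"
    unfolding cell_sum_add cell_sum_const[OF assms(3,4)]
  proof (intro integral_eq_nn_integral[symmetric] borel_measurable_add AE_I2 mS borel_measurable_const)
    fix \<phi> assume "\<phi> \<in> space ?N"
    then show "0 \<le> cell_sum q n a b f \<phi> + B" using bS by fastforce
  qed
  also have "\<dots> = (\<integral>\<phi>. cell_sum q n a b f \<phi> \<partial>?N) + B"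
    unfolding cell_sum_add cell_sum_const[OF assms(3,4)]
    by (subst Bochner_Integration.integral_add[OF iS]) (simp_all only: N.prob_space N.integrable_const lebesgue_integral_const scaleR_one)
  also have "(\<integral>\<omega>. f \<omega> + B \<partial>?D) = (\<integral>\<omega>. f \<omega> \<partial>?D) + B"
    by (subst Bochner_Integration.integral_add[OF iD]) (simp_all add: D.prob_space)
  finally show "(\<integral>\<omega>. f \<omega> \<partial>?D) = (\<integral>\<phi>. cell_sum q n a b f \<phi> \<partial>?N)" by simp
qed

lemma measurable_spin_coord:
  assumes "w \<in> {1..n}"
  shows "(\<lambda>\<omega>. fst \<omega> w) \<in> sample_space n \<rightarrow>\<^sub>M count_space UNIV"
  using measurable_discrete_data[of "\<lambda>\<sigma> G u. \<sigma> w" n] by (simp add: split_beta')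

lemma measurable_weight_coord:
  assumes "w \<in> {1..n}"
  shows "(\<lambda>\<omega>. fst (snd \<omega>) w) \<in> borel_measurable (sample_space n)"
  unfolding sample_space_def
  by (rule measurable_compose[OF _ measurable_component_singleton[OF assms]])
     (rule measurable_compose[OF measurable_snd measurable_fst])

section \<open>Resampling and perturbed weighted means\<close>

lemma override_on_override_on:
  "override_on (override_on \<sigma> \<rho> A) \<rho>' A = override_on \<sigma> \<rho>' A"
  by (auto simp: override_on_def fun_eq_iff)

lemma override_on_restrict: "override_on \<sigma> (restrict \<sigma> A) A = \<sigma>"
  by (auto simp: override_on_def fun_eq_iff)

lemma restrict_override_on: "\<rho> \<in> PiE A Q \<Longrightarrow> restrict (override_on \<sigma> \<rho> A) A = \<rho>"
  by (auto simp: override_on_def fun_eq_iff PiE_def extensional_def)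

lemma override_on_PiE:
  assumes "A \<subseteq> I" "\<sigma> \<in> PiE I (\<lambda>_. Q)" "\<rho> \<in> PiE A (\<lambda>_. Q)"
  shows "override_on \<sigma> \<rho> A \<in> PiE I (\<lambda>_. Q)"
  using assms by (auto simp: override_on_def PiE_def extensional_def Pi_def)

text \<open>
  Bayes' rule in the form used here. In a sum weighted by \<open>p\<close>, a function \<open>X\<close> of the configuration
  may be replaced by its mean over resampled values on \<open>A\<close>, as long as the other factor \<open>Z\<close>
  does not see the configuration on \<open>A\<close>. The reason is the involution of pairs \<open>(\<sigma>, \<rho>)\<close>
  that exchanges the restriction of \<open>\<sigma>\<close> to \<open>A\<close> with \<open>\<rho>\<close>. If the normalising sum is \<open>0\<close>, so is
  \<open>p \<sigma>\<close>, and division by zero does no harm.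
\<close>

lemma sum_resample:
  fixes p X Z :: "('i \<Rightarrow> 'a) \<Rightarrow> real"
  assumes "A \<subseteq> I" "finite I" "finite Q" and p: "\<And>\<sigma>. p \<sigma> \<ge> 0"
    and Z: "\<And>\<sigma> \<rho>. \<sigma> \<in> PiE I (\<lambda>_. Q) \<Longrightarrow> \<rho> \<in> PiE A (\<lambda>_. Q) \<Longrightarrow> Z (override_on \<sigma> \<rho> A) = Z \<sigma>"
  shows "(\<Sum>\<sigma>\<in>PiE I (\<lambda>_. Q). p \<sigma> * (X \<sigma> * Z \<sigma>)) =
    (\<Sum>\<sigma>\<in>PiE I (\<lambda>_. Q). p \<sigma> * ((\<Sum>\<rho>\<in>PiE A (\<lambda>_. Q). p (override_on \<sigma> \<rho> A) * X (override_on \<sigma> \<rho> A)) /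
       (\<Sum>\<rho>\<in>PiE A (\<lambda>_. Q). p (override_on \<sigma> \<rho> A)) * Z \<sigma>))"
proof -
  let ?S = "PiE I (\<lambda>_. Q)" and ?R = "PiE A (\<lambda>_. Q)"
  define N where "N \<sigma> = (\<Sum>\<rho>\<in>?R. p (override_on \<sigma> \<rho> A))" for \<sigma>
  have restr: "restrict \<sigma> A \<in> ?R" if "\<sigma> \<in> ?S" for \<sigma>
    using that assms(1) by (auto simp: PiE_def)
  have Sv: "\<sigma> x \<in> Q" if "\<sigma> \<in> ?S" "x \<in> A" for \<sigma> x
    using that assms(1) by (auto simp: PiE_def)
  have finR: "finite ?R" using assms finite_subset by (intro finite_PiE) blast+
  have "(\<Sum>\<sigma>\<in>?S. p \<sigma> * ((\<Sum>\<rho>\<in>?R. p (override_on \<sigma> \<rho> A) * X (override_on \<sigma> \<rho> A)) / N \<sigma> * Z \<sigma>)) =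
      (\<Sum>\<sigma>\<in>?S. \<Sum>\<rho>\<in>?R. p \<sigma> * (p (override_on \<sigma> \<rho> A) * X (override_on \<sigma> \<rho> A)) / N \<sigma> * Z \<sigma>)"
    by (simp add: sum_distrib_left sum_distrib_right sum_divide_distrib mult_ac)
  also have "\<dots> = (\<Sum>(\<sigma>, \<rho>)\<in>?S \<times> ?R. p \<sigma> * (p (override_on \<sigma> \<rho> A) * X (override_on \<sigma> \<rho> A)) / N \<sigma> * Z \<sigma>)"
    by (rule sum.cartesian_product)
  also have "\<dots> = (\<Sum>(\<sigma>, \<rho>)\<in>?S \<times> ?R. p (override_on \<sigma> \<rho> A) * (p \<sigma> * X \<sigma>) / N \<sigma> * Z \<sigma>)"
    \<comment> \<open>exchange the values of \<open>\<sigma>\<close> on \<open>A\<close> with \<open>\<rho>\<close>\<close>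
  proof (rule sum.reindex_bij_witness[where
        i = "\<lambda>(\<sigma>, \<rho>). (override_on \<sigma> \<rho> A, restrict \<sigma> A)" and
        j = "\<lambda>(\<sigma>, \<rho>). (override_on \<sigma> \<rho> A, restrict \<sigma> A)"], goal_cases)
    case (5 x)
    then obtain \<sigma> \<rho> where x: "x = (\<sigma>, \<rho>)" "\<sigma> \<in> ?S" "\<rho> \<in> ?R" by auto
    have "N (override_on \<sigma> \<rho> A) = N \<sigma>" by (simp add: N_def override_on_override_on)
    then show ?case
      by (simp add: x(1) override_on_override_on override_on_restrict Z[OF x(2,3)])
  qed (use restr Sv in \<open>auto simp: override_on_override_on override_on_restrict
      restrict_override_on intro!: override_on_PiE[OF assms(1)]\<close>)
  also have "\<dots> = (\<Sum>\<sigma>\<in>?S. N \<sigma> * (p \<sigma> * X \<sigma>) / N \<sigma> * Z \<sigma>)"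
    unfolding sum.cartesian_product[symmetric]
    by (intro sum.cong refl) (simp only: N_def sum_distrib_right sum_divide_distrib)
  also have "\<dots> = (\<Sum>\<sigma>\<in>?S. p \<sigma> * (X \<sigma> * Z \<sigma>))"
  proof (rule sum.cong[OF refl])
    fix \<sigma> assume s: "\<sigma> \<in> ?S"
    show "N \<sigma> * (p \<sigma> * X \<sigma>) / N \<sigma> * Z \<sigma> = p \<sigma> * (X \<sigma> * Z \<sigma>)"
    proof (cases "N \<sigma> = 0")
      case True
      from restr[OF s] have "p (override_on \<sigma> (restrict \<sigma> A) A) = 0"
        using True finR p unfolding N_def by (subst (asm) sum_nonneg_eq_0_iff) auto
      then show ?thesis using True by (simp add: override_on_restrict)
    qed simp
  qed
  finally show ?thesis unfolding N_def by simp
qed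

text \<open>
  A weighted mean of values in the unit interval hardly changes when its weights \<open>F\<close> are
  multiplied by an almost constant factor \<open>K\<close>.
\<close>

lemma weighted_mean_perturb:
  fixes F K x :: "'r \<Rightarrow> real"
  assumes "finite R" and F: "\<And>\<rho>. \<rho> \<in> R \<Longrightarrow> F \<rho> \<ge> 0"
    and K: "\<And>\<rho>. \<rho> \<in> R \<Longrightarrow> \<kappa> * exp (- d) \<le> K \<rho>" "\<And>\<rho>. \<rho> \<in> R \<Longrightarrow> K \<rho> \<le> \<kappa> * exp d"
    and "\<kappa> > 0" "d \<ge> 0" and x: "\<And>\<rho>. \<rho> \<in> R \<Longrightarrow> 0 \<le> x \<rho>" "\<And>\<rho>. \<rho> \<in> R \<Longrightarrow> x \<rho> \<le> 1"
  shows "\<bar>(\<Sum>\<rho>\<in>R. F \<rho> * K \<rho> * x \<rho>) / (\<Sum>\<rho>\<in>R. F \<rho> * K \<rho>) - (\<Sum>\<rho>\<in>R. F \<rho> * x \<rho>) / (\<Sum>\<rho>\<in>R. F \<rho>)\<bar>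
     \<le> exp (2 * d) - 1"
proof (cases "(\<Sum>\<rho>\<in>R. F \<rho>) = 0")
  case True
  then have "\<And>\<rho>. \<rho> \<in> R \<Longrightarrow> F \<rho> = 0" using F assms(1) by (simp add: sum_nonneg_eq_0_iff)
  then show ?thesis using \<open>d \<ge> 0\<close> by simp
next
  case False
  define y where "y = (\<Sum>\<rho>\<in>R. F \<rho> * x \<rho>)"
  define N where "N = (\<Sum>\<rho>\<in>R. F \<rho>)"
  define y' where "y' = (\<Sum>\<rho>\<in>R. F \<rho> * K \<rho> * x \<rho>)"
  define N' where "N' = (\<Sum>\<rho>\<in>R. F \<rho> * K \<rho>)"
  have N: "N > 0" using False F by (simp add: N_def sum_nonneg order_less_le)
  have y0: "0 \<le> y" using F x by (simp add: y_def sum_nonneg)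
  have yN: "y \<le> N" unfolding y_def N_def using F x by (intro sum_mono) (simp add: mult_left_le)
  have 1: "N' \<le> \<kappa> * exp d * N" "\<kappa> * exp (- d) * N \<le> N'"
    unfolding N'_def N_def sum_distrib_left using F K by (auto intro!: sum_mono simp: mult.commute mult_left_mono)
  have 2: "y' \<le> \<kappa> * exp d * y" "\<kappa> * exp (- d) * y \<le> y'"
    unfolding y'_def y_def sum_distrib_left
  proof (rule_tac [!] sum_mono)
    fix \<rho> assume r: "\<rho> \<in> R"
    have "F \<rho> * x \<rho> \<ge> 0" using F x r by simp
    from mult_right_mono[OF K(2)[OF r] this] mult_right_mono[OF K(1)[OF r] this]
    show "F \<rho> * K \<rho> * x \<rho> \<le> \<kappa> * exp d * (F \<rho> * x \<rho>)" "\<kappa> * exp (- d) * (F \<rho> * x \<rho>) \<le> F \<rho> * K \<rho> * x \<rho>"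
      by (simp_all add: mult_ac)
  qed
  have pos: "\<kappa> * exp d > 0" "\<kappa> * exp (- d) > 0" using \<open>\<kappa> > 0\<close> by auto
  have N': "N' > 0" using 1(2) pos N by (meson mult_pos_pos order_less_le_trans)
  define r where "r = y' / N'"
  define h where "h = y / N"
  have h: "0 \<le> h" "h \<le> 1" using y0 yN N by (auto simp: h_def)
  have y'0: "0 \<le> y'" using 2(2) pos y0 by (meson mult_nonneg_nonneg order_less_imp_le order_trans)
  have e2: "exp (d * 2) = exp d * exp d" by (simp add: exp_add[symmetric])
  have "r \<le> (\<kappa> * exp d * y) / (\<kappa> * exp (- d) * N)"
    unfolding r_def using 1 2 pos N y0 by (intro frac_le) auto
  also have "\<dots> = exp (2 * d) * h"
    using \<open>\<kappa> > 0\<close> N by (simp add: h_def exp_minus e2 field_simps)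
  finally have up: "r \<le> exp (2 * d) * h" .
  have "exp (- (2 * d)) * h = (\<kappa> * exp (- d) * y) / (\<kappa> * exp d * N)"
    using \<open>\<kappa> > 0\<close> N by (simp add: h_def exp_minus e2 field_simps)
  also have "\<dots> \<le> r"
    unfolding r_def using 1 2 pos N' y'0 by (intro frac_le) auto
  finally have low: "exp (- (2 * d)) * h \<le> r" .
  have "r - h \<le> (exp (2 * d) - 1) * h" using up by (simp add: algebra_simps)
  also have "\<dots> \<le> (exp (2 * d) - 1) * 1" using h \<open>d \<ge> 0\<close> by (intro mult_left_mono) auto
  finally have A: "r - h \<le> exp (2 * d) - 1" by simp
  have "h - r \<le> (1 - exp (- (2 * d))) * h" using low by (simp add: algebra_simps)
  also have "\<dots> \<le> (1 - exp (- (2 * d))) * 1" using h \<open>d \<ge> 0\<close> by (intro mult_left_mono) auto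
  also have "\<dots> \<le> exp (2 * d) - 1"
  proof -
    have "1 - exp (- x) \<le> exp x - 1" for x :: real
      using exp_ge_add_one_self[of x] exp_ge_add_one_self[of "- x"] by linarith
    then show ?thesis by simp
  qed
  finally have B: "h - r \<le> exp (2 * d) - 1" .
  show ?thesis using A B unfolding r_def h_def y_def N_def y'_def N'_def by (simp add: abs_le_iff)
qed

text \<open>
  Here \<open>K\<close> stands for the probability that there is no edge between \<open>A\<close> and \<open>C\<close>. If the field
  \<open>\<Sum>w'\<in>C. \<phi> w' * c w w'\<close> is close to \<open>n * m\<close> for every \<open>w\<close> in \<open>A\<close>, then \<open>K\<close> is close to
  \<open>\<kappa>\<close>, which does not involve the couplings \<open>c\<close>.
\<close>

lemma prod_one_minus_bounds:
  fixes \<phi> :: "nat \<Rightarrow> real" and c :: "nat \<Rightarrow> nat \<Rightarrow> real"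
  assumes fin: "finite A" "finite C" and n: "n > (0::real)"
    and \<phi>: "\<And>w. w \<in> A \<union> C \<Longrightarrow> 0 \<le> \<phi> w" "\<And>w. w \<in> A \<union> C \<Longrightarrow> \<phi> w \<le> L"
    and c: "\<And>w w'. 0 \<le> c w w'" "\<And>w w'. c w w' \<le> c0"
    and L: "L ^ 2 * c0 / n \<le> 1 / 2"
    and t: "\<And>w. w \<in> A \<Longrightarrow> \<bar>(\<Sum>w'\<in>C. \<phi> w' * c w w') - n * m\<bar> \<le> t"
    and d: "real (card A) * L * t / n + 2 * (real (card A) * real (card C) * (L ^ 2 * c0 / n) ^ 2) \<le> d"
  defines "K \<equiv> (\<Prod>(w, w')\<in>A \<times> C. 1 - \<phi> w * \<phi> w' / n * c w w')"
    and "\<kappa> \<equiv> exp (- (m * (\<Sum>w\<in>A. \<phi> w)))"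
  shows "\<kappa> * exp (- d) \<le> K" "K \<le> \<kappa> * exp d"
proof -
  define p where "p w w' = \<phi> w * \<phi> w' / n * c w w'" for w w'
  have p: "0 \<le> p w w'" "p w w' \<le> L ^ 2 * c0 / n" if "w \<in> A" "w' \<in> C" for w w'
  proof -
    show "0 \<le> p w w'" using \<phi> c n that by (simp add: p_def)
    have "\<phi> w * \<phi> w' \<le> L * L"
    proof (rule mult_mono)
      show "0 \<le> L" using \<phi>[of w] that by simp
    qed (use \<phi> that in auto)
    then have "\<phi> w * \<phi> w' * c w w' \<le> L * L * c0"
    proof (rule mult_mono)
      show "0 \<le> L * L" by simp
    qed (use c in auto)
    then show "p w w' \<le> L ^ 2 * c0 / n" using n by (simp add: p_def power2_eq_square divide_right_mono)
  qed
  have lnb: "\<bar>ln (1 - p w w') + p w w'\<bar> \<le> 2 * (L ^ 2 * c0 / n) ^ 2" if "w \<in> A" "w' \<in> C" for w w'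
  proof -
    have "\<bar>ln (1 + - p w w') - - p w w'\<bar> \<le> 2 * (- p w w') ^ 2"
      using p[OF that] L by (intro abs_ln_one_plus_x_minus_x_bound, unfold abs_minus_cancel) linarith
    also have "\<dots> \<le> 2 * (L ^ 2 * c0 / n) ^ 2" using p[OF that] by (simp add: power_mono)
    finally show ?thesis by simp
  qed
  have pos: "1 - p w w' > 0" if "w \<in> A" "w' \<in> C" for w w' using p[OF that] L by linarith
  have K0: "K > 0" unfolding K_def using pos by (intro prod_pos) (auto simp: p_def)
  have "ln K = (\<Sum>(w, w')\<in>A \<times> C. ln (1 - p w w'))"
  proof -
    have "K = (\<Prod>x\<in>A \<times> C. 1 - p (fst x) (snd x))"
      by (simp add: K_def p_def split_beta)
    moreover have "1 - p (fst x) (snd x) \<noteq> 0" if "x \<in> A \<times> C" for x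
      using pos[of "fst x" "snd x"] that by auto
    ultimately show ?thesis using fin by (simp add: ln_prod split_beta)
  qed
  then have "\<bar>ln K + (\<Sum>(w, w')\<in>A \<times> C. p w w')\<bar> = \<bar>\<Sum>(w, w')\<in>A \<times> C. ln (1 - p w w') + p w w'\<bar>"
    by (simp add: sum.distrib split_beta)
  also have "\<dots> \<le> (\<Sum>(w, w')\<in>A \<times> C. 2 * (L ^ 2 * c0 / n) ^ 2)"
    by (rule order_trans[OF sum_abs]) (intro sum_mono, use lnb in auto)
  also have "\<dots> = 2 * (real (card A) * real (card C) * (L ^ 2 * c0 / n) ^ 2)"
    by (simp add: split_beta card_cartesian_product)
  finally have 1: "\<bar>ln K + (\<Sum>(w, w')\<in>A \<times> C. p w w')\<bar> \<le> \<dots>" .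
  have "(\<Sum>(w, w')\<in>A \<times> C. p w w') - m * (\<Sum>w\<in>A. \<phi> w) =
      (\<Sum>w\<in>A. \<phi> w / n * ((\<Sum>w'\<in>C. \<phi> w' * c w w') - n * m))"
    using n by (simp add: sum.cartesian_product[symmetric] p_def sum_distrib_left sum_subtractf
        right_diff_distrib mult_ac)
  also have "\<bar>\<dots>\<bar> \<le> (\<Sum>w\<in>A. L / n * t)"
  proof (rule order_trans[OF sum_abs], rule sum_mono)
    fix w assume w: "w \<in> A"
    then have "0 \<le> L / n" "\<bar>\<phi> w / n\<bar> \<le> L / n" using \<phi>[of w] n by (simp_all add: divide_right_mono)
    then show "\<bar>\<phi> w / n * ((\<Sum>w'\<in>C. \<phi> w' * c w w') - n * m)\<bar> \<le> L / n * t"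
      unfolding abs_mult using t[OF w] by (intro mult_mono) auto
  qed
  also have "\<dots> = real (card A) * L * t / n" by simp
  finally have 2: "\<bar>(\<Sum>(w, w')\<in>A \<times> C. p w w') - m * (\<Sum>w\<in>A. \<phi> w)\<bar> \<le> \<dots>" .
  have "\<bar>ln K + m * (\<Sum>w\<in>A. \<phi> w)\<bar> \<le> d" using 1 2 d by linarith
  then have "- (m * (\<Sum>w\<in>A. \<phi> w)) + - d \<le> ln K" "ln K \<le> - (m * (\<Sum>w\<in>A. \<phi> w)) + d" by (auto simp: abs_le_iff)
  then have "exp (- (m * (\<Sum>w\<in>A. \<phi> w)) + - d) \<le> exp (ln K)" "exp (ln K) \<le> exp (- (m * (\<Sum>w\<in>A. \<phi> w)) + d)"
    by (simp_all only: exp_le_cancel_iff)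
  then show "\<kappa> * exp (- d) \<le> K" "K \<le> \<kappa> * exp d"
    unfolding \<kappa>_def exp_add using K0 by simp_all
qed

section \<open>The local posterior\<close>

text \<open>The pairs of vertices inside \<open>V\<close>.\<close>

definition inner_pairs :: "nat \<Rightarrow> nat set \<Rightarrow> (nat \<times> nat) set" where
  "inner_pairs n V = {(w, w') \<in> vertex_pairs n. w \<in> V \<and> w' \<in> V}"

lemma finite_inner_pairs: "finite (inner_pairs n V)"
  by (rule finite_subset[OF _ finite_vertex_pairs]) (auto simp: inner_pairs_def)

lemma pair_lik_cong:
  assumes "\<And>w w'. (w, w') \<in> P \<Longrightarrow> \<sigma> w = \<sigma>' w \<and> \<sigma> w' = \<sigma>' w' \<and> \<phi> w = \<phi>' w \<and> \<phi> w' = \<phi>' w' \<and>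
     ({w, w'} \<in> snd G \<longleftrightarrow> {w, w'} \<in> snd G')"
  shows "pair_lik n a b G P \<sigma> \<phi> = pair_lik n a b G' P \<sigma>' \<phi>'"
  unfolding pair_lik_def
proof (rule prod.cong[OF refl])
  fix e assume e: "e \<in> P"
  obtain w w' where "e = (w, w')" by (cases e)
  with assms[of w w'] e show "edge_factor n a b G \<sigma> \<phi> e = edge_factor n a b G' \<sigma>' \<phi>' e"
    by (simp add: edge_factor_def edge_prob_def)
qed

lemma separates_no_edge:
  assumes "separates G B A C" "fst G = A \<union> B \<union> C" "A \<inter> C = {}" "A \<inter> B = {}" "B \<inter> C = {}"
    and "x \<in> A" "y \<in> C"
  shows "{x, y} \<notin> snd G"
proof
  assume e: "{x, y} \<in> snd G"
  have "is_path G [x, y]" using assms e by (auto simp: is_path_def)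
  with assms(1,6,7) have "set [x, y] \<inter> B \<noteq> {}"
    unfolding separates_def by (metis hd_Cons_tl last.simps list.discI list.sel(1))
  then show False using assms by auto
qed

lemma edge_factor_nonedge:
  assumes "{w, w'} \<notin> snd G" "0 \<le> \<phi> w * \<phi> w' / real n * (if \<sigma> w = \<sigma> w' then a else b)"
    "\<phi> w * \<phi> w' / real n * (if \<sigma> w = \<sigma> w' then a else b) \<le> 1"
  shows "edge_factor n a b G \<sigma> \<phi> (w, w') = 1 - \<phi> w * \<phi> w' / real n * (if \<sigma> w = \<sigma> w' then a else b)"
  using assms(2,3) unfolding edge_factor_def edge_prob_def prod.case
  by (simp only: assms(1) min_absorb2 pmf_bernoulli_False)

text \<open>
  If there is no edge between \<open>A\<close> and \<open>C\<close>, the likelihood splits into a factor for the pairs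
  inside \<open>A \<union> B\<close>, the product of the non-edge probabilities between \<open>A\<close> and \<open>C\<close>, and a
  factor that does not depend on the spins in \<open>A\<close>.
\<close>

lemma pair_lik_split:
  assumes part: "A \<union> B \<union> C = {1..n}" "A \<inter> B = {}" "A \<inter> C = {}" "B \<inter> C = {}"
    and noedge: "\<And>x y. x \<in> A \<Longrightarrow> y \<in> C \<Longrightarrow> {x, y} \<notin> snd G"
    and pr: "\<And>w w'. w \<in> {1..n} \<Longrightarrow> w' \<in> {1..n} \<Longrightarrow>
      0 \<le> \<phi> w * \<phi> w' / real n * (if \<sigma> w = \<sigma> w' then a else b) \<and>
      \<phi> w * \<phi> w' / real n * (if \<sigma> w = \<sigma> w' then a else b) \<le> 1"
  shows "pair_lik n a b G (vertex_pairs n) \<sigma> \<phi> =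
    pair_lik n a b G (inner_pairs n (A \<union> B)) \<sigma> \<phi> *
    (\<Prod>(w, w')\<in>A \<times> C. 1 - \<phi> w * \<phi> w' / real n * (if \<sigma> w = \<sigma> w' then a else b)) *
    pair_lik n a b G (inner_pairs n (B \<union> C) - B \<times> B) \<sigma> \<phi>"
proof -
  let ?g = "\<lambda>w w'. 1 - \<phi> w * \<phi> w' / real n * (if \<sigma> w = \<sigma> w' then a else b)"
  define P2 where "P2 = vertex_pairs n \<inter> (A \<times> C \<union> C \<times> A)"
  let ?P1 = "inner_pairs n (A \<union> B)" and ?P3 = "inner_pairs n (B \<union> C) - B \<times> B"
  have sub: "A \<subseteq> {1..n}" "C \<subseteq> {1..n}" using part by auto
  have mem: "w \<in> A \<or> w \<in> B \<or> w \<in> C" if "w \<in> {1..n}" for w using part that by blast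
  have vp: "vertex_pairs n = ?P1 \<union> (P2 \<union> ?P3)"
  proof
    show "vertex_pairs n \<subseteq> ?P1 \<union> (P2 \<union> ?P3)"
    proof
      fix e assume e: "e \<in> vertex_pairs n"
      obtain w w' where w: "e = (w, w')" by (cases e)
      have "w \<in> {1..n}" "w' \<in> {1..n}" using e w by (auto simp: vertex_pairs_def)
      from mem[OF this(1)] mem[OF this(2)] show "e \<in> ?P1 \<union> (P2 \<union> ?P3)"
        using e part unfolding w inner_pairs_def P2_def by blast
    qed
  qed (auto simp: inner_pairs_def P2_def)
  have dis: "?P1 \<inter> (P2 \<union> ?P3) = {}" "P2 \<inter> ?P3 = {}"
    using part(2-4) unfolding inner_pairs_def P2_def by blast+
  have fin: "finite ?P1" "finite P2" "finite ?P3"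
    using finite_inner_pairs finite_vertex_pairs unfolding P2_def by auto
  have "pair_lik n a b G (vertex_pairs n) \<sigma> \<phi> = pair_lik n a b G ?P1 \<sigma> \<phi> *
      (pair_lik n a b G P2 \<sigma> \<phi> * pair_lik n a b G ?P3 \<sigma> \<phi>)"
    unfolding pair_lik_def
    by (subst vp, subst prod.union_disjoint[OF fin(1) _ dis(1)], use fin in simp,
        subst prod.union_disjoint[OF fin(2,3) dis(2)], rule refl)
  moreover have "pair_lik n a b G P2 \<sigma> \<phi> = (\<Prod>(w, w')\<in>A \<times> C. ?g w w')"
    unfolding pair_lik_def
    \<comment> \<open>\<open>vertex_pairs\<close> lists every pair in increasing order; reorder it with the endpoint in \<open>A\<close> first\<close>
  proof (rule prod.reindex_bij_witness[where
        i = "\<lambda>(w, w'). if w < w' then (w, w') else (w', w)" and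
        j = "\<lambda>(w, w'). if w \<in> A then (w, w') else (w', w)"], goal_cases)
    case (5 e)
    then obtain w w' where e: "e = (w, w')" "(w, w') \<in> vertex_pairs n" "w \<in> A \<and> w' \<in> C \<or> w \<in> C \<and> w' \<in> A"
      unfolding P2_def by auto
    then have w: "w \<in> {1..n}" "w' \<in> {1..n}" by (auto simp: vertex_pairs_def)
    have "{w, w'} \<notin> snd G" using noedge[of w w'] noedge[of w' w] e(3) by (auto simp: insert_commute)
    then have "edge_factor n a b G \<sigma> \<phi> e = ?g w w'"
      unfolding e(1) using pr[OF w] by (intro edge_factor_nonedge) auto
    moreover have "?g w' w = ?g w w'" by (auto simp: mult.commute)
    ultimately show ?case unfolding e(1) by auto
  next
    case (1 e) then show ?case using part(3) by (auto simp: P2_def vertex_pairs_def)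
  next
    case (2 e) then show ?case using part(3) by (auto simp: P2_def)
  next
    case (3 e) then show ?case using part(3) by auto
  next
    case (4 e)
    then obtain x y where e: "e = (x, y)" "x \<in> A" "y \<in> C" by auto
    then have "x \<noteq> y" "x \<in> {1..n}" "y \<in> {1..n}" using part(3) sub by auto
    then show ?case using e by (auto simp: P2_def vertex_pairs_def)
  qed
  ultimately show ?thesis by (simp only: mult.assoc)
qed

text \<open>
  The posterior probability that \<open>u\<close> has spin \<open>s\<close>, computed from the spins in \<open>B\<close>, the weights in
  \<open>A \<union> B\<close> and the graph inside \<open>A \<union> B\<close> alone: the spins \<open>\<rho>\<close> in \<open>A\<close> are summed out, and
  the pairs between \<open>A\<close> and \<open>C\<close> are ignored. The values of \<open>\<sigma>\<close> on \<open>A\<close> are overwritten.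
\<close>

definition local_posterior ::
  "nat \<Rightarrow> nat \<Rightarrow> real \<Rightarrow> real \<Rightarrow> nat \<Rightarrow> nat set \<Rightarrow> nat set \<Rightarrow> (nat \<Rightarrow> nat) \<Rightarrow> (nat \<Rightarrow> real) \<Rightarrow> graph \<Rightarrow> nat \<Rightarrow> real" where
  "local_posterior q n a b s A B \<sigma> \<phi> G u =
     (\<Sum>\<rho>\<in>PiE A (\<lambda>_. {1..q}). pair_lik n a b G (inner_pairs n (A \<union> B)) (override_on \<sigma> \<rho> A) \<phi> *
        of_bool (override_on \<sigma> \<rho> A u = s)) /
     (\<Sum>\<rho>\<in>PiE A (\<lambda>_. {1..q}). pair_lik n a b G (inner_pairs n (A \<union> B)) (override_on \<sigma> \<rho> A) \<phi>)"

lemma weighted_mean_bounds: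
  fixes p x :: "'r \<Rightarrow> real"
  assumes "\<And>\<rho>. \<rho> \<in> R \<Longrightarrow> 0 \<le> p \<rho>" "\<And>\<rho>. \<rho> \<in> R \<Longrightarrow> 0 \<le> x \<rho>" "\<And>\<rho>. \<rho> \<in> R \<Longrightarrow> x \<rho> \<le> 1"
  shows "0 \<le> (\<Sum>\<rho>\<in>R. p \<rho> * x \<rho>) / (\<Sum>\<rho>\<in>R. p \<rho>)" "(\<Sum>\<rho>\<in>R. p \<rho> * x \<rho>) / (\<Sum>\<rho>\<in>R. p \<rho>) \<le> 1"
proof -
  show "0 \<le> (\<Sum>\<rho>\<in>R. p \<rho> * x \<rho>) / (\<Sum>\<rho>\<in>R. p \<rho>)"
    using assms by (intro divide_nonneg_nonneg sum_nonneg mult_nonneg_nonneg) auto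
  have "(\<Sum>\<rho>\<in>R. p \<rho> * x \<rho>) \<le> (\<Sum>\<rho>\<in>R. p \<rho>)"
    using assms by (intro sum_mono) (simp add: mult_left_le)
  moreover have "0 \<le> (\<Sum>\<rho>\<in>R. p \<rho>)" using assms by (intro sum_nonneg) auto
  ultimately show "(\<Sum>\<rho>\<in>R. p \<rho> * x \<rho>) / (\<Sum>\<rho>\<in>R. p \<rho>) \<le> 1"
    by (intro divide_le_eq_1[THEN iffD2]) linarith
qed

lemma local_posterior_bounds:
  "0 \<le> local_posterior q n a b s A B \<sigma> \<phi> G u" "local_posterior q n a b s A B \<sigma> \<phi> G u \<le> 1"
  unfolding local_posterior_def by (rule weighted_mean_bounds; simp add: pair_lik_nonneg)+

lemma local_posterior_cong:
  assumes "\<And>w. w \<in> B \<Longrightarrow> \<sigma> w = \<sigma>' w" "\<And>w. w \<in> A \<union> B \<Longrightarrow> \<phi> w = \<phi>' w" "u \<in> A"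
    "\<And>w w'. w \<in> A \<union> B \<Longrightarrow> w' \<in> A \<union> B \<Longrightarrow> {w, w'} \<in> snd G \<longleftrightarrow> {w, w'} \<in> snd G'"
  shows "local_posterior q n a b s A B \<sigma> \<phi> G u = local_posterior q n a b s A B \<sigma>' \<phi>' G' u"
proof -
  have "pair_lik n a b G (inner_pairs n (A \<union> B)) (override_on \<sigma> \<rho> A) \<phi> =
      pair_lik n a b G' (inner_pairs n (A \<union> B)) (override_on \<sigma>' \<rho> A) \<phi>'" for \<rho>
    using assms by (intro pair_lik_cong) (auto simp: inner_pairs_def override_on_def)
  then show ?thesis
    unfolding local_posterior_def using assms(3) by simp
qed

text \<open>
  The comparison for fixed weights, graph and marked vertex. The test function \<open>Z\<close> does not see the
  spins in \<open>A\<close>; the condition \<open>T\<close> implies that \<open>A \<union> B\<close> is small and the field concentrated. The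
  exact posterior \<open>r\<close>, which arises by resampling the spins in \<open>A\<close>, differs from the local one only by the
  factor \<open>K\<close> for the missing edges between \<open>A\<close> and \<open>C\<close>.
\<close>

lemma local_posterior_error:
  fixes Z :: "(nat \<Rightarrow> nat) \<Rightarrow> real"
  assumes ab: "0 < a" "a \<le> c0" "0 < b" "b \<le> c0" and n: "n \<ge> 1" and nonneg: "cap \<ge> 0" "\<tau> \<ge> 0"
    and part: "A \<union> B \<union> C = {1..n}" "A \<inter> B = {}" "A \<inter> C = {}" "B \<inter> C = {}"
    and noedge: "\<And>x y. x \<in> A \<Longrightarrow> y \<in> C \<Longrightarrow> {x, y} \<notin> snd G"
    and \<phi>: "\<And>w. w \<in> {1..n} \<Longrightarrow> 0 \<le> \<phi> w" "\<And>w. w \<in> {1..n} \<Longrightarrow> \<phi> w \<le> L"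
    and L: "L ^ 2 * c0 / real n \<le> 1 / 2"
    and Z: "\<And>\<sigma> \<rho>. \<sigma> \<in> spins q n \<Longrightarrow> \<rho> \<in> PiE A (\<lambda>_. {1..q}) \<Longrightarrow> Z (override_on \<sigma> \<rho> A) = Z \<sigma>"
      "\<And>\<sigma>. \<bar>Z \<sigma>\<bar> \<le> 1"
    and T: "\<And>\<sigma>. T \<sigma> \<Longrightarrow> real (card (A \<union> B)) \<le> cap"
      "\<And>\<sigma> k. T \<sigma> \<Longrightarrow> k \<in> {1..q} \<Longrightarrow>
         \<bar>(\<Sum>w\<in>{1..n}. \<phi> w * (if k = \<sigma> w then a else b)) - real n * m\<bar> \<le> \<tau>"
    and d: "cap * L * (\<tau> + cap * L * c0) / real n + 2 * (cap * real n * (L ^ 2 * c0 / real n) ^ 2) \<le> d"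
  shows "(\<Sum>\<sigma>\<in>spins q n. pair_lik n a b G (vertex_pairs n) \<sigma> \<phi> *
      ((of_bool (\<sigma> u = s) - local_posterior q n a b s A B \<sigma> \<phi> G u) * Z \<sigma>)) \<le>
    (\<Sum>\<sigma>\<in>spins q n. pair_lik n a b G (vertex_pairs n) \<sigma> \<phi> * (if T \<sigma> then exp (2 * d) - 1 else 1))"
proof -
  let ?c = "\<lambda>(\<sigma> :: nat \<Rightarrow> nat) w w'. if \<sigma> w = \<sigma> w' then a else b"
  let ?R = "PiE A (\<lambda>_. {1..q})"
  have sub: "A \<subseteq> {1..n}" "B \<subseteq> {1..n}" "C \<subseteq> {1..n}" using part by auto
  have fin: "finite A" "finite B" "finite C" using sub finite_subset by blast+
  have L0: "0 \<le> L" using \<phi>[of 1] n by auto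
  have c: "0 \<le> ?c \<sigma> w w'" "?c \<sigma> w w' \<le> c0" for \<sigma> w w' using ab by auto
  define F where "F \<sigma> = pair_lik n a b G (inner_pairs n (A \<union> B)) \<sigma> \<phi>" for \<sigma>
  define K where "K \<sigma> = (\<Prod>(w, w')\<in>A \<times> C. 1 - \<phi> w * \<phi> w' / real n * ?c \<sigma> w w')" for \<sigma>
  define Y where "Y \<sigma> = pair_lik n a b G (inner_pairs n (B \<union> C) - B \<times> B) \<sigma> \<phi>" for \<sigma>
  define h where "h \<sigma> = local_posterior q n a b s A B \<sigma> \<phi> G u" for \<sigma>
  define r where "r \<sigma> = (\<Sum>\<rho>\<in>?R. F (override_on \<sigma> \<rho> A) * K (override_on \<sigma> \<rho> A) * of_bool (override_on \<sigma> \<rho> A u = s)) /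
    (\<Sum>\<rho>\<in>?R. F (override_on \<sigma> \<rho> A) * K (override_on \<sigma> \<rho> A))" for \<sigma>
  have pr: "0 \<le> \<phi> w * \<phi> w' / real n * ?c \<sigma> w w' \<and> \<phi> w * \<phi> w' / real n * ?c \<sigma> w w' \<le> 1"
    if w: "w \<in> {1..n}" "w' \<in> {1..n}" for \<sigma> w w'
  proof -
    have "\<phi> w * \<phi> w' \<le> L * L" using \<phi> w L0 by (intro mult_mono) auto
    then have "\<phi> w * \<phi> w' * ?c \<sigma> w w' \<le> L * L * c0"
      by (rule mult_mono[OF _ c(2)]) (use c(1) L0 in auto)
    then have "\<phi> w * \<phi> w' * ?c \<sigma> w w' / real n \<le> L * L * c0 / real n" by (rule divide_right_mono) simp
    moreover have "\<phi> w * \<phi> w' / real n * ?c \<sigma> w w' = \<phi> w * \<phi> w' * ?c \<sigma> w w' / real n" by simp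
    ultimately have "\<phi> w * \<phi> w' / real n * ?c \<sigma> w w' \<le> 1"
      using L unfolding power2_eq_square by linarith
    moreover have "0 \<le> \<phi> w * \<phi> w' / real n * ?c \<sigma> w w'"
      using \<phi> w c by (intro mult_nonneg_nonneg divide_nonneg_nonneg) auto
    ultimately show ?thesis by simp
  qed
  have lik: "pair_lik n a b G (vertex_pairs n) \<sigma> \<phi> = F \<sigma> * K \<sigma> * Y \<sigma>" for \<sigma>
    unfolding F_def K_def Y_def by (rule pair_lik_split[OF part noedge pr])
  have F0: "F \<sigma> \<ge> 0" and Y0: "Y \<sigma> \<ge> 0" for \<sigma> unfolding F_def Y_def by (rule pair_lik_nonneg)+
  have K0: "K \<sigma> \<ge> 0" for \<sigma>
    unfolding K_def
  proof (rule prod_nonneg)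
    fix x assume "x \<in> A \<times> C"
    then obtain w w' where x: "x = (w, w')" "w \<in> {1..n}" "w' \<in> {1..n}" using sub by blast
    show "0 \<le> (case x of (w, w') \<Rightarrow> 1 - \<phi> w * \<phi> w' / real n * ?c \<sigma> w w')"
      using pr[OF x(2,3), of \<sigma>] unfolding x(1) prod.case by linarith
  qed
  have FK0: "F \<sigma> * K \<sigma> \<ge> 0" for \<sigma> using F0 K0 by simp
  have Yinv: "Y (override_on \<sigma> \<rho> A) = Y \<sigma>" for \<sigma> \<rho>
    unfolding Y_def by (rule pair_lik_cong) (use part in \<open>auto simp: inner_pairs_def override_on_def\<close>)
  have hF: "h \<sigma> = (\<Sum>\<rho>\<in>?R. F (override_on \<sigma> \<rho> A) * of_bool (override_on \<sigma> \<rho> A u = s)) /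
      (\<Sum>\<rho>\<in>?R. F (override_on \<sigma> \<rho> A))" for \<sigma>
    unfolding h_def local_posterior_def F_def ..
  have bnd: "0 \<le> h \<sigma>" "h \<sigma> \<le> 1" "0 \<le> r \<sigma>" "r \<sigma> \<le> 1" for \<sigma>
    unfolding h_def r_def by (rule local_posterior_bounds weighted_mean_bounds; simp add: FK0)+
  have close: "\<bar>r \<sigma> - h \<sigma>\<bar> \<le> exp (2 * d) - 1" if \<sigma>: "\<sigma> \<in> spins q n" and t: "T \<sigma>" for \<sigma>
    unfolding r_def hF
  proof (rule weighted_mean_perturb[where \<kappa> = "exp (- (m * (\<Sum>w\<in>A. \<phi> w)))"])
    show "finite ?R" using fin by (intro finite_PiE) auto
    have cardA: "real (card A) \<le> cap"
    proof -
      have "card A \<le> card (A \<union> B)" using fin by (intro card_mono) auto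
      then show ?thesis using T(1)[OF t] by linarith
    qed
    have cardC: "real (card C) \<le> real n" using card_mono[OF _ sub(3)] by simp
    have c00: "c0 \<ge> 0" using ab by linarith
    have "0 \<le> cap * L * (\<tau> + cap * L * c0) / real n + 2 * (cap * real n * (L ^ 2 * c0 / real n) ^ 2)"
      using nonneg L0 c00 by simp
    then show "d \<ge> 0" using d by linarith
    fix \<rho> assume \<rho>: "\<rho> \<in> ?R"
    let ?\<sigma> = "override_on \<sigma> \<rho> A"
    \<comment> \<open>the field of \<open>C\<close> is that of all vertices, up to the few vertices in \<open>A \<union> B\<close>\<close>
    have dev: "\<bar>(\<Sum>w'\<in>C. \<phi> w' * ?c ?\<sigma> w w') - real n * m\<bar> \<le> \<tau> + cap * L * c0" if w: "w \<in> A" for w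
    proof -
      have k: "\<rho> w \<in> {1..q}" using \<rho> w by auto
      let ?f = "\<lambda>w'. \<phi> w' * (if \<rho> w = \<sigma> w' then a else b)"
      have "(\<Sum>w'\<in>C. \<phi> w' * ?c ?\<sigma> w w') = sum ?f C"
        using w part(3) by (intro sum.cong refl) (auto simp: override_on_def)
      moreover have "sum ?f {1..n} = sum ?f (A \<union> B) + sum ?f C"
        unfolding part(1)[symmetric] using fin part by (intro sum.union_disjoint) auto
      moreover have "0 \<le> sum ?f (A \<union> B)"
        using \<phi> sub ab by (intro sum_nonneg mult_nonneg_nonneg) auto
      moreover have "sum ?f (A \<union> B) \<le> (\<Sum>w'\<in>A \<union> B. L * c0)"
        using \<phi> sub ab L0 by (intro sum_mono mult_mono) auto
      moreover have "(\<Sum>w'\<in>A \<union> B. L * c0) \<le> cap * L * c0"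
        using T(1)[OF t] L0 c00 by (simp add: mult.assoc mult_right_mono)
      ultimately show ?thesis using T(2)[OF t k] by linarith
    qed
    have "real (card A) * L * (\<tau> + cap * L * c0) / real n +
        2 * (real (card A) * real (card C) * (L ^ 2 * c0 / real n) ^ 2) \<le> d"
    proof (rule order_trans[OF add_mono d])
      show "real (card A) * L * (\<tau> + cap * L * c0) / real n \<le> cap * L * (\<tau> + cap * L * c0) / real n"
        using cardA nonneg L0 c00 by (intro divide_right_mono mult_right_mono) auto
      show "2 * (real (card A) * real (card C) * (L ^ 2 * c0 / real n) ^ 2) \<le>
          2 * (cap * real n * (L ^ 2 * c0 / real n) ^ 2)"
        using cardA cardC nonneg by (intro mult_left_mono mult_right_mono mult_mono) auto
    qed
    note bb = prod_one_minus_bounds[where A=A and C=C and n="real n" and \<phi>=\<phi> and L=L and c="?c ?\<sigma>" and ?c0.0=c0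
        and m=m and t="\<tau> + cap * L * c0" and d=d, OF fin(1,3) _ _ _ c[of ?\<sigma>] L dev this]
    show "exp (- (m * (\<Sum>w\<in>A. \<phi> w))) * exp (- d) \<le> K ?\<sigma>"
      unfolding K_def by (rule bb(1)) (use n \<phi> sub in auto)
    show "K ?\<sigma> \<le> exp (- (m * (\<Sum>w\<in>A. \<phi> w))) * exp d"
      unfolding K_def by (rule bb(2)) (use n \<phi> sub in auto)
  qed (use F0 in auto)
  have "(\<Sum>\<sigma>\<in>spins q n. pair_lik n a b G (vertex_pairs n) \<sigma> \<phi> * ((of_bool (\<sigma> u = s) - h \<sigma>) * Z \<sigma>)) =
      (\<Sum>\<sigma>\<in>spins q n. (F \<sigma> * K \<sigma>) * (of_bool (\<sigma> u = s) * (Y \<sigma> * Z \<sigma>))) -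
      (\<Sum>\<sigma>\<in>spins q n. (F \<sigma> * K \<sigma>) * (h \<sigma> * (Y \<sigma> * Z \<sigma>)))"
    unfolding lik sum_subtractf[symmetric] by (intro sum.cong refl) (simp add: algebra_simps)
  \<comment> \<open>\<open>Y\<close> does not depend on the spins in \<open>A\<close> and can be absorbed into the test function\<close>
  also have "(\<Sum>\<sigma>\<in>spins q n. (F \<sigma> * K \<sigma>) * (of_bool (\<sigma> u = s) * (Y \<sigma> * Z \<sigma>))) =
      (\<Sum>\<sigma>\<in>spins q n. (F \<sigma> * K \<sigma>) * (r \<sigma> * (Y \<sigma> * Z \<sigma>)))"
    unfolding spins_def r_def
    by (rule sum_resample[OF sub(1) _ _ FK0]) (use Z(1) Yinv in \<open>auto simp: spins_def\<close>)
  also have "(\<Sum>\<sigma>\<in>spins q n. (F \<sigma> * K \<sigma>) * (r \<sigma> * (Y \<sigma> * Z \<sigma>))) -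
      (\<Sum>\<sigma>\<in>spins q n. (F \<sigma> * K \<sigma>) * (h \<sigma> * (Y \<sigma> * Z \<sigma>))) =
      (\<Sum>\<sigma>\<in>spins q n. (F \<sigma> * K \<sigma> * Y \<sigma>) * ((r \<sigma> - h \<sigma>) * Z \<sigma>))"
    unfolding sum_subtractf[symmetric] by (intro sum.cong refl) (simp add: algebra_simps)
  also have "\<dots> \<le> (\<Sum>\<sigma>\<in>spins q n. (F \<sigma> * K \<sigma> * Y \<sigma>) * (if T \<sigma> then exp (2 * d) - 1 else 1))"
  proof (intro sum_mono mult_left_mono)
    fix \<sigma> assume \<sigma>: "\<sigma> \<in> spins q n"
    have "(r \<sigma> - h \<sigma>) * Z \<sigma> \<le> \<bar>r \<sigma> - h \<sigma>\<bar> * \<bar>Z \<sigma>\<bar>" by (simp add: abs_mult[symmetric])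
    also have "\<dots> \<le> \<bar>r \<sigma> - h \<sigma>\<bar>" using Z(2)[of \<sigma>] by (simp add: mult_left_le)
    also have "\<dots> \<le> (if T \<sigma> then exp (2 * d) - 1 else 1)"
      using close[OF \<sigma>] bnd[of \<sigma>] by auto
    finally show "(r \<sigma> - h \<sigma>) * Z \<sigma> \<le> (if T \<sigma> then exp (2 * d) - 1 else 1)" .
  qed (use FK0 Y0 in auto)
  finally show ?thesis unfolding lik h_def .
qed

section \<open>The sigma-algebra of an observation\<close>

text \<open>The map that generates the sigma-algebra \<open>observed n S U\<close>.\<close>

definition observation ::
  "nat \<Rightarrow> (graph \<Rightarrow> nat \<Rightarrow> nat set) \<Rightarrow> (graph \<Rightarrow> nat \<Rightarrow> nat set) \<Rightarrow> sample \<Rightarrow>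
    nat \<times> (nat \<Rightarrow> nat option) \<times> graph \<times> (nat \<Rightarrow> real)" where
  "observation n S U = (\<lambda>(\<sigma>, \<phi>, G, u).
     (u, (Some \<circ> \<sigma>) |` S G u, induced G (U G u), \<lambda>w\<in>{1..n}. if w \<in> U G u then \<phi> w else 0))"

abbreviation observation_space :: "nat \<Rightarrow> (nat \<times> (nat \<Rightarrow> nat option) \<times> graph \<times> (nat \<Rightarrow> real)) measure" where
  "observation_space n \<equiv>
     count_space UNIV \<Otimes>\<^sub>M count_space UNIV \<Otimes>\<^sub>M count_space UNIV \<Otimes>\<^sub>M weight_space n"

lemma observed_eq: "observed n S U = vimage_algebra (space (sample_space n)) (observation n S U) (observation_space n)"
  unfolding observed_def observation_def ..

lemma observation_in_space: "observation n S U \<omega> \<in> space (observation_space n)"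
  by (simp add: observation_def split_beta space_pair_measure space_PiM)

lemma sets_observed:
  "sets (observed n S U) = {observation n S U -` A \<inter> space (sample_space n) | A. A \<in> sets (observation_space n)}"
  unfolding observed_eq by (rule sets_vimage_algebra2) (use observation_in_space in blast)

lemma space_observed: "space (observed n S U) = space (sample_space n)"
  by (simp add: observed_def)

lemma observed_determined:
  fixes Z :: "sample \<Rightarrow> real"
  assumes Z: "Z \<in> borel_measurable (observed n S U)"
    and mem: "\<omega> \<in> space (sample_space n)" "\<omega>' \<in> space (sample_space n)"
    and eq: "observation n S U \<omega> = observation n S U \<omega>'"
  shows "Z \<omega> = Z \<omega>'"
proof -
  have "Z -` {Z \<omega>} \<inter> space (observed n S U) \<in> sets (observed n S U)"
    by (rule measurable_sets[OF Z]) simp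
  then obtain A where A: "Z -` {Z \<omega>} \<inter> space (sample_space n) = observation n S U -` A \<inter> space (sample_space n)"
    unfolding sets_observed space_observed by blast
  from mem(1) have "\<omega> \<in> observation n S U -` A" using A by blast
  then have "\<omega>' \<in> observation n S U -` A" using eq by simp
  then have "\<omega>' \<in> Z -` {Z \<omega>}" using A mem(2) by blast
  then show ?thesis by simp
qed

lemma measurable_observation: "observation n S U \<in> sample_space n \<rightarrow>\<^sub>M observation_space n"
proof -
  note D = measurable_discrete_data[where n = n, unfolded split_beta']
  have p: "Measurable.pred (sample_space n) (\<lambda>\<omega>. w \<in> U (fst (snd (snd \<omega>))) (snd (snd (snd \<omega>))))" for w
    using D[of "\<lambda>\<sigma> G u. w \<in> U G u"] by simp
  have r: "(\<lambda>\<omega>. \<lambda>w\<in>{1..n}. if w \<in> U (fst (snd (snd \<omega>))) (snd (snd (snd \<omega>))) then fst (snd \<omega>) w else 0) \<in>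
      sample_space n \<rightarrow>\<^sub>M weight_space n"
    by (rule measurable_restrict, rule measurable_If[OF measurable_weight_coord _ predE[OF p]]) auto
  show ?thesis
    unfolding observation_def split_beta'
    by (intro measurable_Pair r D[of "\<lambda>\<sigma> G u. u"] D[of "\<lambda>\<sigma> G u. (Some \<circ> \<sigma>) |` S G u"]
        D[of "\<lambda>\<sigma> G u. induced G (U G u)"])
qed

lemma sets_observed_subset: "sets (observed n S U) \<subseteq> sets (sample_space n)"
  unfolding sets_observed using measurable_sets[OF measurable_observation] by blast

text \<open>
  A function that is measurable in the weights and determined by the observation agrees with a
  measurable function of the observation on all samples with spins in \<open>{1..q}\<close>, a simple graph and
  a marked vertex in \<open>{1..n}\<close>. Only finitely many values of the discrete data occur in these samples,
  and the measurable version is a finite sum over them.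
\<close>

lemma observed_version:
  fixes g :: "(nat \<Rightarrow> nat) \<Rightarrow> (nat \<Rightarrow> real) \<Rightarrow> graph \<Rightarrow> nat \<Rightarrow> real"
  assumes meas: "\<And>\<sigma> G u. \<sigma> \<in> spins q n \<Longrightarrow> (\<lambda>\<phi>. g \<sigma> \<phi> G u) \<in> borel_measurable (weight_space n)"
    and det: "\<And>\<sigma> \<sigma>' \<phi> \<phi>' G G' u u'. \<sigma> \<in> spins q n \<Longrightarrow> \<sigma>' \<in> spins q n \<Longrightarrow> G \<in> simple_graphs n \<Longrightarrow>
      G' \<in> simple_graphs n \<Longrightarrow> u \<in> {1..n} \<Longrightarrow> u' \<in> {1..n} \<Longrightarrow>
      observation n S U (\<sigma>, \<phi>, G, u) = observation n S U (\<sigma>', \<phi>', G', u') \<Longrightarrow> g \<sigma> \<phi> G u = g \<sigma>' \<phi>' G' u'"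
  shows "\<exists>g' \<in> borel_measurable (observed n S U).
    \<forall>\<sigma>\<in>spins q n. \<forall>G\<in>simple_graphs n. \<forall>u\<in>{1..n}. \<forall>\<phi>. g' (\<sigma>, \<phi>, G, u) = g \<sigma> \<phi> G u"
proof -
  define D where "D = spins q n \<times> simple_graphs n \<times> {1..n}"
  have finD: "finite D" unfolding D_def using finite_spins finite_simple_graphs by simp
  define ds where "ds = (\<lambda>(\<sigma>, G, u). (u :: nat, (Some \<circ> \<sigma> :: nat \<Rightarrow> nat option) |` S G u, induced G (U G u)))"
  \<comment> \<open>a representative of each value of the discrete part of the observation\<close>
  define c where "c = inv_into D ds"
  define H where "H = (\<lambda>y. \<Sum>x\<in>ds ` D.
      if fst y = fst x \<and> fst (snd y) = fst (snd x) \<and> fst (snd (snd y)) = snd (snd x)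
      then g (fst (c x)) (snd (snd (snd y))) (fst (snd (c x))) (snd (snd (c x))) else 0)"
  have c: "c x \<in> D" "ds (c x) = x" if "x \<in> ds ` D" for x
    using that unfolding c_def by (auto intro: inv_into_into f_inv_into_f)
  have Hm: "H \<in> borel_measurable (observation_space n)"
    unfolding H_def
  proof (intro borel_measurable_sum measurable_If)
    fix x assume "x \<in> ds ` D"
    from c(1)[OF this] have "fst (c x) \<in> spins q n" unfolding D_def by auto
    then have "(\<lambda>\<phi>. g (fst (c x)) \<phi> (fst (snd (c x))) (snd (snd (c x)))) \<in> borel_measurable (weight_space n)"
      by (rule meas)
    then show "(\<lambda>y. g (fst (c x)) (snd (snd (snd y))) (fst (snd (c x))) (snd (snd (c x)))) \<in>
        borel_measurable (observation_space n)"
      by (rule measurable_compose[rotated]) (intro measurable_compose[OF measurable_snd] measurable_snd)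
    have eq: "Measurable.pred (count_space UNIV) (\<lambda>z. z = v)" for v by simp
    have "Measurable.pred (observation_space n) (\<lambda>y. fst y = fst x)"
      by (rule measurable_compose[OF _ eq]) (rule measurable_fst)
    moreover have "Measurable.pred (observation_space n) (\<lambda>y. fst (snd y) = fst (snd x))"
      by (rule measurable_compose[OF _ eq]) (rule measurable_compose[OF measurable_snd measurable_fst])
    moreover have "Measurable.pred (observation_space n) (\<lambda>y. fst (snd (snd y)) = snd (snd x))"
      by (rule measurable_compose[OF _ eq])
         (rule measurable_compose[OF measurable_snd measurable_compose[OF measurable_snd measurable_fst]])
    ultimately show "{y \<in> space (observation_space n).
        fst y = fst x \<and> fst (snd y) = fst (snd x) \<and> fst (snd (snd y)) = snd (snd x)} \<in> sets (observation_space n)"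
      by (intro predE pred_intros_logic)
  qed auto
  have om: "observation n S U \<in> observed n S U \<rightarrow>\<^sub>M observation_space n"
    unfolding observed_eq by (rule measurable_vimage_algebra1) (use observation_in_space in blast)
  have "H (observation n S U (\<sigma>, \<phi>, G, u)) = g \<sigma> \<phi> G u"
    if mem: "\<sigma> \<in> spins q n" "G \<in> simple_graphs n" "u \<in> {1..n}" for \<sigma> \<phi> G u
  proof -
    let ?y = "observation n S U (\<sigma>, \<phi>, G, u)" and ?x = "ds (\<sigma>, G, u)"
    let ?r = "snd (snd (snd ?y))"
    have xD: "?x \<in> ds ` D" using mem unfolding D_def by blast
    obtain \<sigma>' G' u' where c': "c ?x = (\<sigma>', G', u')" by (cases "c ?x")
    have mem': "\<sigma>' \<in> spins q n" "G' \<in> simple_graphs n" "u' \<in> {1..n}"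
      using c(1)[OF xD] unfolding c' D_def by auto
    have eqd: "ds (\<sigma>', G', u') = ?x" using c(2)[OF xD] unfolding c' .
    from arg_cong[OF this, of "\<lambda>x. fst (snd (snd x))"] have U: "U G' u' = U G u"
      by (simp only: ds_def induced_def prod.case fst_conv snd_conv)
    have "H ?y = (\<Sum>x\<in>{?x}. if fst ?y = fst x \<and> fst (snd ?y) = fst (snd x) \<and> fst (snd (snd ?y)) = snd (snd x)
      then g (fst (c x)) (snd (snd (snd ?y))) (fst (snd (c x))) (snd (snd (c x))) else 0)"
      unfolding H_def using finD xD
      by (intro sum.mono_neutral_right) (auto simp: observation_def ds_def)
    also have "\<dots> = g \<sigma>' ?r G' u'"
      using c' by (simp add: observation_def ds_def)
    also have "\<dots> = g \<sigma> \<phi> G u"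
    proof (rule det[OF mem'(1) mem(1) mem'(2) mem(2) mem'(3) mem(3)])
      show "observation n S U (\<sigma>', ?r, G', u') = ?y"
        using eqd U unfolding ds_def by (auto simp: observation_def fun_eq_iff)
    qed
    finally show ?thesis .
  qed
  then show ?thesis
    by (intro bexI[of _ "\<lambda>\<omega>. H (observation n S U \<omega>)"] measurable_compose[OF om Hm]) blast
qed

section \<open>Concentration of the field\<close>

lemma indep_vars_PiM_components:
  assumes "prob_space N" "finite I" "I \<noteq> {}"
  shows "prob_space.indep_vars (PiM I (\<lambda>_. N)) (\<lambda>_. N) (\<lambda>i x. x i) I"
proof -
  interpret P: prob_space "PiM I (\<lambda>_. N)" by (rule prob_space_PiM) (rule assms)
  have "distr (PiM I (\<lambda>_. N)) (PiM I (\<lambda>_. N)) (\<lambda>x. \<lambda>i\<in>I. x i) =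
      distr (PiM I (\<lambda>_. N)) (PiM I (\<lambda>_. N)) (\<lambda>x. x)"
    by (rule distr_cong) (auto simp: space_PiM)
  also have "\<dots> = PiM I (\<lambda>_. N)" by (rule distr_id2) simp
  also have "\<dots> = PiM I (\<lambda>i. distr (PiM I (\<lambda>_. N)) N (\<lambda>x. x i))"
    by (rule PiM_cong[OF refl], rule distr_PiM_component[symmetric]) (rule assms)
  finally show ?thesis
    by (subst P.indep_vars_iff_distr_eq_PiM'[OF assms(3)]) (auto intro: measurable_component_singleton)
qed

lemma hoeffding_PiM:
  fixes g :: "'i \<Rightarrow> 'a \<Rightarrow> real"
  assumes N: "prob_space N" and I: "finite I" "I \<noteq> {}" and L: "L > 0" and t: "t \<ge> 0"
    and g: "\<And>i. i \<in> I \<Longrightarrow> g i \<in> borel_measurable N"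
      "\<And>i x. i \<in> I \<Longrightarrow> x \<in> space N \<Longrightarrow> 0 \<le> g i x \<and> g i x \<le> L"
  shows "measure (PiM I (\<lambda>_. N)) {x \<in> space (PiM I (\<lambda>_. N)).
      t \<le> \<bar>(\<Sum>i\<in>I. g i (x i)) - (\<Sum>i\<in>I. \<integral>y. g i y \<partial>N)\<bar>} \<le> 2 * exp (- 2 * t ^ 2 / (real (card I) * L ^ 2))"
proof -
  let ?P = "PiM I (\<lambda>_. N)"
  interpret P: prob_space ?P by (rule prob_space_PiM) (rule N)
  have E: "P.expectation (\<lambda>x. g i (x i)) = (\<integral>y. g i y \<partial>N)" if "i \<in> I" for i
  proof -
    have "(\<integral>y. g i y \<partial>N) = (\<integral>y. g i y \<partial>distr ?P N (\<lambda>x. x i))"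
      by (subst distr_PiM_component) (use N I that in auto)
    also have "\<dots> = P.expectation (\<lambda>x. g i (x i))"
      by (rule integral_distr) (use that g in \<open>auto intro: measurable_component_singleton\<close>)
    finally show ?thesis ..
  qed
  interpret H: Hoeffding_ineq ?P I "\<lambda>i x. g i (x i)" "\<lambda>_. 0" "\<lambda>_. L" "\<Sum>i\<in>I. P.expectation (\<lambda>x. g i (x i))"
  proof unfold_locales
    show "P.indep_vars (\<lambda>_. borel) (\<lambda>i x. g i (x i)) I"
      by (rule P.indep_vars_compose2[OF indep_vars_PiM_components[OF N I]]) (rule g)
    fix i assume i: "i \<in> I"
    show "AE x in ?P. g i (x i) \<in> {0..L}"
      by (rule AE_I2) (use i g(2)[OF i] in \<open>auto simp: space_PiM PiE_def\<close>)
  qed (use I in auto)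
  have "P.prob {x \<in> space ?P. t \<le> \<bar>(\<Sum>i\<in>I. g i (x i)) - (\<Sum>i\<in>I. P.expectation (\<lambda>x. g i (x i)))\<bar>}
      \<le> 2 * exp (- 2 * t\<^sup>2 / (\<Sum>i\<in>I. (L - 0)\<^sup>2))"
    by (rule H.Hoeffding_ineq_abs_ge[OF t]) (use L I in \<open>auto simp: card_gt_0_iff\<close>)
  moreover have "(\<Sum>i\<in>I. P.expectation (\<lambda>x. g i (x i))) = (\<Sum>i\<in>I. \<integral>y. g i y \<partial>N)"
    by (rule sum.cong[OF refl]) (rule E)
  ultimately show ?thesis by simp
qed

text \<open>
  Weights outside \<open>[0, L)\<close> are replaced by zero. This makes the weights bounded under the
  unconditioned law, so that no moment of \<open>\<nu>\<close> is needed; nothing changes on the event that all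
  weights are nonnegative and smaller than \<open>L\<close>.
\<close>

definition clip :: "real \<Rightarrow> real \<Rightarrow> real" where
  "clip L x = (if 0 \<le> x \<and> x < L then x else 0)"

lemma measurable_clip [measurable]: "clip L \<in> borel_measurable borel"
  unfolding clip_def[abs_def] by measurable

lemma clip_bounds: "0 \<le> L \<Longrightarrow> 0 \<le> clip L x" "0 \<le> L \<Longrightarrow> clip L x \<le> L"
  by (auto simp: clip_def)

text \<open>The mean coupling of a fixed spin with a uniform one; it is the same for every fixed spin.\<close>

definition mean_rate :: "nat \<Rightarrow> real \<Rightarrow> real \<Rightarrow> real" where
  "mean_rate q a b = (a + (real q - 1) * b) / real q"

lemma expectation_rate:
  assumes "q \<ge> 1" "k \<in> {1..q}"
  shows "(\<integral>x. (if k = x then a else b) \<partial>measure_pmf (pmf_of_set {1..q})) = mean_rate q a b"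
proof -
  have "(\<integral>x. (if k = x then a else b) \<partial>measure_pmf (pmf_of_set {1..q})) =
      (\<Sum>x\<in>{1..q}. if k = x then a else b) / real q"
    using assms by (subst integral_pmf_of_set) auto
  also have "(\<Sum>x\<in>{1..q}. if k = x then a else b) = a + (\<Sum>x\<in>{1..q} - {k}. b)"
    using assms by (subst sum.remove[of _ k]) (auto intro!: sum.cong)
  also have "(\<Sum>x\<in>{1..q} - {k}. b) = (real q - 1) * b"
    using assms by (simp add: of_nat_diff)
  finally show ?thesis by (simp add: mean_rate_def)
qed

text \<open>
  The event that the field which all vertices exert on a vertex of spin \<open>k\<close>, computed with clipped
  weights, differs from \<open>m\<close> by more than \<open>\<tau>\<close>.
\<close>

definition deviation_event ::
  "nat \<Rightarrow> real \<Rightarrow> real \<Rightarrow> real \<Rightarrow> real \<Rightarrow> real \<Rightarrow> nat \<Rightarrow> sample set" where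
  "deviation_event n a b L m \<tau> k = {(\<sigma>, \<phi>, G, u) \<in> space (sample_space n).
     \<tau> < \<bar>(\<Sum>w\<in>{1..n}. clip L (\<phi> w) * (if k = \<sigma> w then a else b)) - m\<bar>}"

lemma measurable_field_sum:
  fixes f :: "real \<Rightarrow> real"
  assumes "f \<in> borel_measurable borel"
  shows "(\<lambda>\<omega>. \<Sum>w\<in>{1..n}. f (fst (snd \<omega>) w) * (if k = fst \<omega> w then a else b)) \<in>
     borel_measurable (sample_space n)"
proof (intro borel_measurable_sum borel_measurable_times)
  fix w assume w: "w \<in> {1..n}"
  show "(\<lambda>\<omega>. f (fst (snd \<omega>) w)) \<in> borel_measurable (sample_space n)"
    by (rule measurable_compose[OF measurable_weight_coord[OF w] assms])
  show "(\<lambda>\<omega>. if k = fst \<omega> w then a else b) \<in> borel_measurable (sample_space n)"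
    by (rule measurable_compose[OF measurable_spin_coord[OF w], where g = "\<lambda>x. if k = x then a else b"]) simp
qed

lemma sets_deviation_event: "deviation_event n a b L m \<tau> k \<in> sets (sample_space n)"
proof -
  note [measurable] = measurable_field_sum[OF measurable_clip, of L k a b n]
  have "{\<omega> \<in> space (sample_space n).
      \<tau> < \<bar>(\<Sum>w\<in>{1..n}. clip L (fst (snd \<omega>) w) * (if k = fst \<omega> w then a else b)) - m\<bar>} \<in> sets (sample_space n)"
    by measurable
  then show ?thesis unfolding deviation_event_def by (simp add: split_beta')
qed

text \<open>
  Hoeffding's inequality is applied twice: to the weights for fixed spins, with deviation \<open>t1\<close>, and
  then to the spins, with deviation \<open>t2\<close>; the latter is multiplied by the mean clipped weight, which is
  at most \<open>L\<close>.
\<close>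

lemma deviation_prob:
  assumes \<nu>: "prob_space \<nu>" "sets \<nu> = sets borel" and n: "n \<ge> 1" and q: "q \<ge> 1"
    and ab: "0 < a" "a \<le> c0" "0 < b" "b \<le> c0" and L: "L > 0" and t: "t1 \<ge> 0" "t2 \<ge> 0"
    and k: "k \<in> {1..q}"
  shows "measure (dcsbm q a b \<nu> n)
      (deviation_event n a b L (real n * ((\<integral>x. clip L x \<partial>\<nu>) * mean_rate q a b)) (t1 + L * t2) k) \<le>
     2 * exp (- 2 * t1 ^ 2 / (real n * (L * c0) ^ 2)) + 2 * exp (- 2 * t2 ^ 2 / (real n * c0 ^ 2))"
proof -
  let ?D = "dcsbm q a b \<nu> n" and ?N = "PiM {1..n} (\<lambda>_. \<nu>)" and ?p = "measure_pmf (pmf_of_set {1..q})"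
  let ?M = "PiM {1..n} (\<lambda>_. ?p)"
  let ?c = "\<lambda>x. if k = x then a else b"
  interpret D: prob_space ?D by (rule prob_space_dcsbm[OF \<nu> n q])
  interpret \<nu>: prob_space \<nu> by (rule \<nu>)
  interpret N: prob_space ?N by (rule prob_space_PiM) (rule \<nu>)
  interpret M: prob_space ?M by (rule prob_space_PiM) (rule measure_pmf.prob_space_axioms)
  define \<mu> where "\<mu> = (\<integral>x. clip L x \<partial>\<nu>)"
  define S where "S = deviation_event n a b L (real n * (\<mu> * mean_rate q a b)) (t1 + L * t2) k"
  have clipm: "clip L \<in> borel_measurable \<nu>"
    unfolding measurable_cong_sets[OF \<nu>(2) refl] by (rule measurable_clip)
  have clipi: "integrable \<nu> (clip L)"
    by (rule \<nu>.integrable_const_bound[of _ L]) (use clip_bounds[of L] L clipm in auto)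
  have \<mu>: "0 \<le> \<mu>" "\<mu> \<le> L"
  proof -
    show "0 \<le> \<mu>" unfolding \<mu>_def using L clip_bounds by (intro integral_nonneg_AE) auto
    have "\<mu> \<le> (\<integral>x. L \<partial>\<nu>)" unfolding \<mu>_def using L clip_bounds clipi by (intro integral_mono) auto
    then show "\<mu> \<le> L" using \<nu>.prob_space by simp
  qed
  have c0: "c0 > 0" using ab by linarith
  define E1 where "E1 \<sigma> = {\<phi> \<in> space ?N. t1 \<le> \<bar>(\<Sum>w\<in>{1..n}. clip L (\<phi> w) * ?c (\<sigma> w)) -
      (\<Sum>w\<in>{1..n}. \<integral>x. clip L x * ?c (\<sigma> w) \<partial>\<nu>)\<bar>}" for \<sigma> :: "nat \<Rightarrow> nat"
  define E2 where "E2 = {\<sigma> \<in> space ?M. t2 \<le> \<bar>(\<Sum>w\<in>{1..n}. ?c (\<sigma> w)) - (\<Sum>w\<in>{1..n}. \<integral>x. ?c x \<partial>?p)\<bar>}"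
  let ?p1 = "2 * exp (- 2 * t1 ^ 2 / (real n * (L * c0) ^ 2))"
  let ?p2 = "2 * exp (- 2 * t2 ^ 2 / (real n * c0 ^ 2))"
  have P1: "measure ?N (E1 \<sigma>) \<le> ?p1" for \<sigma>
  proof -
    have "measure ?N (E1 \<sigma>) \<le> 2 * exp (- 2 * t1 ^ 2 / (real (card {1..n}) * (L * c0) ^ 2))"
      unfolding E1_def
    proof (rule hoeffding_PiM[where g = "\<lambda>w x. clip L x * ?c (\<sigma> w)"])
      show "(\<lambda>x. clip L x * ?c (\<sigma> w)) \<in> borel_measurable \<nu>" for w
        using clipm by (rule borel_measurable_times) simp
      show "0 \<le> clip L x * ?c (\<sigma> w) \<and> clip L x * ?c (\<sigma> w) \<le> L * c0" for w x
        using clip_bounds[of L x] L ab c0 by (auto intro!: mult_mono mult_nonneg_nonneg)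
    qed (use \<nu> n L c0 t in auto)
    then show ?thesis by simp
  qed
  have P2: "measure ?M E2 \<le> ?p2"
  proof -
    have "measure ?M E2 \<le> 2 * exp (- 2 * t2 ^ 2 / (real (card {1..n}) * c0 ^ 2))"
      unfolding E2_def
      by (rule hoeffding_PiM[where g = "\<lambda>w. ?c"])
         (use n c0 t ab in \<open>auto intro: measure_pmf.prob_space_axioms\<close>)
    then show ?thesis by simp
  qed
  have setsM: "sets ?M = Pow (PiE {1..n} (\<lambda>_. UNIV))"
    using sets_PiM_nat[of n] sets_PiM_const[of ?p "count_space UNIV" "{1..n}"] by simp
  have sN: "sets ?N = sets (weight_space n)" by (rule sets_PiM_const) (rule \<nu>)
  have cw: "(\<lambda>\<phi>. clip L (\<phi> w)) \<in> borel_measurable (weight_space n)" if "w \<in> {1..n}" for w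
    by (rule measurable_compose[OF _ measurable_clip]) (rule measurable_component_singleton[OF that])
  have S1: "E1 \<sigma> \<in> sets ?N" for \<sigma>
  proof -
    have "(\<lambda>\<phi>. \<Sum>w\<in>{1..n}. clip L (\<phi> w) * ?c (\<sigma> w)) \<in> borel_measurable ?N"
      unfolding measurable_cong_sets[OF sN refl]
      by (intro borel_measurable_sum borel_measurable_times borel_measurable_const cw)
    then show ?thesis unfolding E1_def
      by (intro borel_measurable_le borel_measurable_const borel_measurable_abs borel_measurable_diff)
  qed
  have S2: "E2 \<in> sets ?M" unfolding setsM by (auto simp: E2_def space_PiM)
  have SS: "S \<in> sets (sample_space n)" unfolding S_def by (rule sets_deviation_event)
  have incl: "indicator S (\<sigma>, \<phi>, G, u) \<le> (indicator (E1 \<sigma>) \<phi> + indicator E2 \<sigma> :: ennreal)"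
    if "\<sigma> \<in> space ?M" "\<phi> \<in> space ?N" for \<sigma> \<phi> G u
  proof -
    have "\<phi> \<in> E1 \<sigma> \<or> \<sigma> \<in> E2" if s: "(\<sigma>, \<phi>, G, u) \<in> S"
    proof (rule ccontr)
      assume neg: "\<not> (\<phi> \<in> E1 \<sigma> \<or> \<sigma> \<in> E2)"
      let ?A = "\<Sum>w\<in>{1..n}. clip L (\<phi> w) * ?c (\<sigma> w)" and ?B = "\<Sum>w\<in>{1..n}. ?c (\<sigma> w)"
      have "(\<Sum>w\<in>{1..n}. \<integral>x. clip L x * ?c (\<sigma> w) \<partial>\<nu>) = \<mu> * ?B"
        by (simp add: \<mu>_def sum_distrib_left)
      moreover have "\<not> t1 \<le> \<bar>?A - (\<Sum>w\<in>{1..n}. \<integral>x. clip L x * ?c (\<sigma> w) \<partial>\<nu>)\<bar>"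
        using neg \<open>\<phi> \<in> space ?N\<close> unfolding E1_def by blast
      ultimately have 1: "\<bar>?A - \<mu> * ?B\<bar> < t1" by (simp only: not_le)
      have "(\<Sum>w\<in>{1..n}. \<integral>x. ?c x \<partial>?p) = real n * mean_rate q a b"
        using expectation_rate[OF q k] by simp
      moreover have "\<not> t2 \<le> \<bar>?B - (\<Sum>w\<in>{1..n}. \<integral>x. ?c x \<partial>?p)\<bar>"
        using neg \<open>\<sigma> \<in> space ?M\<close> unfolding E2_def by blast
      ultimately have 2: "\<bar>?B - real n * mean_rate q a b\<bar> < t2" by (simp only: not_le)
      have "\<bar>\<mu> * (?B - real n * mean_rate q a b)\<bar> \<le> L * t2"
        unfolding abs_mult using \<mu> 2 by (intro mult_mono) auto
      moreover have "?A - real n * (\<mu> * mean_rate q a b) =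
          (?A - \<mu> * ?B) + \<mu> * (?B - real n * mean_rate q a b)" by (simp add: algebra_simps)
      moreover have "t1 + L * t2 < \<bar>?A - real n * (\<mu> * mean_rate q a b)\<bar>"
        using s unfolding S_def deviation_event_def by simp
      ultimately show False using 1 by linarith
    qed
    then show ?thesis by (auto simp: indicator_def)
  qed
  have "emeasure ?D S = (\<integral>\<^sup>+\<omega>. indicator S \<omega> \<partial>?D)"
    using SS sets_dcsbm[OF \<nu>] by simp
  also have "\<dots> = (\<integral>\<^sup>+\<sigma>. \<integral>\<^sup>+\<phi>. \<integral>\<^sup>+G. \<integral>\<^sup>+u. indicator S (\<sigma>, \<phi>, G, u)
         \<partial>measure_pmf (pmf_of_set {1..n}) \<partial>measure_pmf (graph_law n a b \<sigma> \<phi>) \<partial>?N \<partial>?M)"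
    by (rule nn_integral_dcsbm_iterated[OF \<nu>]) (rule borel_measurable_indicator[OF SS])
  also have "\<dots> \<le> (\<integral>\<^sup>+\<sigma>. \<integral>\<^sup>+\<phi>. \<integral>\<^sup>+G. \<integral>\<^sup>+u. (indicator (E1 \<sigma>) \<phi> + indicator E2 \<sigma>)
         \<partial>measure_pmf (pmf_of_set {1..n}) \<partial>measure_pmf (graph_law n a b \<sigma> \<phi>) \<partial>?N \<partial>?M)"
    by (intro nn_integral_mono incl)
  also have "\<dots> = (\<integral>\<^sup>+\<sigma>. \<integral>\<^sup>+\<phi>. (indicator (E1 \<sigma>) \<phi> + indicator E2 \<sigma>) \<partial>?N \<partial>?M)"
    by (simp only: nn_integral_const measure_pmf.emeasure_space_1 mult_1_right)
  also have "\<dots> = (\<integral>\<^sup>+\<sigma>. emeasure ?N (E1 \<sigma>) + indicator E2 \<sigma> \<partial>?M)"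
    by (intro nn_integral_cong, subst nn_integral_add)
       (use S1 in \<open>simp_all only: nn_integral_const N.emeasure_space_1 nn_integral_indicator mult_1_right
          borel_measurable_indicator borel_measurable_const\<close>)
  also have "\<dots> \<le> (\<integral>\<^sup>+\<sigma>. ennreal ?p1 + indicator E2 \<sigma> \<partial>?M)"
    by (intro nn_integral_mono add_right_mono) (simp only: N.emeasure_eq_measure ennreal_leI P1)
  also have "\<dots> = ennreal ?p1 + emeasure ?M E2"
    by (subst nn_integral_add) (use S2 in \<open>simp_all only: nn_integral_const M.emeasure_space_1
          nn_integral_indicator mult_1_right borel_measurable_indicator borel_measurable_const\<close>)
  also have "\<dots> \<le> ennreal ?p1 + ennreal ?p2"
    by (intro add_left_mono) (simp only: M.emeasure_eq_measure ennreal_leI P2)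
  also have "\<dots> = ennreal (?p1 + ?p2)" by (rule ennreal_plus[symmetric]) auto
  finally have "ennreal (measure ?D S) \<le> ennreal (?p1 + ?p2)" unfolding D.emeasure_eq_measure .
  moreover have "0 \<le> ?p1 + ?p2" by simp
  ultimately show ?thesis unfolding S_def \<mu>_def by (simp only: ennreal_le_iff)
qed

section \<open>Distance in mean between conditional probabilities and the local posterior\<close>

text \<open>The event that all weights are smaller than \<open>L\<close>.\<close>

definition trunc_event :: "nat \<Rightarrow> real \<Rightarrow> sample set" where
  "trunc_event n L = {(\<sigma>, \<phi>, G, u) \<in> space (sample_space n). \<forall>w\<in>{1..n}. \<phi> w < L}"

lemma sets_trunc_event: "trunc_event n L \<in> sets (sample_space n)"
proof -
  have "{\<omega> \<in> space (sample_space n). \<forall>w\<in>{1..n}. fst (snd \<omega>) w < L} \<in> sets (sample_space n)"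
  proof (rule sets.sets_Collect_finite_All)
    fix w assume "w \<in> {1..n}"
    note [measurable] = measurable_weight_coord[OF this]
    show "{\<omega> \<in> space (sample_space n). fst (snd \<omega>) w < L} \<in> sets (sample_space n)" by measurable
  qed simp
  then show ?thesis unfolding trunc_event_def by (simp add: split_beta')
qed

lemma sets_discrete_event: "{(\<sigma>, \<phi>, G, u) \<in> space (sample_space n). P \<sigma> G u} \<in> sets (sample_space n)"
  using predE[OF measurable_discrete_data[of P n]] by (simp add: split_beta')

text \<open>The event that \<open>A \<union> B\<close> has at most \<open>cap\<close> vertices.\<close>

definition size_event ::
  "nat \<Rightarrow> (graph \<Rightarrow> nat \<Rightarrow> nat set) \<Rightarrow> (graph \<Rightarrow> nat \<Rightarrow> nat set) \<Rightarrow> real \<Rightarrow> sample set" where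
  "size_event n A B cap =
     {(\<sigma>, \<phi>, G, u) \<in> space (sample_space n). real (card (A G u \<union> B G u)) \<le> cap}"

lemma sets_size_event: "size_event n A B cap \<in> sets (sample_space n)"
  unfolding size_event_def by (rule sets_discrete_event)

lemma sets_marked_spin: "marked_spin n s \<in> sets (sample_space n)"
  unfolding marked_spin_def by (rule sets_discrete_event)

text \<open>
  The event that \<open>A \<union> B\<close> is small and that the field with clipped weights is within \<open>\<tau>\<close> of \<open>m\<close>
  for every spin.
\<close>

definition typical_event ::
  "nat \<Rightarrow> nat \<Rightarrow> real \<Rightarrow> real \<Rightarrow> (graph \<Rightarrow> nat \<Rightarrow> nat set) \<Rightarrow> (graph \<Rightarrow> nat \<Rightarrow> nat set) \<Rightarrow>
    real \<Rightarrow> real \<Rightarrow> real \<Rightarrow> real \<Rightarrow> sample set" where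
  "typical_event q n a b A B L cap m \<tau> =
     size_event n A B cap - (\<Union>k\<in>{1..q}. deviation_event n a b L m \<tau> k)"

lemma sets_typical_event: "typical_event q n a b A B L cap m \<tau> \<in> sets (sample_space n)"
  unfolding typical_event_def
  by (intro sets.Diff sets_size_event sets.finite_UN sets_deviation_event) simp

lemma integral_uniform_measure:
  fixes f :: "'a \<Rightarrow> real"
  assumes D: "prob_space D" and A: "A \<in> sets D" "measure D A > 0" and f: "f \<in> borel_measurable D"
  shows "(\<integral>x. f x \<partial>uniform_measure D A) = (\<integral>x. f x * indicator A x \<partial>D) / measure D A"
proof -
  interpret prob_space D by (rule D)
  have "uniform_measure D A = density D (\<lambda>x. ennreal (indicator A x / measure D A))"
    unfolding uniform_measure_def emeasure_eq_measure using A
    by (intro arg_cong[where f="density D"] ext) (simp add: divide_ennreal[symmetric] ennreal_indicator)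
  then have "(\<integral>x. f x \<partial>uniform_measure D A) = (\<integral>x. (indicator A x / measure D A) *\<^sub>R f x \<partial>D)"
    using A by (simp only:) (intro integral_density f borel_measurable_divide borel_measurable_indicator, auto)
  also have "\<dots> = (\<integral>x. f x * indicator A x / measure D A \<partial>D)" by (simp add: mult.commute)
  finally show ?thesis by simp
qed

lemma AE_dcsbm_valid:
  assumes "prob_space \<nu>" "sets \<nu> = sets borel" "n \<ge> 1" "q \<ge> 1"
  shows "AE \<omega> in dcsbm q a b \<nu> n. fst \<omega> \<in> spins q n \<and> fst (snd (snd \<omega>)) \<in> simple_graphs n \<and> snd (snd (snd \<omega>)) \<in> {1..n}"
proof -
  let ?D = "dcsbm q a b \<nu> n"
  interpret D: prob_space ?D by (rule prob_space_dcsbm[OF assms])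
  define S where "S = {(\<sigma>, \<phi>, G, u) \<in> space (sample_space n). \<not> (\<sigma> \<in> spins q n \<and> G \<in> simple_graphs n \<and> u \<in> {1..n})}"
  have S: "S \<in> sets (sample_space n)" unfolding S_def by (rule sets_discrete_event)
  have sD: "sets ?D = sets (sample_space n)" by (rule sets_dcsbm[OF assms(1,2)])
  have "measure ?D S = (\<integral>\<omega>. indicator S \<omega> \<partial>?D)"
    using S sD by simp
  also have "\<dots> = (\<integral>\<phi>. cell_sum q n a b (indicator S) \<phi> \<partial>PiM {1..n} (\<lambda>_. \<nu>))"
    by (rule integral_dcsbm[OF assms, where B = 1]) (use S in \<open>auto simp: indicator_def\<close>)
  also have "cell_sum q n a b (indicator S) = (\<lambda>\<phi>. 0)"
    unfolding cell_sum_def by (intro ext sum.neutral ballI) (auto simp: S_def)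
  finally have "emeasure ?D S = 0" by (simp add: D.emeasure_eq_measure)
  then have "S \<in> null_sets ?D" using S sD by auto
  then show ?thesis
    by (rule AE_I') (auto simp: S_def sets_eq_imp_space_eq[OF sD])
qed

text \<open>
  If the observation determines the local posterior and does not include the spins in \<open>A\<close>, the
  conditional probability of the spin of \<open>u\<close> is close in mean to the local posterior \<open>h\<close>.
  The proof tests the difference against its sign \<open>Z\<close>, which is measurable with respect to the
  observation: there the conditional probability may be replaced by the indicator of the event itself,
  and the comparison for fixed weights applies. The same bound serves for both conditional
  probabilities in the theorem, and neither sigma-algebra needs to contain the other.
\<close>

lemma posterior_L1_error:
  fixes A B C S U :: "graph \<Rightarrow> nat \<Rightarrow> nat set"
  assumes \<nu>: "prob_space \<nu>" "sets \<nu> = sets borel" and pos: "AE x in \<nu>. 0 \<le> x"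
    and n: "n \<ge> 1" and q: "q \<ge> 1"
    and ab: "0 < a" "a \<le> c0" "0 < b" "b \<le> c0"
    and L0: "L \<ge> 0" and L: "L ^ 2 * c0 / real n \<le> 1 / 2" and nonneg: "cap \<ge> 0" "\<tau> \<ge> 0"
    and d: "cap * L * (\<tau> + cap * L * c0) / real n + 2 * (cap * real n * (L ^ 2 * c0 / real n) ^ 2) \<le> d"
    and trunc: "measure (dcsbm q a b \<nu> n) (trunc_event n L) > 0"
    and part: "\<And>G u. G \<in> simple_graphs n \<Longrightarrow> u \<in> {1..n} \<Longrightarrow>
           A G u \<union> B G u \<union> C G u = {1..n} \<and>
           A G u \<inter> B G u = {} \<and> A G u \<inter> C G u = {} \<and> B G u \<inter> C G u = {} \<and>
           u \<in> A G u \<and> separates G (B G u) (A G u) (C G u)"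
    and SA: "\<And>G u. G \<in> simple_graphs n \<Longrightarrow> u \<in> {1..n} \<Longrightarrow> S G u \<inter> A G u = {}"
    and det: "\<And>\<sigma> \<sigma>' \<phi> \<phi>' G G' u u'. G \<in> simple_graphs n \<Longrightarrow>
      G' \<in> simple_graphs n \<Longrightarrow> u \<in> {1..n} \<Longrightarrow> u' \<in> {1..n} \<Longrightarrow>
      observation n S U (\<sigma>, \<phi>, G, u) = observation n S U (\<sigma>', \<phi>', G', u') \<Longrightarrow>
      local_posterior q n a b s (A G u) (B G u) \<sigma> \<phi> G u =
      local_posterior q n a b s (A G' u') (B G' u') \<sigma>' \<phi>' G' u'"
  defines "M \<equiv> uniform_measure (dcsbm q a b \<nu> n) (trunc_event n L)"
  shows "\<exists>h \<in> borel_measurable (observed n S U).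
    (\<forall>\<sigma>\<in>spins q n. \<forall>G\<in>simple_graphs n. \<forall>u\<in>{1..n}. \<forall>\<phi>.
       h (\<sigma>, \<phi>, G, u) = local_posterior q n a b s (A G u) (B G u) \<sigma> \<phi> G u) \<and>
    integrable M (\<lambda>\<omega>. cprob M (observed n S U) (marked_spin n s) \<omega> - h \<omega>) \<and>
    (\<integral>\<omega>. \<bar>cprob M (observed n S U) (marked_spin n s) \<omega> - h \<omega>\<bar> \<partial>M) \<le>
      exp (2 * d) - 1 + measure M (space M - typical_event q n a b A B L cap (real n * m) \<tau>)"
proof -
  let ?D = "dcsbm q a b \<nu> n" and ?F = "observed n S U" and ?X = "marked_spin n s"
    and ?N = "PiM {1..n} (\<lambda>_. \<nu>)" and ?\<Lambda> = "trunc_event n L"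
  let ?lp = "\<lambda>\<sigma> \<phi> G u. local_posterior q n a b s (A G u) (B G u) \<sigma> \<phi> G u"
  define T where "T = typical_event q n a b A B L cap (real n * m) \<tau>"
  interpret D: prob_space ?D by (rule prob_space_dcsbm[OF \<nu> n q])
  have sD: "sets ?D = sets (sample_space n)" by (rule sets_dcsbm[OF \<nu>])
  have sM: "sets M = sets (sample_space n)" unfolding M_def by (simp add: sD)
  have spM: "space M = space (sample_space n)" by (rule sets_eq_imp_space_eq[OF sM])
  have \<Lambda>: "?\<Lambda> \<in> sets ?D" unfolding sD by (rule sets_trunc_event)
  have pM: "prob_space M" unfolding M_def
    by (rule prob_space_uniform_measure) (use trunc in \<open>simp_all add: D.emeasure_eq_measure\<close>)
  interpret M: prob_space M by (rule pM)
  have sub: "subalgebra M ?F"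
    unfolding subalgebra_def spM sM space_observed using sets_observed_subset by blast
  interpret M: finite_measure_subalgebra M ?F by unfold_locales (rule sub)
  have mb: "borel_measurable M = (borel_measurable (sample_space n) :: (sample \<Rightarrow> real) set)"
    by (rule measurable_cong_sets[OF sM refl])
  have Fm: "f \<in> borel_measurable (sample_space n)" if "f \<in> borel_measurable ?F" for f :: "sample \<Rightarrow> real"
    using measurable_from_subalg[OF sub that] unfolding mb .
  have X: "?X \<in> sets M" unfolding sM by (rule sets_marked_spin)
  have Ts: "T \<in> sets (sample_space n)" unfolding T_def by (rule sets_typical_event)
  have sub1: "A G u \<union> B G u \<subseteq> {1..n}" if "G \<in> simple_graphs n" "u \<in> {1..n}" for G u
    using part[OF that] by blast
  have "\<exists>g \<in> borel_measurable ?F. \<forall>\<sigma>\<in>spins q n. \<forall>G\<in>simple_graphs n. \<forall>u\<in>{1..n}. \<forall>\<phi>.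
       g (\<sigma>, \<phi>, G, u) = (if G \<in> simple_graphs n \<and> u \<in> {1..n} then ?lp \<sigma> \<phi> G u else 0)"
  proof (rule observed_version)
    fix \<sigma> G u assume s: "\<sigma> \<in> spins q n"
    show "(\<lambda>\<phi>. if G \<in> simple_graphs n \<and> u \<in> {1..n} then ?lp \<sigma> \<phi> G u else 0) \<in> borel_measurable (weight_space n)"
    proof (cases "G \<in> simple_graphs n \<and> u \<in> {1..n}")
      case True
      have ov: "override_on \<sigma> \<rho> (A G u) \<in> PiE {1..n} (\<lambda>_. UNIV)" if "\<rho> \<in> PiE (A G u) (\<lambda>_. {1..q})" for \<rho>
        using override_on_PiE[of "A G u" "{1..n}" \<sigma> "{1..q}" \<rho>] that s sub1[of G u] True
        unfolding spins_def by (auto simp: PiE_def)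
      have "(\<lambda>\<phi>. ?lp \<sigma> \<phi> G u) \<in> borel_measurable (weight_space n)"
        unfolding local_posterior_def
        by (intro borel_measurable_divide borel_measurable_sum borel_measurable_times borel_measurable_const
            measurable_pair_lik_section ov) (auto simp: inner_pairs_def)
      then show ?thesis using True by simp
    next
      case False
      show ?thesis by (simp only: False if_False borel_measurable_const)
    qed
  next
    fix \<sigma> \<sigma>' \<phi> \<phi>' G G' u u'
    assume h: "G \<in> simple_graphs n" "G' \<in> simple_graphs n" "u \<in> {1..n}" "u' \<in> {1..n}"
      "observation n S U (\<sigma>, \<phi>, G, u) = observation n S U (\<sigma>', \<phi>', G', u')"
    show "(if G \<in> simple_graphs n \<and> u \<in> {1..n} then ?lp \<sigma> \<phi> G u else 0) =
        (if G' \<in> simple_graphs n \<and> u' \<in> {1..n} then ?lp \<sigma>' \<phi>' G' u' else 0)"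
      using det[OF h] h(1-4) by simp
  qed
  then obtain g where gF: "g \<in> borel_measurable ?F"
    and g: "\<And>\<sigma> G u \<phi>. \<sigma> \<in> spins q n \<Longrightarrow> G \<in> simple_graphs n \<Longrightarrow> u \<in> {1..n} \<Longrightarrow> g (\<sigma>, \<phi>, G, u) = ?lp \<sigma> \<phi> G u"
    by auto
  \<comment> \<open>\<open>g\<close> is arbitrary on samples of probability zero; clamping makes it bounded everywhere\<close>
  define h where "h \<omega> = max 0 (min 1 (g \<omega>))" for \<omega>
  have hF: "h \<in> borel_measurable ?F"
    unfolding h_def by (intro borel_measurable_max borel_measurable_min borel_measurable_const gF)
  have h: "h (\<sigma>, \<phi>, G, u) = ?lp \<sigma> \<phi> G u" if "\<sigma> \<in> spins q n" "G \<in> simple_graphs n" "u \<in> {1..n}" for \<sigma> \<phi> G u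
    unfolding h_def g[OF that] using local_posterior_bounds[of q n a b s "A G u" "B G u" \<sigma> \<phi> G u] by simp
  have h01: "0 \<le> h \<omega>" "h \<omega> \<le> 1" for \<omega> unfolding h_def by auto
  define P where "P = cprob M ?F ?X"
  have PF: "P \<in> borel_measurable ?F" unfolding P_def cprob_def by simp
  have iX: "integrable M (indicator ?X :: sample \<Rightarrow> real)"
    by (rule M.integrable_const_bound[of _ 1]) (use X in \<open>auto simp: indicator_def\<close>)
  have iP: "integrable M P" unfolding P_def cprob_def by (rule M.real_cond_exp_int(1)[OF iX])
  have hM: "h \<in> borel_measurable M" unfolding mb by (rule Fm[OF hF])
  have ih: "integrable M h"
    by (rule M.integrable_const_bound[of _ 1]) (use h01 hM in auto)
  define Z where "Z \<omega> = sgn (P \<omega> - h \<omega>)" for \<omega>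
  have ZF: "Z \<in> borel_measurable ?F"
    unfolding Z_def
    by (rule measurable_compose[OF _ borel_measurable_sgn]) (intro borel_measurable_diff PF hF)
  have ZM: "Z \<in> borel_measurable M" unfolding mb by (rule Fm[OF ZF])
  have Z1: "\<bar>Z \<omega>\<bar> \<le> 1" for \<omega> unfolding Z_def by (simp add: sgn_if)
  \<comment> \<open>the tested difference and its bound, as integrands with respect to the unconditioned law\<close>
  define f1 where "f1 \<omega> = (indicator ?X \<omega> - h \<omega>) * Z \<omega> * indicator ?\<Lambda> \<omega>" for \<omega>
  define f2 where "f2 \<omega> = (if \<omega> \<in> T then exp (2 * d) - 1 else 1) * indicator ?\<Lambda> \<omega>" for \<omega> :: sample
  have d0: "d \<ge> 0"
    using nonneg L0 ab by (intro order_trans[OF _ d] add_nonneg_nonneg mult_nonneg_nonneg divide_nonneg_nonneg) auto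
  have f1m: "f1 \<in> borel_measurable (sample_space n)"
    unfolding f1_def using X \<Lambda> Fm[OF hF] Fm[OF ZF] unfolding sM sD by (intro borel_measurable_times borel_measurable_diff borel_measurable_indicator)
  have f2m: "f2 \<in> borel_measurable (sample_space n)"
    unfolding f2_def using \<Lambda> Ts unfolding sD
    by (intro borel_measurable_times borel_measurable_indicator measurable_If_set) auto
  have f1b: "\<bar>f1 \<omega>\<bar> \<le> 1" for \<omega>
  proof -
    have "\<bar>indicator ?X \<omega> - h \<omega>\<bar> \<le> 1" using h01[of \<omega>] by (auto simp: indicator_def)
    then have "\<bar>indicator ?X \<omega> - h \<omega>\<bar> * \<bar>Z \<omega>\<bar> \<le> 1 * 1" using Z1 by (intro mult_mono) auto
    then show ?thesis unfolding f1_def by (auto simp: abs_mult indicator_def)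
  qed
  have f2b: "\<bar>f2 \<omega>\<bar> \<le> \<bar>exp (2 * d) - 1\<bar> + 1" for \<omega> unfolding f2_def by (auto simp: indicator_def)
  note f1i = integrable_cell_sum[OF \<nu> n q f1m f1b, of a b] integral_dcsbm[OF \<nu> n q f1m f1b, of a b]
  note f2i = integrable_cell_sum[OF \<nu> n q f2m f2b, of a b] integral_dcsbm[OF \<nu> n q f2m f2b, of a b]
  have sN: "sets ?N = sets (weight_space n)" by (rule sets_PiM_const) (rule \<nu>)
  have ae: "AE \<phi> in ?N. \<forall>w\<in>{1..n}. 0 \<le> \<phi> w"
    by (rule AE_finite_allI) (use \<nu> pos in \<open>auto intro!: AE_PiM_component\<close>)
  have "(\<integral>\<phi>. cell_sum q n a b f1 \<phi> \<partial>?N) \<le> (\<integral>\<phi>. cell_sum q n a b f2 \<phi> \<partial>?N)"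
  proof (rule integral_mono_AE[OF f1i(1) f2i(1)], use ae AE_space in eventually_elim)
    fix \<phi> assume p0: "\<forall>w\<in>{1..n}. 0 \<le> \<phi> w" and "\<phi> \<in> space ?N"
    then have pE: "\<phi> \<in> PiE {1..n} (\<lambda>_. UNIV)" using sets_eq_imp_space_eq[OF sN] by (simp add: space_PiM)
    have mem: "(\<sigma>, \<phi>, G, u) \<in> space (sample_space n)" if "\<sigma> \<in> spins q n" for \<sigma> G u
      using spins_PiE[OF that] pE by (simp add: space_sample_space)
    show "cell_sum q n a b f1 \<phi> \<le> cell_sum q n a b f2 \<phi>"
    proof (cases "\<forall>w\<in>{1..n}. \<phi> w < L")
      case False
      then have "f1 (\<sigma>, \<phi>, G, u) = 0" "f2 (\<sigma>, \<phi>, G, u) = 0" for \<sigma> G u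
        by (auto simp: f1_def f2_def trunc_event_def)
      then show ?thesis by (simp add: cell_sum_def)
    next
      case True
      have swap: "cell_sum q n a b f \<phi> = (\<Sum>G\<in>simple_graphs n. \<Sum>u\<in>{1..n}. \<Sum>\<sigma>\<in>spins q n.
          pair_lik n a b G (vertex_pairs n) \<sigma> \<phi> * f (\<sigma>, \<phi>, G, u)) / (real q ^ n * real n)" for f
        unfolding cell_sum_def cell_prob_def sum_divide_distrib
        by (subst sum.swap, rule sum.cong[OF refl], subst sum.swap) simp
      have "(\<Sum>\<sigma>\<in>spins q n. pair_lik n a b G (vertex_pairs n) \<sigma> \<phi> * f1 (\<sigma>, \<phi>, G, u)) \<le>
          (\<Sum>\<sigma>\<in>spins q n. pair_lik n a b G (vertex_pairs n) \<sigma> \<phi> * f2 (\<sigma>, \<phi>, G, u))"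
        if G: "G \<in> simple_graphs n" and u: "u \<in> {1..n}" for G u
      proof -
        note pt = part[OF G u]
        have V: "fst G = {1..n}" using G by (auto simp: simple_graphs_def)
        have "(\<Sum>\<sigma>\<in>spins q n. pair_lik n a b G (vertex_pairs n) \<sigma> \<phi> * f1 (\<sigma>, \<phi>, G, u)) =
          (\<Sum>\<sigma>\<in>spins q n. pair_lik n a b G (vertex_pairs n) \<sigma> \<phi> *
             ((of_bool (\<sigma> u = s) - ?lp \<sigma> \<phi> G u) * Z (\<sigma>, \<phi>, G, u)))"
          using True by (intro sum.cong refl)
            (auto simp: f1_def h[OF _ G u] trunc_event_def mem marked_spin_def indicator_def)
        also have "\<dots> \<le> (\<Sum>\<sigma>\<in>spins q n. pair_lik n a b G (vertex_pairs n) \<sigma> \<phi> *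
            (if \<sigma> \<in> spins q n \<and> (\<sigma>, \<phi>, G, u) \<in> T then exp (2 * d) - 1 else 1))"
        proof (rule local_posterior_error[where cap = cap and \<tau> = \<tau> and C = "C G u" and L = L and m = m,
              OF ab n nonneg])
          show "{x, y} \<notin> snd G" if "x \<in> A G u" "y \<in> C G u" for x y
            by (rule separates_no_edge[of G "B G u" "A G u" "C G u"]) (use pt V that in auto)
          show "\<phi> w \<le> L" if "w \<in> {1..n}" for w using True that by (simp add: less_imp_le)
          show "Z (override_on \<sigma> \<rho> (A G u), \<phi>, G, u) = Z (\<sigma>, \<phi>, G, u)"
            if "\<sigma> \<in> spins q n" "\<rho> \<in> PiE (A G u) (\<lambda>_. {1..q})" for \<sigma> \<rho>
          proof (rule observed_determined[OF ZF])
            have "override_on \<sigma> \<rho> (A G u) \<in> spins q n"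
              using override_on_PiE[of "A G u" "{1..n}" \<sigma> "{1..q}" \<rho>] that sub1[OF G u] unfolding spins_def by auto
            then show "(override_on \<sigma> \<rho> (A G u), \<phi>, G, u) \<in> space (sample_space n)" by (rule mem)
            show "(\<sigma>, \<phi>, G, u) \<in> space (sample_space n)" by (rule mem) (rule that)
            have "(Some \<circ> override_on \<sigma> \<rho> (A G u)) |` S G u = (Some \<circ> \<sigma>) |` S G u"
              using SA[OF G u] by (auto simp: restrict_map_def override_on_def fun_eq_iff)
            then show "observation n S U (override_on \<sigma> \<rho> (A G u), \<phi>, G, u) = observation n S U (\<sigma>, \<phi>, G, u)"
              by (simp add: observation_def)
          qed
          fix \<sigma> assume T: "\<sigma> \<in> spins q n \<and> (\<sigma>, \<phi>, G, u) \<in> T"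
          show "real (card (A G u \<union> B G u)) \<le> cap"
            using T by (simp add: T_def typical_event_def size_event_def)
          fix k assume k: "k \<in> {1..q}"
          have "(\<sigma>, \<phi>, G, u) \<notin> deviation_event n a b L (real n * m) \<tau> k"
            using T k by (simp add: T_def typical_event_def)
          then have "\<bar>(\<Sum>w\<in>{1..n}. clip L (\<phi> w) * (if k = \<sigma> w then a else b)) - real n * m\<bar> \<le> \<tau>"
            using mem T unfolding deviation_event_def by (simp add: not_less)
          moreover have "(\<Sum>w\<in>{1..n}. clip L (\<phi> w) * (if k = \<sigma> w then a else b)) =
              (\<Sum>w\<in>{1..n}. \<phi> w * (if k = \<sigma> w then a else b))"
            using True p0 by (intro sum.cong refl) (simp add: clip_def)
          ultimately show "\<bar>(\<Sum>w\<in>{1..n}. \<phi> w * (if k = \<sigma> w then a else b)) - real n * m\<bar> \<le> \<tau>" by simp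
        qed (use pt p0 L d Z1 in auto)
        also have "\<dots> = (\<Sum>\<sigma>\<in>spins q n. pair_lik n a b G (vertex_pairs n) \<sigma> \<phi> * f2 (\<sigma>, \<phi>, G, u))"
          using True by (intro sum.cong refl) (auto simp: f2_def trunc_event_def mem)
        finally show ?thesis .
      qed
      from sum_mono[OF sum_mono[OF this]] show ?thesis
        unfolding swap by (rule divide_right_mono) simp_all
    qed
  qed
  then have f12: "(\<integral>\<omega>. f1 \<omega> \<partial>?D) \<le> (\<integral>\<omega>. f2 \<omega> \<partial>?D)" unfolding f1i(2) f2i(2) .
  have mbD: "borel_measurable ?D = (borel_measurable (sample_space n) :: (sample \<Rightarrow> real) set)"
    by (rule measurable_cong_sets[OF sD refl])
  have "(\<integral>\<omega>. \<bar>P \<omega> - h \<omega>\<bar> \<partial>M) = (\<integral>\<omega>. Z \<omega> * P \<omega> - Z \<omega> * h \<omega> \<partial>M)"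
    unfolding Z_def by (intro Bochner_Integration.integral_cong refl) (simp add: abs_sgn algebra_simps)
  also have "\<dots> = (\<integral>\<omega>. Z \<omega> * P \<omega> \<partial>M) - (\<integral>\<omega>. Z \<omega> * h \<omega> \<partial>M)"
  proof (rule Bochner_Integration.integral_diff)
    show iZX: "integrable M (\<lambda>\<omega>. Z \<omega> * P \<omega>)"
      by (rule Bochner_Integration.integrable_bound[OF iP borel_measurable_times[OF ZM borel_measurable_integrable[OF iP]]])
         (use Z1 in \<open>auto simp: abs_mult intro!: mult_left_le_one_le\<close>)
    show "integrable M (\<lambda>\<omega>. Z \<omega> * h \<omega>)"
      by (rule Bochner_Integration.integrable_bound[OF ih borel_measurable_times[OF ZM hM]])
         (use Z1 in \<open>auto simp: abs_mult intro!: mult_left_le_one_le\<close>)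
  qed
  also have "(\<integral>\<omega>. Z \<omega> * P \<omega> \<partial>M) = (\<integral>\<omega>. Z \<omega> * indicator ?X \<omega> \<partial>M)"
    unfolding P_def cprob_def
  proof (rule M.real_cond_exp_intg(2)[OF _ ZF])
    show "integrable M (\<lambda>\<omega>. Z \<omega> * indicator ?X \<omega>)"
      by (rule M.integrable_const_bound[of _ 1])
         (use Z1 ZM X in \<open>auto simp: abs_mult indicator_def intro!: borel_measurable_times\<close>)
  qed (use X in simp)
  also have "(\<integral>\<omega>. Z \<omega> * indicator ?X \<omega> \<partial>M) - (\<integral>\<omega>. Z \<omega> * h \<omega> \<partial>M) = (\<integral>\<omega>. Z \<omega> * indicator ?X \<omega> - Z \<omega> * h \<omega> \<partial>M)"
  proof (rule Bochner_Integration.integral_diff[symmetric])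
    show "integrable M (\<lambda>\<omega>. Z \<omega> * indicator ?X \<omega>)"
      by (rule M.integrable_const_bound[of _ 1])
         (use Z1 ZM X in \<open>auto simp: abs_mult indicator_def intro!: borel_measurable_times\<close>)
    show "integrable M (\<lambda>\<omega>. Z \<omega> * h \<omega>)"
      by (rule Bochner_Integration.integrable_bound[OF ih borel_measurable_times[OF ZM hM]])
         (use Z1 in \<open>auto simp: abs_mult intro!: mult_left_le_one_le\<close>)
  qed
  also have "\<dots> = (\<integral>\<omega>. (Z \<omega> * indicator ?X \<omega> - Z \<omega> * h \<omega>) * indicator ?\<Lambda> \<omega> \<partial>?D) / measure ?D ?\<Lambda>"
    unfolding M_def
  proof (rule integral_uniform_measure[OF D.prob_space_axioms \<Lambda> trunc])
    show "(\<lambda>\<omega>. Z \<omega> * indicator ?X \<omega> - Z \<omega> * h \<omega>) \<in> borel_measurable ?D"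
      unfolding mbD using ZM hM X unfolding mb sM
      by (intro borel_measurable_diff borel_measurable_times borel_measurable_indicator)
  qed
  also have "(\<lambda>\<omega>. (Z \<omega> * indicator ?X \<omega> - Z \<omega> * h \<omega>) * indicator ?\<Lambda> \<omega>) = f1"
    unfolding f1_def by (simp add: fun_eq_iff algebra_simps)
  also have "(\<integral>\<omega>. f1 \<omega> \<partial>?D) / measure ?D ?\<Lambda> \<le> (\<integral>\<omega>. f2 \<omega> \<partial>?D) / measure ?D ?\<Lambda>"
    using f12 trunc by (intro divide_right_mono) auto
  also have "\<dots> = (\<integral>\<omega>. (if \<omega> \<in> T then exp (2 * d) - 1 else 1) \<partial>M)"
    unfolding M_def f2_def
  proof (rule integral_uniform_measure[OF D.prob_space_axioms \<Lambda> trunc, symmetric])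
    show "(\<lambda>\<omega>. if \<omega> \<in> T then exp (2 * d) - 1 else 1 :: real) \<in> borel_measurable ?D"
      unfolding mbD using Ts by (intro measurable_If_set) auto
  qed
  also have "\<dots> \<le> (\<integral>\<omega>. (exp (2 * d) - 1) + indicator (space M - T) \<omega> \<partial>M)"
  proof (rule integral_mono)
    have TM: "T \<in> sets M" using Ts sM by simp
    show "integrable M (\<lambda>\<omega>. if \<omega> \<in> T then exp (2 * d) - 1 else 1 :: real)"
      by (rule M.integrable_const_bound[of _ "\<bar>exp (2 * d) - 1\<bar> + 1"]) (use TM in \<open>auto intro!: measurable_If_set\<close>)
    show "integrable M (\<lambda>\<omega>. (exp (2 * d) - 1) + indicator (space M - T) \<omega> :: real)"
      by (rule M.integrable_const_bound[of _ "\<bar>exp (2 * d) - 1\<bar> + 1"]) (use TM in \<open>auto simp: indicator_def\<close>)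
    show "(if \<omega> \<in> T then exp (2 * d) - 1 else 1) \<le> (exp (2 * d) - 1) + (indicator (space M - T) \<omega> :: real)"
      if "\<omega> \<in> space M" for \<omega>
      using d0 that by (auto simp: indicator_def)
  qed
  also have "\<dots> = exp (2 * d) - 1 + measure M (space M - T)"
  proof (subst Bochner_Integration.integral_add)
    have "space M - T \<in> sets M" using Ts sM by auto
    then show "integrable M (indicator (space M - T) :: sample \<Rightarrow> real)"
      by (intro M.integrable_const_bound[of _ 1]) (auto simp: indicator_def)
    show "(\<integral>\<omega>. exp (2 * d) - 1 \<partial>M) + (\<integral>\<omega>. indicator (space M - T) \<omega> \<partial>M) =
        exp (2 * d) - 1 + measure M (space M - T)"
      by (simp_all add: M.prob_space Int_absorb2)
  qed simp
  finally have main: "(\<integral>\<omega>. \<bar>P \<omega> - h \<omega>\<bar> \<partial>M) \<le> exp (2 * d) - 1 + measure M (space M - T)" .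
  show ?thesis
    by (rule bexI[OF _ hF]) (use main h iP ih in \<open>simp add: P_def T_def\<close>)
qed

section \<open>Probabilities of the exceptional events and the limit\<close>

text \<open>
  By the union bound over the vertices, truncation at \<open>L\<close> is likely if the tail of \<open>\<nu>\<close> at \<open>L\<close> is
  small compared to \<open>1 / n\<close>.
\<close>

lemma trunc_event_prob:
  assumes \<nu>: "prob_space \<nu>" "sets \<nu> = sets borel" and n: "n \<ge> 1" and q: "q \<ge> 1"
  shows "measure (dcsbm q a b \<nu> n) (trunc_event n L) \<ge> 1 - real n * measure \<nu> {L..}"
proof -
  let ?D = "dcsbm q a b \<nu> n" and ?N = "PiM {1..n} (\<lambda>_. \<nu>)"
  interpret D: prob_space ?D by (rule prob_space_dcsbm[OF \<nu> n q])
  interpret N: prob_space ?N by (rule prob_space_PiM) (rule \<nu>)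
  have sD: "sets ?D = sets (sample_space n)" by (rule sets_dcsbm[OF \<nu>])
  have sN: "sets ?N = sets (weight_space n)" by (rule sets_PiM_const) (rule \<nu>)
  define H where "H w = {\<omega> \<in> space (sample_space n). L \<le> fst (snd \<omega>) w}" for w
  have H: "H w \<in> sets (sample_space n)" if "w \<in> {1..n}" for w
    unfolding H_def by (intro borel_measurable_le borel_measurable_const measurable_weight_coord that)
  have "measure ?D (H w) = measure \<nu> {L..}" if w: "w \<in> {1..n}" for w
  proof -
    have "measure ?D (H w) = (\<integral>\<omega>. indicator (H w) \<omega> \<partial>?D)"
      using H[OF w] sD sets.sets_into_space[OF H[OF w]] sets_eq_imp_space_eq[OF sD] by (simp add: Int_absorb2)
    also have "\<dots> = (\<integral>\<phi>. cell_sum q n a b (indicator (H w)) \<phi> \<partial>?N)"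
      by (rule integral_dcsbm[OF \<nu> n q, where B = 1]) (use H[OF w] in \<open>auto simp: indicator_def\<close>)
    also have "\<dots> = (\<integral>\<phi>. indicator {\<phi> \<in> space ?N. L \<le> \<phi> w} \<phi> \<partial>?N)"
    proof (rule Bochner_Integration.integral_cong[OF refl])
      fix \<phi> assume p: "\<phi> \<in> space ?N"
      then have pE: "\<phi> \<in> PiE {1..n} (\<lambda>_. UNIV)" using sets_eq_imp_space_eq[OF sN] by (simp add: space_PiM)
      have "cell_sum q n a b (indicator (H w)) \<phi> =
          cell_sum q n a b (\<lambda>_. indicator {\<phi> \<in> space ?N. L \<le> \<phi> w} \<phi>) \<phi>"
        unfolding cell_sum_def
        by (intro sum.cong refl arg_cong2[where f = "(*)"])
           (use p pE spins_PiE in \<open>auto simp: H_def indicator_def space_sample_space\<close>)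
      then show "cell_sum q n a b (indicator (H w)) \<phi> = indicator {\<phi> \<in> space ?N. L \<le> \<phi> w} \<phi>"
        by (simp only: cell_sum_const[OF n q])
    qed
    also have "\<dots> = measure ?N {\<phi> \<in> space ?N. L \<le> \<phi> w}"
    proof -
      have "{\<phi> \<in> space ?N. L \<le> \<phi> w} \<in> sets ?N"
        using measurable_component_singleton[OF w, of "\<lambda>_. borel :: real measure"]
        unfolding measurable_cong_sets[OF sN[symmetric] refl]
        by (intro borel_measurable_le borel_measurable_const)
      then show ?thesis by (simp add: Int_absorb2)
    qed
    also have "{\<phi> \<in> space ?N. L \<le> \<phi> w} = (\<lambda>\<phi>. \<phi> w) -` {L..} \<inter> space ?N" by auto
    also have "measure ?N \<dots> = measure (distr ?N \<nu> (\<lambda>\<phi>. \<phi> w)) {L..}"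
      by (rule measure_distr[symmetric]) (use \<nu>(2) w in \<open>auto intro!: measurable_component_singleton\<close>)
    also have "distr ?N \<nu> (\<lambda>\<phi>. \<phi> w) = \<nu>"
      by (rule distr_PiM_component[where M = "\<lambda>_. \<nu>", OF \<nu>(1) w])
    finally show ?thesis .
  qed
  then have "(\<Sum>w\<in>{1..n}. measure ?D (H w)) = real n * measure \<nu> {L..}" by simp
  moreover have "measure ?D (\<Union>w\<in>{1..n}. H w) \<le> (\<Sum>w\<in>{1..n}. measure ?D (H w))"
    by (rule measure_UNION_le) (use H sD in auto)
  moreover have "measure ?D (trunc_event n L) = 1 - measure ?D (\<Union>w\<in>{1..n}. H w)"
  proof -
    have "space ?D - trunc_event n L = (\<Union>w\<in>{1..n}. H w)"
      unfolding sets_eq_imp_space_eq[OF sD] by (auto simp: trunc_event_def H_def not_less not_le)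
    then show ?thesis
      using D.prob_compl[of "trunc_event n L"] sets_trunc_event sD by simp
  qed
  ultimately show ?thesis by linarith
qed

lemma atypical_prob:
  assumes \<nu>: "prob_space \<nu>" "sets \<nu> = sets borel" and n: "n \<ge> 1" and q: "q \<ge> 1"
    and ab: "0 < a" "a \<le> c0" "0 < b" "b \<le> c0" and L: "L > 0" and t: "t1 \<ge> 0" "t2 \<ge> 0"
    and trunc: "measure (dcsbm q a b \<nu> n) (trunc_event n L) \<ge> 1 / 2"
  defines "M \<equiv> uniform_measure (dcsbm q a b \<nu> n) (trunc_event n L)"
  shows "measure M (space M - typical_event q n a b A B L cap
       (real n * ((\<integral>x. clip L x \<partial>\<nu>) * mean_rate q a b)) (t1 + L * t2)) \<le>
    (1 - measure M (size_event n A B cap)) +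
    real q * (2 * (2 * exp (- 2 * t1 ^ 2 / (real n * (L * c0) ^ 2)) + 2 * exp (- 2 * t2 ^ 2 / (real n * c0 ^ 2))))"
proof -
  let ?D = "dcsbm q a b \<nu> n" and ?\<Lambda> = "trunc_event n L"
  let ?p = "2 * exp (- 2 * t1 ^ 2 / (real n * (L * c0) ^ 2)) + 2 * exp (- 2 * t2 ^ 2 / (real n * c0 ^ 2))"
  let ?E = "deviation_event n a b L (real n * ((\<integral>x. clip L x \<partial>\<nu>) * mean_rate q a b)) (t1 + L * t2)"
  interpret D: prob_space ?D by (rule prob_space_dcsbm[OF \<nu> n q])
  have sD: "sets ?D = sets (sample_space n)" by (rule sets_dcsbm[OF \<nu>])
  have sM: "sets M = sets (sample_space n)" unfolding M_def by (simp add: sD)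
  have \<Lambda>: "?\<Lambda> \<in> sets ?D" unfolding sD by (rule sets_trunc_event)
  have em: "emeasure ?D ?\<Lambda> \<noteq> 0" "emeasure ?D ?\<Lambda> \<noteq> \<infinity>"
    using trunc by (auto simp: D.emeasure_eq_measure)
  have pM: "prob_space M" unfolding M_def by (rule prob_space_uniform_measure[OF em])
  interpret M: prob_space M by (rule pM)
  have dev: "measure M (?E k) \<le> 2 * ?p" if k: "k \<in> {1..q}" for k
  proof -
    have E: "?E k \<in> sets ?D" unfolding sD by (rule sets_deviation_event)
    have "measure M (?E k) = measure ?D (?\<Lambda> \<inter> ?E k) / measure ?D ?\<Lambda>"
      unfolding M_def by (rule measure_uniform_measure[OF em E])
    also have "\<dots> \<le> measure ?D (?E k) / (1 / 2)"
      using trunc E by (intro frac_le D.finite_measure_mono) auto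
    also have "\<dots> \<le> 2 * ?p" using deviation_prob[OF \<nu> n q ab L t k] by simp
    finally show ?thesis .
  qed
  have S: "size_event n A B cap \<in> sets M" unfolding sM by (rule sets_size_event)
  have EM: "?E k \<in> sets M" for k unfolding sM by (rule sets_deviation_event)
  have "measure M (space M - typical_event q n a b A B L cap
       (real n * ((\<integral>x. clip L x \<partial>\<nu>) * mean_rate q a b)) (t1 + L * t2)) \<le>
     measure M ((space M - size_event n A B cap) \<union> (\<Union>k\<in>{1..q}. ?E k))"
    using S EM by (intro M.finite_measure_mono) (auto simp: typical_event_def)
  also have "\<dots> \<le> measure M (space M - size_event n A B cap) + measure M (\<Union>k\<in>{1..q}. ?E k)"
    using S EM by (intro measure_Un_le sets.compl_sets sets.finite_UN) auto
  also have "measure M (space M - size_event n A B cap) = 1 - measure M (size_event n A B cap)"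
    by (rule M.prob_compl[OF S])
  also have "measure M (\<Union>k\<in>{1..q}. ?E k) \<le> (\<Sum>k\<in>{1..q}. measure M (?E k))"
    by (rule measure_UNION_le) (use EM in auto)
  also have "(\<Sum>k\<in>{1..q}. measure M (?E k)) \<le> (\<Sum>k\<in>{1..q}. 2 * ?p)" by (intro sum_mono dev)
  also have "\<dots> = real q * (2 * ?p)" by simp
  finally show ?thesis by simp
qed

lemma induced_full: "G \<in> simple_graphs n \<Longrightarrow> induced G {1..n} = G"
  by (cases G) (auto simp: simple_graphs_def induced_def)

lemma restrict_map_eqD:
  assumes "(Some \<circ> \<sigma>) |` S = (Some \<circ> \<sigma>') |` S'"
  shows "S = S'" "w \<in> S \<Longrightarrow> \<sigma> w = \<sigma>' w"
proof -
  have eq: "((Some \<circ> \<sigma>) |` S) v = ((Some \<circ> \<sigma>') |` S') v" for v using assms by simp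
  show "S = S'"
  proof (rule set_eqI)
    show "v \<in> S \<longleftrightarrow> v \<in> S'" for v using eq[of v] by (auto simp: restrict_map_def split: if_splits)
  qed
  show "\<sigma> w = \<sigma>' w" if "w \<in> S" using eq[of w] that by (auto simp: restrict_map_def split: if_splits)
qed

lemma observation_eqD:
  assumes "observation n S U (\<sigma>, \<phi>, G, u) = observation n S U (\<sigma>', \<phi>', G', u')"
  shows "u' = u" "S G' u' = S G u" "U G' u' = U G u" "\<And>w. w \<in> S G u \<Longrightarrow> \<sigma> w = \<sigma>' w"
    "induced G (U G u) = induced G' (U G' u')"
    "\<And>w. w \<in> U G u \<Longrightarrow> w \<in> {1..n} \<Longrightarrow> \<phi> w = \<phi>' w"
proof -
  from assms have *: "u = u'" "(Some \<circ> \<sigma>) |` S G u = (Some \<circ> \<sigma>') |` S G' u'"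
    "induced G (U G u) = induced G' (U G' u')"
    "(\<lambda>w\<in>{1..n}. if w \<in> U G u then \<phi> w else 0) = (\<lambda>w\<in>{1..n}. if w \<in> U G' u' then \<phi>' w else 0)"
    unfolding observation_def prod.case prod.inject by blast+
  show "u' = u" by (rule *(1)[symmetric])
  show "S G' u' = S G u" by (rule restrict_map_eqD(1)[OF *(2), symmetric])
  show "\<sigma> w = \<sigma>' w" if "w \<in> S G u" for w by (rule restrict_map_eqD(2)[OF *(2) that])
  show "induced G (U G u) = induced G' (U G' u')" by (rule *(3))
  show U: "U G' u' = U G u" using arg_cong[OF *(3), of fst] by (simp add: induced_def)
  show "\<phi> w = \<phi>' w" if "w \<in> U G u" "w \<in> {1..n}" for w
    using fun_cong[OF *(4), of w] that U by simp
qed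

text \<open>
  The asymptotics of the error terms with weights below \<open>n powr (1/8)\<close>, at most \<open>n powr (1/9)\<close>
  vertices in \<open>A \<union> B\<close>, and deviations of order \<open>n powr (2/3)\<close>. The largest term in the first limit is
  of order \<open>n powr (1/9 + 1/8 + 2/3 - 1)\<close>.
\<close>

lemma powr_limits:
  fixes c0 :: real assumes c0: "c0 > 0"
  shows "(\<lambda>n. real n powr (1/9) * real n powr (1/8) *
      (c0 * real n powr (2/3) + real n powr (1/8) * (c0 * real n powr (13/24)) + real n powr (1/9) * real n powr (1/8) * c0) / real n
      + 2 * (real n powr (1/9) * real n * ((real n powr (1/8)) ^ 2 * c0 / real n) ^ 2)) \<longlonglongrightarrow> 0"
    and "(\<lambda>n. 2 * exp (- 2 * (c0 * real n powr (2/3)) ^ 2 / (real n * (real n powr (1/8) * c0) ^ 2))) \<longlonglongrightarrow> 0"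
    and "(\<lambda>n. 2 * exp (- 2 * (c0 * real n powr (13/24)) ^ 2 / (real n * c0 ^ 2))) \<longlonglongrightarrow> 0"
    and "eventually (\<lambda>n. (real n powr (1/8)) ^ 2 * c0 / real n \<le> 1 / 2) sequentially"
  using c0 by real_asymp+

lemma tail_limit: "\<beta> > 8 \<Longrightarrow> (\<lambda>n. real n * (real n powr (1/8)) powr (- \<beta>)) \<longlonglongrightarrow> 0" for \<beta> :: real
  by real_asymp

lemma cutoff_at_top: "filterlim (\<lambda>n. real n powr (1/8)) at_top sequentially"
  by real_asymp

theorem lemma4p1:
  fixes q s :: nat and a b \<phi>min \<beta> :: real and W :: "real set" and \<nu> :: "real measure"
    and A B C :: "graph \<Rightarrow> nat \<Rightarrow> nat set"
  assumes "q \<ge> 2" and "a > 0" and "b > 0" and "\<phi>min > 0"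
    and "prob_space \<nu>" and "sets \<nu> = sets borel"
    and "W \<subseteq> {\<phi>min..}" and "AE x in \<nu>. x \<in> W"
    and "\<beta> > 8" and "eventually (\<lambda>k::real. measure \<nu> {k..} \<le> k powr (-\<beta>)) at_top"
    and "s \<in> {1..q}"
    and partition: "\<And>n G u. G \<in> simple_graphs n \<Longrightarrow> u \<in> {1..n} \<Longrightarrow>
           A G u \<union> B G u \<union> C G u = {1..n} \<and>
           A G u \<inter> B G u = {} \<and> A G u \<inter> C G u = {} \<and> B G u \<inter> C G u = {} \<and>
           u \<in> A G u \<and> separates G (B G u) (A G u) (C G u)"
    and small: "(\<lambda>n. measure (dcsbm_trunc q a b \<nu> (1/8) n)
            {(\<sigma>, \<phi>, G, u) \<in> space (sample_space n).
               real (card (A G u \<union> B G u)) \<le> real n powr (1/9)}) \<longlonglongrightarrow> 1"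
  shows "\<exists>(\<Omega> :: nat \<Rightarrow> sample set) (\<epsilon> :: nat \<Rightarrow> real).
      (\<forall>n. \<Omega> n \<in> sets (dcsbm_trunc q a b \<nu> (1/8) n)) \<and>
      (\<lambda>n. measure (dcsbm_trunc q a b \<nu> (1/8) n) (\<Omega> n)) \<longlonglongrightarrow> 1 \<and>
      (\<forall>n. \<epsilon> n \<ge> 0) \<and> \<epsilon> \<longlonglongrightarrow> 0 \<and>
      (\<forall>n. \<forall>\<omega>\<in>\<Omega> n.
         \<bar>cprob (dcsbm_trunc q a b \<nu> (1/8) n)
            (observed n (\<lambda>G u. B G u \<union> C G u) (\<lambda>G u. {1..n})) (marked_spin n s) \<omega>
          - cprob (dcsbm_trunc q a b \<nu> (1/8) n)
            (observed n B (\<lambda>G u. A G u \<union> B G u)) (marked_spin n s) \<omega>\<bar> \<le> \<epsilon> n)"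
proof -
  define c0 where "c0 = max a b"
  have ab: "0 < a" "a \<le> c0" "0 < b" "b \<le> c0" using assms(2,3) by (auto simp: c0_def)
  have c0: "c0 > 0" using ab by linarith
  have q: "q \<ge> 1" using assms(1) by simp
  note \<nu> = \<open>prob_space \<nu>\<close> \<open>sets \<nu> = sets borel\<close>
  have pos: "AE x in \<nu>. 0 \<le> x"
    using \<open>AE x in \<nu>. x \<in> W\<close> by eventually_elim (use assms(4,7) in force)
  define L where "L n = real n powr (1/8)" for n :: nat
  define cap where "cap n = real n powr (1/9)" for n :: nat
  \<comment> \<open>\<open>t2\<close> is chosen so that \<open>L n * t2 n\<close> equals \<open>t1 n\<close>\<close>
  define t1 where "t1 n = c0 * real n powr (2/3)" for n :: nat
  define t2 where "t2 n = c0 * real n powr (13/24)" for n :: nat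
  define d where "d n = cap n * L n * (t1 n + L n * t2 n + cap n * L n * c0) / real n +
      2 * (cap n * real n * (L n ^ 2 * c0 / real n) ^ 2)" for n :: nat
  define p where "p n = 2 * exp (- 2 * t1 n ^ 2 / (real n * (L n * c0) ^ 2)) +
      2 * exp (- 2 * t2 n ^ 2 / (real n * c0 ^ 2))" for n :: nat
  define m where "m n = (\<integral>x. clip (L n) x \<partial>\<nu>) * mean_rate q a b" for n :: nat
  let ?D = "\<lambda>n. dcsbm q a b \<nu> n" and ?M = "\<lambda>n. dcsbm_trunc q a b \<nu> (1/8) n"
  have M: "?M n = uniform_measure (?D n) (trunc_event n (L n))" for n
    unfolding dcsbm_trunc_def trunc_event_def L_def ..
  define T where "T n = typical_event q n a b A B (L n) (cap n) (real n * m n) (t1 n + L n * t2 n)" for n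
  define \<eta> where "\<eta> n = exp (2 * d n) - 1 + measure (?M n) (space (?M n) - T n)" for n
  let ?P1 = "\<lambda>n. cprob (?M n) (observed n (\<lambda>G u. B G u \<union> C G u) (\<lambda>G u. {1..n})) (marked_spin n s)"
  let ?P2 = "\<lambda>n. cprob (?M n) (observed n B (\<lambda>G u. A G u \<union> B G u)) (marked_spin n s)"
  have nn: "L n \<ge> 0" "cap n \<ge> 0" "t1 n \<ge> 0" "t2 n \<ge> 0" for n
    using c0 by (simp_all add: L_def cap_def t1_def t2_def)
  have d0: "d n \<ge> 0" for n
    unfolding d_def using nn c0 by (intro add_nonneg_nonneg mult_nonneg_nonneg divide_nonneg_nonneg) auto
  have \<eta>0: "\<eta> n \<ge> 0" for n unfolding \<eta>_def using d0[of n] by simp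
  have sM: "sets (?M n) = sets (sample_space n)" for n
    unfolding M by (simp add: sets_dcsbm[OF \<nu>])

  \<comment> \<open>both conditional probabilities are close to a version of the same local posterior\<close>
  have key: "integrable (?M n) (\<lambda>\<omega>. \<bar>?P1 n \<omega> - ?P2 n \<omega>\<bar>) \<and> (\<integral>\<omega>. \<bar>?P1 n \<omega> - ?P2 n \<omega>\<bar> \<partial>?M n) \<le> 2 * \<eta> n"
    if n: "n \<ge> 1" and tr: "measure (?D n) (trunc_event n (L n)) \<ge> 1 / 2" and L: "L n ^ 2 * c0 / real n \<le> 1 / 2" for n
  proof -
    have tr0: "measure (?D n) (trunc_event n (L n)) > 0" using tr by linarith
    have tau: "t1 n + L n * t2 n \<ge> 0" using nn[of n] by simp
    interpret D: prob_space "?D n" by (rule prob_space_dcsbm[OF \<nu> n q])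
    note err = posterior_L1_error[where A = A and B = B and C = C and ?c0.0 = c0 and d = "d n" and n = n and s = s and m = "m n" and cap = "cap n",
        OF \<nu> pos n q ab nn(1) L nn(2) tau _ tr0 partition, folded M T_def, folded \<eta>_def]
    let ?valid = "\<lambda>h. \<forall>\<sigma>\<in>spins q n. \<forall>G\<in>simple_graphs n. \<forall>u\<in>{1..n}. \<forall>\<phi>.
       h (\<sigma>, \<phi>, G, u) = local_posterior q n a b s (A G u) (B G u) \<sigma> \<phi> G u"
    have "\<exists>h\<in>borel_measurable (observed n (\<lambda>G u. B G u \<union> C G u) (\<lambda>G u. {1..n})).
        ?valid h \<and> integrable (?M n) (\<lambda>\<omega>. ?P1 n \<omega> - h \<omega>) \<and> (\<integral>\<omega>. \<bar>?P1 n \<omega> - h \<omega>\<bar> \<partial>?M n) \<le> \<eta> n"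
    proof (rule err)
      fix G u assume "G \<in> simple_graphs n" "u \<in> {1..n}"
      from partition[OF this] show "(B G u \<union> C G u) \<inter> A G u = {}" by blast
    next
      fix \<sigma> \<sigma>' \<phi> \<phi>' G G' u u'
      assume G: "G \<in> simple_graphs n" "G' \<in> simple_graphs n" "u \<in> {1..n}" "u' \<in> {1..n}"
        and eq: "observation n (\<lambda>G u. B G u \<union> C G u) (\<lambda>G u. {1..n}) (\<sigma>, \<phi>, G, u) =
          observation n (\<lambda>G u. B G u \<union> C G u) (\<lambda>G u. {1..n}) (\<sigma>', \<phi>', G', u')"
      note D = observation_eqD[OF eq]
      have G': "G' = G" using D(5) G by (simp only: induced_full)
      note pt = partition[OF G(1,3)]
      have ph: "\<phi> w = \<phi>' w" if "w \<in> A G u \<union> B G u" for w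
        by (rule D(6)) (use that pt in blast)+
      show "local_posterior q n a b s (A G u) (B G u) \<sigma> \<phi> G u =
          local_posterior q n a b s (A G' u') (B G' u') \<sigma>' \<phi>' G' u'"
        unfolding D(1) G'
      proof (rule local_posterior_cong)
        show "\<sigma> w = \<sigma>' w" if "w \<in> B G u" for w by (rule D(4)) (use that in blast)
        show "u \<in> A G u" using pt by blast
      qed (use ph in blast)+
    qed (simp_all add: d_def)
    then obtain h1 where h1: "?valid h1" "integrable (?M n) (\<lambda>\<omega>. ?P1 n \<omega> - h1 \<omega>)"
      "(\<integral>\<omega>. \<bar>?P1 n \<omega> - h1 \<omega>\<bar> \<partial>?M n) \<le> \<eta> n" by blast
    have "\<exists>h\<in>borel_measurable (observed n B (\<lambda>G u. A G u \<union> B G u)).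
        ?valid h \<and> integrable (?M n) (\<lambda>\<omega>. ?P2 n \<omega> - h \<omega>) \<and> (\<integral>\<omega>. \<bar>?P2 n \<omega> - h \<omega>\<bar> \<partial>?M n) \<le> \<eta> n"
    proof (rule err)
      fix G u assume "G \<in> simple_graphs n" "u \<in> {1..n}"
      from partition[OF this] show "B G u \<inter> A G u = {}" by blast
    next
      fix \<sigma> \<sigma>' \<phi> \<phi>' G G' u u'
      assume G: "G \<in> simple_graphs n" "G' \<in> simple_graphs n" "u \<in> {1..n}" "u' \<in> {1..n}"
        and eq: "observation n B (\<lambda>G u. A G u \<union> B G u) (\<sigma>, \<phi>, G, u) =
          observation n B (\<lambda>G u. A G u \<union> B G u) (\<sigma>', \<phi>', G', u')"
      note D = observation_eqD[OF eq]
      note pt = partition[OF G(1,3)] partition[OF G(2,4)]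
      have "A G u \<inter> B G u = {}" "A G' u' \<inter> B G' u' = {}"
        using pt(1)[THEN conjunct2, THEN conjunct1] pt(2)[THEN conjunct2, THEN conjunct1] .
      then have "A G u = (A G u \<union> B G u) - B G u" "A G' u' = (A G' u' \<union> B G' u') - B G' u'" by blast+
      moreover have "(A G' u' \<union> B G' u') - B G' u' = (A G u \<union> B G u) - B G u"
        unfolding D(3) unfolding D(2) ..
      ultimately have AA: "A G' u' = A G u" by (simp only:)
      have E: "{e \<in> snd G. e \<subseteq> A G u \<union> B G u} = {e \<in> snd G'. e \<subseteq> A G u \<union> B G u}"
        using arg_cong[OF D(5), of snd] unfolding D(3) by (simp only: induced_def snd_conv)
      show "local_posterior q n a b s (A G u) (B G u) \<sigma> \<phi> G u =
          local_posterior q n a b s (A G' u') (B G' u') \<sigma>' \<phi>' G' u'"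
        unfolding AA D(2) unfolding D(1)
      proof (rule local_posterior_cong)
        show "\<sigma> w = \<sigma>' w" if "w \<in> B G u" for w by (rule D(4)[OF that])
        show "\<phi> w = \<phi>' w" if "w \<in> A G u \<union> B G u" for w
          by (rule D(6)[OF that]) (use that pt(1) in blast)
        show "u \<in> A G u" using pt(1) by blast
        fix w w' assume "w \<in> A G u \<union> B G u" "w' \<in> A G u \<union> B G u"
        then have "{w, w'} \<subseteq> A G u \<union> B G u" by blast
        then show "{w, w'} \<in> snd G \<longleftrightarrow> {w, w'} \<in> snd G'" using E by blast
      qed
    qed (simp_all add: d_def)
    then obtain h2 where h2: "?valid h2" "integrable (?M n) (\<lambda>\<omega>. ?P2 n \<omega> - h2 \<omega>)"
      "(\<integral>\<omega>. \<bar>?P2 n \<omega> - h2 \<omega>\<bar> \<partial>?M n) \<le> \<eta> n" by blast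
    have ae: "AE \<omega> in ?M n. h1 \<omega> = h2 \<omega>"
      unfolding M
    proof (rule AE_uniform_measureI)
      show "trunc_event n (L n) \<in> sets (?D n)" unfolding sets_dcsbm[OF \<nu>] by (rule sets_trunc_event)
      show "AE \<omega> in ?D n. \<omega> \<in> trunc_event n (L n) \<longrightarrow> h1 \<omega> = h2 \<omega>"
        using AE_dcsbm_valid[OF \<nu> n q, of a b]
      proof eventually_elim
        fix \<omega> :: sample
        obtain \<sigma> \<phi> G u where w: "\<omega> = (\<sigma>, \<phi>, G, u)" by (cases \<omega>)
        assume "fst \<omega> \<in> spins q n \<and> fst (snd (snd \<omega>)) \<in> simple_graphs n \<and> snd (snd (snd \<omega>)) \<in> {1..n}"
        then have "h1 \<omega> = h2 \<omega>" using h1(1) h2(1) unfolding w fst_conv snd_conv by metis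
        then show "\<omega> \<in> trunc_event n (L n) \<longrightarrow> h1 \<omega> = h2 \<omega>" ..
      qed
    qed
    have i12: "integrable (?M n) (\<lambda>\<omega>. \<bar>?P1 n \<omega> - h1 \<omega>\<bar> + \<bar>?P2 n \<omega> - h2 \<omega>\<bar>)"
      by (intro Bochner_Integration.integrable_add integrable_abs h1 h2)
    have mP: "?P1 n \<in> borel_measurable (?M n)" "?P2 n \<in> borel_measurable (?M n)"
      unfolding cprob_def by (rule borel_measurable_cond_exp2)+
    have ae2: "AE \<omega> in ?M n. \<bar>?P1 n \<omega> - ?P2 n \<omega>\<bar> \<le> \<bar>?P1 n \<omega> - h1 \<omega>\<bar> + \<bar>?P2 n \<omega> - h2 \<omega>\<bar>"
      using ae by eventually_elim linarith
    have i: "integrable (?M n) (\<lambda>\<omega>. \<bar>?P1 n \<omega> - ?P2 n \<omega>\<bar>)"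
      by (rule Bochner_Integration.integrable_bound[OF i12 borel_measurable_abs[OF borel_measurable_diff[OF mP]]])
         (use ae2 in eventually_elim, simp)
    have "(\<integral>\<omega>. \<bar>?P1 n \<omega> - ?P2 n \<omega>\<bar> \<partial>?M n) \<le> (\<integral>\<omega>. \<bar>?P1 n \<omega> - h1 \<omega>\<bar> + \<bar>?P2 n \<omega> - h2 \<omega>\<bar> \<partial>?M n)"
      by (rule integral_mono_AE[OF i i12 ae2])
    also have "\<dots> = (\<integral>\<omega>. \<bar>?P1 n \<omega> - h1 \<omega>\<bar> \<partial>?M n) + (\<integral>\<omega>. \<bar>?P2 n \<omega> - h2 \<omega>\<bar> \<partial>?M n)"
      by (intro Bochner_Integration.integral_add integrable_abs h1 h2)
    finally show ?thesis using i h1(3) h2(3) by simp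
  qed

  have evL: "eventually (\<lambda>n. L n ^ 2 * c0 / real n \<le> 1 / 2) sequentially"
    unfolding L_def by (rule powr_limits(4)[OF c0])
  have evT: "eventually (\<lambda>n. measure (?D n) (trunc_event n (L n)) \<ge> 1 / 2) sequentially"
  proof -
    have "eventually (\<lambda>n. measure \<nu> {L n..} \<le> L n powr (- \<beta>)) sequentially"
      using filterlim_iff[THEN iffD1, OF cutoff_at_top] assms(10) unfolding L_def by blast
    moreover have "eventually (\<lambda>n. real n * L n powr (- \<beta>) < 1 / 2) sequentially"
      unfolding L_def by (rule order_tendstoD(2)[OF tail_limit[OF assms(9)]]) simp
    ultimately show ?thesis
      using eventually_ge_at_top[of 1]
    proof eventually_elim
      case (elim n)
      have "real n * measure \<nu> {L n..} \<le> real n * L n powr (- \<beta>)" using elim(1) by (rule mult_left_mono) simp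
      then show ?case using trunc_event_prob[OF \<nu> elim(3) q, of "L n" a b] elim(2) by linarith
    qed
  qed
  define good where "good n \<longleftrightarrow> n \<ge> 1 \<and> measure (?D n) (trunc_event n (L n)) \<ge> 1 / 2 \<and> L n ^ 2 * c0 / real n \<le> 1 / 2" for n
  have evg: "eventually good sequentially"
    using evL evT eventually_ge_at_top[of 1] unfolding good_def by eventually_elim blast
  have pM: "prob_space (?M n)" if "good n" for n
  proof -
    interpret D: prob_space "?D n" by (rule prob_space_dcsbm[OF \<nu> _ q]) (use that in \<open>simp add: good_def\<close>)
    show ?thesis unfolding M
      by (rule prob_space_uniform_measure) (use that in \<open>auto simp: good_def D.emeasure_eq_measure\<close>)
  qed
  have lim_d: "d \<longlonglongrightarrow> 0"
    unfolding d_def cap_def L_def t1_def t2_def by (rule powr_limits(1)[OF c0])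
  have lim_p: "p \<longlonglongrightarrow> 0"
    using tendsto_add[OF powr_limits(2)[OF c0] powr_limits(3)[OF c0]] unfolding p_def L_def t1_def t2_def by simp
  have lim_s: "(\<lambda>n. measure (?M n) (size_event n A B (cap n))) \<longlonglongrightarrow> 1"
    using small unfolding size_event_def cap_def .
  have lim_\<eta>: "\<eta> \<longlonglongrightarrow> 0"
  proof (rule tendsto_sandwich[OF _ _ tendsto_const])
    show "eventually (\<lambda>n. 0 \<le> \<eta> n) sequentially" using \<eta>0 by simp
    show "eventually (\<lambda>n. \<eta> n \<le> exp (2 * d n) - 1 + ((1 - measure (?M n) (size_event n A B (cap n))) + real q * (2 * p n))) sequentially"
      using evg
    proof eventually_elim
      case (elim n)
      have L: "L n > 0" using elim by (simp add: L_def good_def)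
      from elim have n: "n \<ge> 1" and tr: "measure (?D n) (trunc_event n (L n)) \<ge> 1 / 2"
        unfolding good_def by blast+
      have "measure (?M n) (space (?M n) - T n) \<le>
          (1 - measure (?M n) (size_event n A B (cap n))) + real q * (2 * p n)"
        unfolding T_def M m_def p_def by (rule atypical_prob[OF \<nu> n q ab L nn(3,4) tr])
      then show ?case unfolding \<eta>_def by linarith
    qed
    have "(\<lambda>n. exp (2 * d n) - 1 + ((1 - measure (?M n) (size_event n A B (cap n))) + real q * (2 * p n)))
        \<longlonglongrightarrow> exp (2 * 0) - 1 + ((1 - 1) + real q * (2 * 0))"
      by (intro tendsto_intros lim_d lim_p lim_s)
    then show "(\<lambda>n. exp (2 * d n) - 1 + ((1 - measure (?M n) (size_event n A B (cap n))) + real q * (2 * p n)))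
        \<longlonglongrightarrow> 0" by simp
  qed
  \<comment> \<open>the summand \<open>1 / n\<close> keeps \<open>\<epsilon>\<close> positive, as Markov's inequality requires\<close>
  define \<epsilon> where "\<epsilon> n = sqrt (2 * \<eta> n) + 1 / real n" for n
  have \<epsilon>0: "\<epsilon> n \<ge> 0" for n unfolding \<epsilon>_def using \<eta>0[of n] by simp
  have "\<epsilon> \<longlonglongrightarrow> sqrt (2 * 0) + 0"
    unfolding \<epsilon>_def by (intro tendsto_intros lim_\<eta> lim_1_over_n)
  then have lim_\<epsilon>: "\<epsilon> \<longlonglongrightarrow> 0" by simp
  \<comment> \<open>for the finitely many other \<open>n\<close> the truncated law need not even be a probability measure\<close>
  define \<Omega> where "\<Omega> n = (if good n then {\<omega> \<in> space (?M n). \<bar>?P1 n \<omega> - ?P2 n \<omega>\<bar> \<le> \<epsilon> n} else {})" for n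
  have mP: "?P1 n \<in> borel_measurable (?M n)" "?P2 n \<in> borel_measurable (?M n)" for n
    unfolding cprob_def by (rule borel_measurable_cond_exp2)+
  have \<Omega>s: "\<Omega> n \<in> sets (?M n)" for n
  proof -
    have "{\<omega> \<in> space (?M n). \<bar>?P1 n \<omega> - ?P2 n \<omega>\<bar> \<le> \<epsilon> n} \<in> sets (?M n)"
      by (intro borel_measurable_le borel_measurable_abs borel_measurable_diff mP borel_measurable_const)
    then show ?thesis unfolding \<Omega>_def by simp
  qed
  have "(\<lambda>n. measure (?M n) (\<Omega> n)) \<longlonglongrightarrow> 1"
  proof (rule tendsto_sandwich)
    show "eventually (\<lambda>n. 1 - \<epsilon> n \<le> measure (?M n) (\<Omega> n)) sequentially"
      using evg
    proof eventually_elim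
      case (elim n)
      interpret prob_space "?M n" by (rule pM[OF elim])
      have n: "n \<ge> 1" using elim by (simp add: good_def)
      have k: "integrable (?M n) (\<lambda>\<omega>. \<bar>?P1 n \<omega> - ?P2 n \<omega>\<bar>)" "(\<integral>\<omega>. \<bar>?P1 n \<omega> - ?P2 n \<omega>\<bar> \<partial>?M n) \<le> 2 * \<eta> n"
        using key[of n] elim unfolding good_def by blast+
      have e: "\<epsilon> n > 0" unfolding \<epsilon>_def using \<eta>0[of n] n by (intro add_nonneg_pos) auto
      have "sqrt (2 * \<eta> n) \<le> \<epsilon> n" unfolding \<epsilon>_def by simp
      then have "sqrt (2 * \<eta> n) ^ 2 \<le> \<epsilon> n ^ 2" using \<eta>0[of n] by (intro power_mono) auto
      then have sq: "2 * \<eta> n \<le> \<epsilon> n * \<epsilon> n" using \<eta>0[of n] by (simp add: power2_eq_square)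
      have "measure (?M n) {\<omega> \<in> space (?M n). \<bar>?P1 n \<omega> - ?P2 n \<omega>\<bar> \<ge> \<epsilon> n} \<le> (\<integral>\<omega>. \<bar>?P1 n \<omega> - ?P2 n \<omega>\<bar> \<partial>?M n) / \<epsilon> n"
        by (rule integral_Markov_inequality_measure[OF k(1) sets.top _ e]) simp
      also have "\<dots> \<le> \<epsilon> n" using k(2) sq e by (simp add: divide_le_eq)
      finally have b: "measure (?M n) {\<omega> \<in> space (?M n). \<bar>?P1 n \<omega> - ?P2 n \<omega>\<bar> \<ge> \<epsilon> n} \<le> \<epsilon> n" .
      have "measure (?M n) (space (?M n) - \<Omega> n) \<le> measure (?M n) {\<omega> \<in> space (?M n). \<bar>?P1 n \<omega> - ?P2 n \<omega>\<bar> \<ge> \<epsilon> n}"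
      proof (rule finite_measure_mono)
        show "space (?M n) - \<Omega> n \<subseteq> {\<omega> \<in> space (?M n). \<bar>?P1 n \<omega> - ?P2 n \<omega>\<bar> \<ge> \<epsilon> n}"
          unfolding \<Omega>_def using elim by auto
        show "{\<omega> \<in> space (?M n). \<bar>?P1 n \<omega> - ?P2 n \<omega>\<bar> \<ge> \<epsilon> n} \<in> sets (?M n)"
          by (intro borel_measurable_le borel_measurable_abs borel_measurable_diff mP borel_measurable_const)
      qed
      then show ?case using b prob_compl[OF \<Omega>s] by linarith
    qed
    show "eventually (\<lambda>n. measure (?M n) (\<Omega> n) \<le> 1) sequentially"
      using evg by eventually_elim (rule prob_space.prob_le_1[OF pM])
    show "(\<lambda>n. 1 - \<epsilon> n) \<longlonglongrightarrow> 1" using tendsto_diff[OF tendsto_const lim_\<epsilon>, of 1] by simp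
  qed simp
  moreover have "\<forall>n. \<forall>\<omega>\<in>\<Omega> n. \<bar>?P1 n \<omega> - ?P2 n \<omega>\<bar> \<le> \<epsilon> n"
    unfolding \<Omega>_def by auto
  ultimately show ?thesis using \<Omega>s \<epsilon>0 lim_\<epsilon> by blast
qed

end
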